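(* Let $G$ be a connected $5$-chromatic graph on $n$ vertices and let $y\ge 4$ be an integer. Then $$Q_G(y) \le (y+1)\,y^{n-4}(y-1)(y-2)(y-3).$$ Moreover, equality holds for some integer $y\ge 4$ if and only if $G$ can be obtained from $K_5$ by adding a tree on each vertex of $K_5$ (in which case equality holds for every $y\in\mathbb{R}$).
   Context: Graphs are finite and simple, and $n=|V(G)|$. A graph is $5$-chromatic if its chromatic number equals $5$. For a positive integer $x$, an $x$-colouring of $G$ is a function $f:V(G)\to\{1,\dots,x\}$ with $f(u)\neq f(v)$ whenever $uv\in E(G)$ (colourings differing by a permutation of the colours are counted as different). The chromatic polynomial $P_G(x)$ is the polynomial of degree $n$ whose value at every positive integer $x$ is the number of $x$-colourings of $G$. The shifted chromatic polynomial is $Q_G(y)=P_G(y+1)$. "Obtained from $K_5$ by adding a tree on each vertex of $K_5$" means that $G$ is formed from a copy of $K_5$ by growing an arbitrary (possibly trivial, i.e. single-vertex) tree rooted at each vertex of the clique, the five trees being pairwise disjoint and each meeting the clique exactly in its root; equivalently, $G$ is obtained from $K_5$ by repeatedly adding leaves (vertices of degree $1$). *)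

theory Defs
  imports
    "Graph_Theory.Graph_Theory"
    "HOL-Library.FuncSet"
    "HOL-Library.Disjoint_Sets"
    "HOL-Computational_Algebra.Polynomial"
begin

text \<open>
  A finite simple graph is a \<open>pair_graph\<close>: a finite, loop-free, symmetric digraph whose arcs are
  pairs of vertices, an edge \<open>uv\<close> being represented by the two arcs \<open>(u, v)\<close> and \<open>(v, u)\<close>.

  Colourings are extensional functions, so that each colouring of the vertex set is counted once.
\<close>

definition colourings :: "'a pair_pre_digraph \<Rightarrow> nat \<Rightarrow> ('a \<Rightarrow> nat) set" where
  "colourings G x = {f \<in> pverts G \<rightarrow>\<^sub>E {1..x}. \<forall>(u, v) \<in> parcs G. f u \<noteq> f v}"

definition chromatic_number :: "'a pair_pre_digraph \<Rightarrow> nat" where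
  "chromatic_number G = (LEAST x. colourings G x \<noteq> {})"

definition is_chromatic_poly :: "'a pair_pre_digraph \<Rightarrow> real poly \<Rightarrow> bool" where
  "is_chromatic_poly G p \<longleftrightarrow> degree p = card (pverts G) \<and>
     (\<forall>x::nat. x > 0 \<longrightarrow> poly p (real x) = real (card (colourings G x)))"

definition chromatic_poly :: "'a pair_pre_digraph \<Rightarrow> real poly" where
  "chromatic_poly G = (THE p. is_chromatic_poly G p)"

definition shifted_chromatic_poly :: "'a pair_pre_digraph \<Rightarrow> real poly" where
  "shifted_chromatic_poly G = pcompose (chromatic_poly G) [:1, 1:]"

lemma poly_shifted_chromatic_poly:
  "poly (shifted_chromatic_poly G) y = poly (chromatic_poly G) (y + 1)"
  by (simp add: shifted_chromatic_poly_def poly_pcompose add.commute)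

text \<open>
  The library notion \<open>tree\<close> cannot be used for undirected trees: in a symmetric digraph every edge
  gives a directed cycle \<open>u, v, u\<close> of length 2. The cycles of an undirected simple graph are
  the directed cycles of length at least 3.
\<close>

definition undirected_tree :: "'a pair_pre_digraph \<Rightarrow> bool" where
  "undirected_tree T \<longleftrightarrow> pair_graph T \<and> Digraph_Component.connected (with_proj T) \<and>
     \<not> (\<exists>p. pre_digraph.cycle (with_proj T) p \<and> 3 \<le> length p)"

definition K5_with_trees :: "'a pair_pre_digraph \<Rightarrow> bool" where
  "K5_with_trees G \<longleftrightarrow>
     (\<exists>(K :: 'a pair_pre_digraph) (T :: 'a \<Rightarrow> 'a pair_pre_digraph).
        complete_digraph 5 (with_proj K) \<and>
        (\<forall>v \<in> pverts K. undirected_tree (T v) \<and> pverts (T v) \<inter> pverts K = {v}) \<and>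
        disjoint_family_on (\<lambda>v. pverts (T v)) (pverts K) \<and>
        pverts G = (\<Union>v \<in> pverts K. pverts (T v)) \<and>
        parcs G = parcs K \<union> (\<Union>v \<in> pverts K. parcs (T v)))"

text \<open>The chromatic polynomial is well defined.\<close>

lemma finite_colourings: "finite (pverts G) \<Longrightarrow> finite (colourings G x)"
  unfolding colourings_def by (rule finite_subset[of _ "pverts G \<rightarrow>\<^sub>E {1..x}"]) (auto intro: finite_PiE)

lemma card_colourings_image:
  assumes "pair_graph G" "finite S" "S \<subseteq> {1..x}"
  shows "card {f \<in> colourings G x. f ` pverts G = S} =
         card {f \<in> colourings G (card S). f ` pverts G = {1..card S}}"
proof -
  interpret pair_graph G by fact
  obtain g where g: "bij_betw g {1..card S} S"
    using ex_bij_betw_nat_finite_1[OF assms(2)] by blast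
  define h where "h = inv_into {1..card S} g"
  have h: "bij_betw h S {1..card S}" unfolding h_def using g by (rule bij_betw_inv_into)
  have gh: "g (h y) = y" if "y \<in> S" for y
    using that g unfolding h_def by (simp add: bij_betw_inv_into_right)
  have hg: "h (g y) = y" if "y \<in> {1..card S}" for y
    using that g unfolding h_def by (simp add: bij_betw_inv_into_left)
  have compose: "restrict (k \<circ> f) (pverts G) \<in> {f \<in> colourings G y. f ` pverts G = B}"
    if k: "bij_betw k A B" and A: "f \<in> {f \<in> colourings G z. f ` pverts G = A}" and B: "B \<subseteq> {1..y}"
    for k f A B y z
  proof -
    have im: "restrict (k \<circ> f) (pverts G) ` pverts G = B"
      using k A by (auto simp: bij_betw_def)
    have "f u \<noteq> f v \<and> f u \<in> A \<and> f v \<in> A \<and> u \<in> pverts G \<and> v \<in> pverts G"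
      if "(u, v) \<in> parcs G" for u v
      using that A wellformed'[OF that] by (auto simp: colourings_def)
    hence "\<forall>(u, v) \<in> parcs G. restrict (k \<circ> f) (pverts G) u \<noteq> restrict (k \<circ> f) (pverts G) v"
      using bij_betw_imp_inj_on[OF k] by (fastforce dest: inj_onD)
    moreover have "restrict (k \<circ> f) (pverts G) \<in> pverts G \<rightarrow>\<^sub>E {1..y}"
      using im B by (auto simp del: atLeastAtMost_iff)
    ultimately show ?thesis using im by (auto simp: colourings_def)
  qed
  have "bij_betw (\<lambda>f. restrict (h \<circ> f) (pverts G))
      {f \<in> colourings G x. f ` pverts G = S}
      {f \<in> colourings G (card S). f ` pverts G = {1..card S}}"
  proof (rule bij_betwI[where g = "\<lambda>f. restrict (g \<circ> f) (pverts G)"])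
    show "(\<lambda>f. restrict (h \<circ> f) (pverts G)) \<in> {f \<in> colourings G x. f ` pverts G = S} \<rightarrow>
        {f \<in> colourings G (card S). f ` pverts G = {1..card S}}"
      using compose[OF h] by blast
    show "(\<lambda>f. restrict (g \<circ> f) (pverts G)) \<in>
        {f \<in> colourings G (card S). f ` pverts G = {1..card S}} \<rightarrow>
        {f \<in> colourings G x. f ` pverts G = S}"
      using compose[OF g _ assms(3)] by blast
  next
    fix f assume f: "f \<in> {f \<in> colourings G x. f ` pverts G = S}"
    hence "f \<in> extensional (pverts G)" by (auto simp: colourings_def PiE_def)
    thus "restrict (g \<circ> restrict (h \<circ> f) (pverts G)) (pverts G) = f"
      using f gh by (auto simp: fun_eq_iff extensional_def restrict_def)
  next
    fix f assume f: "f \<in> {f \<in> colourings G (card S). f ` pverts G = {1..card S}}"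
    hence "f \<in> extensional (pverts G)" by (auto simp: colourings_def PiE_def)
    moreover have "f u \<in> {1..card S}" if "u \<in> pverts G" for u using f that by blast
    ultimately show "restrict (h \<circ> restrict (g \<circ> f) (pverts G)) (pverts G) = f"
      using hg by (auto simp: fun_eq_iff extensional_def restrict_def)
  qed
  thus ?thesis by (rule bij_betw_same_card)
qed

lemma ex1_chromatic_poly:
  assumes "pair_graph G"
  shows "\<exists>!p. is_chromatic_poly G p"
proof -
  interpret pair_graph G by fact
  define n where "n = card (pverts G)"
  define a where "a k = card {f \<in> colourings G k. f ` pverts G = {1..k}}" for k
  define q where "q k = (\<Prod>i<k. [:- real i, 1:])" for k
  define p where "p = (\<Sum>k\<le>n. smult (real (a k) / fact k) (q k))"
  have poly_q: "poly (q k) (real x) / fact k = real (x choose k)" for k x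
    by (simp add: q_def poly_prod binomial_gbinomial gbinomial_prod_rev atLeast0LessThan)
  have deg_q: "degree (q k) = k" for k
    unfolding q_def by (subst degree_prod_eq_sum_degree) auto
  have count: "card (colourings G x) = (\<Sum>k\<le>n. (x choose k) * a k)" for x
  proof -
    let ?B = "\<lambda>S. {f \<in> colourings G x. f ` pverts G = S}"
    let ?I = "{S. S \<subseteq> {1..x} \<and> card S \<le> n}"
    have im: "f ` pverts G \<in> ?I" if "f \<in> colourings G x" for f
      using that pair_finite_verts by (auto simp: colourings_def n_def card_image_le)
    have finI: "finite ?I" by (rule finite_subset[of _ "Pow {1..x}"]) auto
    have "card (colourings G x) = card (\<Union>S\<in>?I. ?B S)"
      using im by (intro arg_cong[where f = card]) blast
    also have "\<dots> = (\<Sum>S\<in>?I. card (?B S))"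
      using finI finite_colourings[OF pair_finite_verts] by (intro card_UN_disjoint) auto
    also have "\<dots> = (\<Sum>S\<in>?I. a (card S))"
      unfolding a_def using assms
      by (intro sum.cong refl card_colourings_image) (auto intro: finite_subset)
    also have "\<dots> = (\<Sum>k\<le>n. \<Sum>S\<in>{S \<in> ?I. card S = k}. a (card S))"
      using finI by (intro sum.group[symmetric]) auto
    also have "\<dots> = (\<Sum>k\<le>n. \<Sum>S\<in>{S. S \<subseteq> {1..x} \<and> card S = k}. a k)"
      by (intro sum.cong refl) auto
    also have "\<dots> = (\<Sum>k\<le>n. (x choose k) * a k)"
      using n_subsets[of "{1..x}"] by simp
    finally show ?thesis .
  qed
  have val: "poly p (real x) = real (card (colourings G x))" for x
  proof -
    have "poly p (real x) = (\<Sum>k\<le>n. real (a k) * (poly (q k) (real x) / fact k))"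
      by (simp add: p_def poly_sum)
    also have "\<dots> = real (card (colourings G x))"
      unfolding poly_q count by (simp add: mult.commute)
    finally show ?thesis .
  qed
  have "a n > 0"
  proof -
    obtain g where g: "bij_betw g (pverts G) {1..n}"
      using bij_betw_iff_card[of "pverts G" "{1..n}"] pair_finite_verts by (auto simp: n_def)
    have "restrict g (pverts G) u \<noteq> restrict g (pverts G) v" if "(u, v) \<in> parcs G" for u v
      using pair_no_loops[OF that] wellformed'[OF that] g by (auto simp: bij_betw_def inj_on_def)
    moreover have "restrict g (pverts G) \<in> pverts G \<rightarrow>\<^sub>E {1..n}"
      using g by (auto simp: bij_betw_def simp del: atLeastAtMost_iff)
    ultimately have "restrict g (pverts G) \<in> colourings G n"
      unfolding colourings_def by blast
    moreover have "restrict g (pverts G) ` pverts G = {1..n}"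
      using g by (simp add: bij_betw_def)
    ultimately have "restrict g (pverts G) \<in> {f \<in> colourings G n. f ` pverts G = {1..n}}"
      by blast
    moreover have "finite {f \<in> colourings G n. f ` pverts G = {1..n}}"
      using finite_colourings[OF pair_finite_verts] by auto
    ultimately show ?thesis unfolding a_def card_gt_0_iff by blast
  qed
  have "coeff p n = (\<Sum>k\<le>n. real (a k) / fact k * coeff (q k) n)"
    by (simp add: p_def coeff_sum)
  also have "\<dots> = (\<Sum>k\<in>{n}. real (a k) / fact k * coeff (q k) n)"
    by (rule sum.mono_neutral_right) (auto simp: coeff_eq_0 deg_q)
  also have "\<dots> \<noteq> 0"
  proof -
    have "q n \<noteq> 0" by (simp add: q_def)
    hence "coeff (q n) n \<noteq> 0" using leading_coeff_neq_0[of "q n"] by (simp add: deg_q)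
    thus ?thesis using \<open>a n > 0\<close> by simp
  qed
  finally have "n \<le> degree p" by (rule le_degree)
  moreover have "degree p \<le> n"
    unfolding p_def by (intro degree_sum_le) (auto intro: order.trans[OF degree_smult_le] simp: deg_q)
  ultimately have "is_chromatic_poly G p"
    using val by (simp add: is_chromatic_poly_def n_def)
  moreover have "r = s" if "is_chromatic_poly G r" "is_chromatic_poly G s" for r s
  proof (rule ccontr)
    assume "r \<noteq> s"
    hence "finite {z. poly (r - s) z = 0}" by (intro poly_roots_finite) simp
    moreover have "real ` {0<..} \<subseteq> {z. poly (r - s) z = 0}"
      using that by (auto simp: is_chromatic_poly_def)
    ultimately have "finite (real ` {0<..})" by (rule finite_subset[rotated])
    hence "finite {0::nat<..}" by (rule finite_imageD) simp
    thus False using infinite_Ioi by blast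
  qed
  ultimately show ?thesis by blast
qed

lemma is_chromatic_poly_chromatic_poly:
  "pair_graph G \<Longrightarrow> is_chromatic_poly G (chromatic_poly G)"
  unfolding chromatic_poly_def by (rule theI'[OF ex1_chromatic_poly])

end

theory Submission
imports Defs "HOL-Analysis.Convex"
begin

text \<open>Put \<open>x = y + 1\<close>. A connected graph can be built up one vertex at a time, each new vertex being
  adjacent to an old one; this multiplies the number of \<open>x\<close>-colourings by at most \<open>y\<close>, and by
  exactly \<open>y\<close> only if the new vertex is a leaf (or if all its old neighbours always share a colour).
  Starting from a vertex-critical subgraph, it is therefore enough to know that \<open>K\<^sub>5\<close> attains the bound
  and that every connected graph on \<open>n \<ge> 6\<close> vertices which is not 4-colourable and has minimum degree
  at least 4 stays strictly below it (\<open>card_cols_less_bound\<close>).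

  The strict inequality is proved by counting with random orders. If a colouring is revealed along an
  order of the vertices, a vertex whose earlier neighbours show \<open>J\<close> colours has \<open>y + 1 - J\<close> possible
  colours; compared with \<open>y\<close>, the value in a tree, it gains \<open>ln (y / (y + 1 - J))\<close>. Averaging the
  logarithms over all orders and all colourings shows that the mean total gain is at most
  \<open>n ln y - ln P\<close>, where \<open>P\<close> is the number of colourings (\<open>sum_gain_le\<close>). If \<open>P\<close> reached the bound, this
  would be at most the number \<open>clique_gain y\<close>, which depends on \<open>y\<close> alone. It is contradicted by bounding
  the gains from below.

  In a random order a vertex has a uniformly distributed rank among itself and any set of its
  neighbours. Hence a vertex that sees four colours gains at least \<open>clique_gain y / 5\<close> on average, one
  that sees two or three gains something, and only a vertex with a monochromatic neighbourhood loses.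
  Such vertices are rare, by induction on \<open>n\<close>: identifying four neighbours gives a connected graph with
  \<open>n - 3\<close> vertices that is still not 4-colourable, so the number of colourings that are constant on the
  four is at most the bound divided by \<open>y\<^sup>3\<close>, a small fraction of \<open>P\<close>. In a colouring with five colours each class contains a vertex that sees the four
  other colours, since otherwise the class could be dissolved; these five vertices alone gain as much
  as \<open>K\<^sub>5\<close> does, and all others are profit. This settles \<open>y = 4\<close>. For \<open>y \<ge> 5\<close> and \<open>n \<le> 10\<close> a
  colouring with more classes can be coarsened until any two classes are joined by an edge; six classes
  then force so many colours to be seen that the gain is again larger than \<open>clique_gain y\<close>. For \<open>y \<ge> 5\<close>
  and \<open>n \<ge> 11\<close> it suffices to look at four fixed neighbours of every vertex: by the
  same induction they have at most two colours in a minority of the colourings only, and eleven vertices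
  that mostly see three colours gain enough.

  Finally, the graphs grown from a 5-clique by adding leaves are the 5-cliques with trees attached
  to their vertices: two edges from a new vertex to a connected part of a tree close a cycle, and a
  leaf lies on no cycle of length at least 3.\<close>

section \<open>Colourings of a relation on a finite set\<close>

text \<open>A graph is a vertex set \<open>V\<close> with a relation \<open>E\<close> of which only the part inside \<open>V\<close> matters, so
  that an induced subgraph is obtained by shrinking \<open>V\<close> and keeping \<open>E\<close>. Loops are not excluded;
  they make the graph uncolourable, which keeps the identification of vertices free of side conditions.\<close>

definition proper_on :: "'a set \<Rightarrow> ('a \<times> 'a) set \<Rightarrow> ('a \<Rightarrow> 'b) \<Rightarrow> bool" where
  "proper_on V E f \<longleftrightarrow> (\<forall>u\<in>V. \<forall>v\<in>V. (u, v) \<in> E \<longrightarrow> f u \<noteq> f v)"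

definition cols :: "'a set \<Rightarrow> ('a \<times> 'a) set \<Rightarrow> nat \<Rightarrow> ('a \<Rightarrow> nat) set" where
  "cols V E x = {f \<in> V \<rightarrow>\<^sub>E {1..x}. proper_on V E f}"

definition nbrs :: "'a set \<Rightarrow> ('a \<times> 'a) set \<Rightarrow> 'a \<Rightarrow> 'a set" where
  "nbrs V E v = {u \<in> V. (u, v) \<in> E}"

lemma finite_cols: "finite V \<Longrightarrow> finite (cols V E x)"
  unfolding cols_def by (rule finite_subset[of _ "V \<rightarrow>\<^sub>E {1..x}"]) (auto intro: finite_PiE)

lemma finite_nbrs: "finite V \<Longrightarrow> finite (nbrs V E v)"
  by (simp add: nbrs_def)

lemma cols_eqI: "f \<in> cols V E x \<Longrightarrow> g \<in> cols V E x \<Longrightarrow> (\<And>v. v \<in> V \<Longrightarrow> f v = g v) \<Longrightarrow> f = g"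
  unfolding cols_def by (auto intro: PiE_ext)

lemma bij_betw_cols_insert:
  assumes "m \<notin> S" "(m, m) \<notin> E" "sym E"
  shows "bij_betw (\<lambda>(c, k). c(m := k))
    (SIGMA c:cols S E x. {1..x} - c ` nbrs S E m) (cols (insert m S) E x)"
proof (rule bij_betwI[where g = "\<lambda>f. (restrict f S, f m)"])
  show "(\<lambda>(c, k). c(m := k)) \<in> (SIGMA c:cols S E x. {1..x} - c ` nbrs S E m) \<rightarrow> cols (insert m S) E x"
  proof (clarsimp, goal_cases)
    case (1 c k)
    then have c: "c \<in> S \<rightarrow>\<^sub>E {1..x}" "proper_on S E c" by (auto simp: cols_def)
    have k: "k \<noteq> c u" if "u \<in> S" "(u, m) \<in> E" for u using 1 that by (auto simp: nbrs_def)
    have "c(m := k) \<in> insert m S \<rightarrow>\<^sub>E {1..x}" using c(1) 1 by (auto simp: PiE_iff extensional_def)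
    moreover have "proper_on (insert m S) E (c(m := k))"
      unfolding proper_on_def
    proof (intro ballI impI)
      fix u v assume uv: "u \<in> insert m S" "v \<in> insert m S" "(u, v) \<in> E"
      then have vu: "(v, u) \<in> E" using assms(3) by (auto dest: symD)
      show "(c(m := k)) u \<noteq> (c(m := k)) v"
        using uv vu c(2) k[of u] k[of v] assms(1,2) by (auto simp: proper_on_def)
    qed
    ultimately show ?case by (simp add: cols_def)
  qed
next
  show "(\<lambda>f. (restrict f S, f m)) \<in> cols (insert m S) E x \<rightarrow> (SIGMA c:cols S E x. {1..x} - c ` nbrs S E m)"
    using assms by (auto simp: cols_def nbrs_def proper_on_def PiE_iff extensional_def)
next
  fix a assume "a \<in> (SIGMA c:cols S E x. {1..x} - c ` nbrs S E m)"
  then show "(restrict ((case a of (c, k) \<Rightarrow> c(m := k))) S, (case a of (c, k) \<Rightarrow> c(m := k)) m) = a"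
    using assms(1) by (auto simp: cols_def fun_eq_iff PiE_iff extensional_def restrict_def)
next
  fix f assume "f \<in> cols (insert m S) E x"
  then show "(case (restrict f S, f m) of (c, k) \<Rightarrow> c(m := k)) = f"
    by (auto simp: cols_def fun_eq_iff PiE_iff extensional_def restrict_def)
qed

lemma sum_cols_insert:
  fixes F :: "('a \<Rightarrow> nat) \<Rightarrow> 'c::comm_monoid_add"
  assumes "m \<notin> S" "(m, m) \<notin> E" "sym E" "finite S"
  shows "(\<Sum>c\<in>cols (insert m S) E x. F c)
    = (\<Sum>c\<in>cols S E x. \<Sum>k\<in>{1..x} - c ` nbrs S E m. F (c(m := k)))"
proof -
  have "(\<Sum>c\<in>cols (insert m S) E x. F c)
    = (\<Sum>z\<in>(SIGMA c:cols S E x. {1..x} - c ` nbrs S E m). F (case z of (c, k) \<Rightarrow> c(m := k)))"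
    using sum.reindex_bij_betw[OF bij_betw_cols_insert[OF assms(1-3)], of F] by simp
  also have "\<dots> = (\<Sum>c\<in>cols S E x. \<Sum>k\<in>{1..x} - c ` nbrs S E m. F (c(m := k)))"
    using finite_cols[OF assms(4)] by (subst sum.Sigma) (auto intro!: sum.cong)
  finally show ?thesis .
qed

lemma cols_image_subset: "c \<in> cols V E x \<Longrightarrow> A \<subseteq> V \<Longrightarrow> c ` A \<subseteq> {1..x}"
  by (auto simp: cols_def PiE_iff)

lemma card_free_colours:
  assumes "c \<in> cols S E x" "finite S"
  shows "card ({1..x} - c ` nbrs S E m) = x - card (c ` nbrs S E m)"
proof -
  have "c ` nbrs S E m \<subseteq> {1..x}" by (rule cols_image_subset[OF assms(1)]) (auto simp: nbrs_def)
  then show ?thesis by (subst card_Diff_subset) (auto intro: finite_subset)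
qed

lemma card_cols_insert:
  assumes "m \<notin> S" "(m, m) \<notin> E" "sym E" "finite S"
  shows "card (cols (insert m S) E x) = (\<Sum>c\<in>cols S E x. x - card (c ` nbrs S E m))"
  using sum_cols_insert[OF assms, where x = x and F = "\<lambda>_. 1::nat"] card_free_colours[OF _ assms(4)] by simp

lemma seen_le:
  assumes "c \<in> cols V E x" "v \<in> V" "finite V"
  shows "card (c ` nbrs V E v) < x"
proof -
  have "c ` nbrs V E v \<subseteq> {1..x} - {c v}"
    using assms by (auto simp: cols_def nbrs_def proper_on_def PiE_iff)
  then have "card (c ` nbrs V E v) \<le> card ({1..x} - {c v})" by (intro card_mono) auto
  also have "\<dots> < x" using assms(1,2) by (auto simp: cols_def PiE_iff)
  finally show ?thesis .
qed

section \<open>Revealing a colouring along a random order\<close>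

text \<open>Guess a colouring along the order \<open>p\<close>, choosing the colour of each vertex uniformly among those not
  shown by its earlier neighbours. The product is the probability of guessing \<open>c\<close>, and these
  probabilities add up to at most 1.\<close>

lemma sequential_bound:
  fixes p :: "'a \<Rightarrow> nat"
  assumes "finite V" "sym E" "inj_on p V"
  shows "(\<Sum>c\<in>cols V E x. \<Prod>v\<in>V. 1 / real (x - card (c ` {u \<in> nbrs V E v. p u < p v}))) \<le> 1"
  using assms(1,3)
proof (induction V rule: finite_ranking_induct[where f = p])
  case empty
  then show ?case by (auto simp: cols_def proper_on_def)
next
  case (insert m S)
  show ?case
  proof (cases "m \<in> S")
    case True
    then have "insert m S = S" by auto
    with insert show ?thesis by simp
  next
    case False
    have lt: "p u < p m" if "u \<in> S" for u
      using insert.hyps(2)[OF that] insert.prems that False by (auto simp: inj_on_def order_less_le)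
    show ?thesis
    proof (cases "(m, m) \<in> E")
      case True
      then have "cols (insert m S) E x = {}" by (auto simp: cols_def proper_on_def)
      then show ?thesis by simp
    next
      case nl: False
      define w :: "'a set \<Rightarrow> ('a \<Rightarrow> nat) \<Rightarrow> 'a \<Rightarrow> real" where "w V c v = 1 / real (x - card (c ` {u \<in> nbrs V E v. p u < p v}))" for V c v
      have "(\<Sum>c\<in>cols (insert m S) E x. \<Prod>v\<in>insert m S. w (insert m S) c v)
          = (\<Sum>c\<in>cols S E x. \<Sum>k\<in>{1..x} - c ` nbrs S E m. \<Prod>v\<in>insert m S. w (insert m S) (c(m := k)) v)"
        by (rule sum_cols_insert[OF False nl assms(2) insert.hyps(1)])
      also have "\<dots> \<le> (\<Sum>c\<in>cols S E x. \<Prod>v\<in>S. w S c v)"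
      proof (rule sum_mono)
        fix c assume c: "c \<in> cols S E x"
        let ?J = "card (c ` nbrs S E m)"
        have wm: "w (insert m S) (c(m := k)) m = 1 / real (x - ?J)" for k
        proof -
          have "{u \<in> nbrs (insert m S) E m. p u < p m} = nbrs S E m"
            using lt nl by (auto simp: nbrs_def)
          moreover have "(c(m := k)) ` nbrs S E m = c ` nbrs S E m"
            using False by (auto simp: nbrs_def)
          ultimately show ?thesis by (simp add: w_def)
        qed
        have wS: "w (insert m S) (c(m := k)) v = w S c v" if "v \<in> S" for k v
        proof -
          have "{u \<in> nbrs (insert m S) E v. p u < p v} = {u \<in> nbrs S E v. p u < p v}"
            using lt[OF that] by (auto simp: nbrs_def)
          moreover have "(c(m := k)) ` {u \<in> nbrs S E v. p u < p v} = c ` {u \<in> nbrs S E v. p u < p v}"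
            using False by (intro image_cong) (auto simp: nbrs_def)
          ultimately show ?thesis by (simp add: w_def)
        qed
        have "(\<Sum>k\<in>{1..x} - c ` nbrs S E m. \<Prod>v\<in>insert m S. w (insert m S) (c(m := k)) v)
            = (\<Sum>k\<in>{1..x} - c ` nbrs S E m. 1 / real (x - ?J) * (\<Prod>v\<in>S. w S c v))"
          using False insert.hyps(1) by (intro sum.cong refl) (simp add: wm wS cong: prod.cong)
        also have "\<dots> = real (x - ?J) * (1 / real (x - ?J)) * (\<Prod>v\<in>S. w S c v)"
          using card_free_colours[OF c insert.hyps(1), of m] by (simp only: sum_constant mult.assoc)
        also have "\<dots> \<le> 1 * (\<Prod>v\<in>S. w S c v)"
          by (intro mult_right_mono prod_nonneg) (auto simp: w_def)
        finally show "(\<Sum>k\<in>{1..x} - c ` nbrs S E m. \<Prod>v\<in>insert m S. w (insert m S) (c(m := k)) v)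
          \<le> (\<Prod>v\<in>S. w S c v)" by simp
      qed
      also have "\<dots> \<le> 1"
        unfolding w_def using insert.IH insert.prems by (auto intro: inj_on_subset)
      finally show ?thesis by (simp add: w_def)
    qed
  qed
qed

definition orders :: "'a set \<Rightarrow> ('a \<Rightarrow> nat) set" where
  "orders V = {p \<in> V \<rightarrow>\<^sub>E {..<card V}. inj_on p V}"

lemma finite_orders: "finite V \<Longrightarrow> finite (orders V)"
  unfolding orders_def by (rule finite_subset[of _ "V \<rightarrow>\<^sub>E {..<card V}"]) (auto intro: finite_PiE)

lemma orders_nonempty:
  assumes "finite V" shows "orders V \<noteq> {}"
proof -
  obtain h where "bij_betw h V {0..<card V}" using ex_bij_betw_finite_nat[OF assms] by blast
  then have "restrict h V \<in> orders V"
    by (auto simp: orders_def bij_betw_def inj_on_def)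
  then show ?thesis by blast
qed

lemma card_orders_pos: "finite V \<Longrightarrow> 0 < card (orders V)"
  using finite_orders orders_nonempty by (auto simp: card_gt_0_iff)

lemma unique_rank:
  fixes p :: "'a \<Rightarrow> nat"
  assumes "finite X" "inj_on p X" "k < card X"
  shows "card {w \<in> X. card {u \<in> X. p u < p w} = k} = 1"
proof -
  define r where "r w = card {u \<in> X. p u < p w}" for w
  have less: "r w < r w'" if "w \<in> X" "w' \<in> X" "p w < p w'" for w w'
    unfolding r_def using that assms(1) by (intro psubset_card_mono) auto
  have inj: "inj_on r X"
  proof (rule inj_onI)
    fix a b assume ab: "a \<in> X" "b \<in> X" "r a = r b"
    then have "p a = p b" using less[of a b] less[of b a] by (metis less_irrefl linorder_neqE_nat)
    then show "a = b" using assms(2) ab by (auto simp: inj_on_def)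
  qed
  have "r ` X \<subseteq> {..<card X}"
  proof
    fix i assume "i \<in> r ` X"
    then obtain w where "w \<in> X" "i = r w" by auto
    moreover have "r w < card X" if "w \<in> X" for w
      unfolding r_def using that assms(1) by (intro psubset_card_mono) auto
    ultimately show "i \<in> {..<card X}" by auto
  qed
  moreover have "card (r ` X) = card {..<card X}" using card_image[OF inj] by simp
  ultimately have "r ` X = {..<card X}" by (intro card_subset_eq) auto
  then obtain w where w: "w \<in> X" "r w = k" using assms(3) by (metis imageE lessThan_iff)
  then have "{w \<in> X. r w = k} = {w}" using inj by (auto simp: inj_on_def)
  then show ?thesis by (simp add: r_def)
qed

lemma orders_transpose:
  assumes "p \<in> orders V" "v \<in> V" "w \<in> V"
  shows "p \<circ> Transposition.transpose v w \<in> orders V"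
proof -
  have "inj_on (p \<circ> Transposition.transpose v w) V"
  proof (rule comp_inj_on)
    show "inj_on (Transposition.transpose v w) V" by (rule inj_on_subset[OF inj_transpose]) simp
    have "Transposition.transpose v w ` V = V" using assms by (simp add: Transposition.transpose_image_eq)
    then show "inj_on p (Transposition.transpose v w ` V)" using assms by (simp add: orders_def)
  qed
  moreover have "(p \<circ> Transposition.transpose v w) u \<in> {..<card V}" if "u \<in> V" for u
  proof -
    have "Transposition.transpose v w u \<in> V" using that assms by (auto simp: Transposition.transpose_def)
    then show ?thesis using assms(1) by (auto simp: orders_def PiE_iff)
  qed
  moreover have "(p \<circ> Transposition.transpose v w) u = undefined" if "u \<notin> V" for u
    using that assms by (auto simp: orders_def PiE_iff extensional_def Transposition.transpose_def)
  ultimately show ?thesis unfolding orders_def by (auto simp: PiE_iff extensional_def)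
qed

text \<open>The rank within \<open>X\<close> is uniformly distributed: every order gives rank \<open>k\<close> to exactly one element of \<open>X\<close>,
  and transposing two elements of \<open>X\<close> shows that all of them are equally likely to have it.\<close>

lemma card_orders_rank:
  assumes "finite V" "X \<subseteq> V" "v \<in> X" "k < card X"
  shows "card {p \<in> orders V. card {u \<in> X. p u < p v} = k} * card X = card (orders V)"
proof -
  have finX: "finite X" using assms finite_subset by blast
  let ?R = "\<lambda>w (p::'a \<Rightarrow> nat). card {u \<in> X. p u < p w} = k"
  have eq: "card {p \<in> orders V. ?R w p} = card {p \<in> orders V. ?R v p}" if "w \<in> X" for w
  proof -
    let ?t = "Transposition.transpose v w"
    have im: "?R a (q \<circ> ?t) \<longleftrightarrow> ?R (?t a) q" for a q
    proof -
      have "bij_betw ?t {u \<in> X. q (?t u) < q (?t a)} {u \<in> X. q u < q (?t a)}"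
        using assms(3) that by (intro bij_betwI[where g = ?t]) (auto simp: Transposition.transpose_def)
      then show ?thesis by (simp add: bij_betw_same_card)
    qed
    have "bij_betw (\<lambda>p. p \<circ> ?t) {p \<in> orders V. ?R w p} {p \<in> orders V. ?R v p}"
    proof (rule bij_betwI[where g = "\<lambda>p. p \<circ> ?t"])
      have V: "v \<in> V" "w \<in> V" using assms that by auto
      show "(\<lambda>p. p \<circ> ?t) \<in> {p \<in> orders V. ?R w p} \<rightarrow> {p \<in> orders V. ?R v p}"
        using orders_transpose[OF _ V] im[of _ v] by (simp add: Pi_iff comp_def)
      show "(\<lambda>p. p \<circ> ?t) \<in> {p \<in> orders V. ?R v p} \<rightarrow> {p \<in> orders V. ?R w p}"
        using orders_transpose[OF _ V] im[of _ w] by (simp add: Pi_iff comp_def)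
    qed (auto simp: comp_assoc)
    then show ?thesis by (rule bij_betw_same_card)
  qed
  have "(\<Sum>p\<in>orders V. card {w \<in> X. ?R w p}) = (\<Sum>w\<in>X. card {p \<in> orders V. ?R v p})"
    by (rule sum_multicount_gen) (use finX finite_orders[OF assms(1)] eq in auto)
  moreover have "(\<Sum>p\<in>orders V. card {w \<in> X. ?R w p}) = (\<Sum>p\<in>orders V. 1)"
  proof (rule sum.cong[OF refl])
    fix p assume "p \<in> orders V"
    then have "inj_on p X" using assms(2) by (auto simp: orders_def intro: inj_on_subset)
    then show "card {w \<in> X. ?R w p} = 1" using unique_rank finX assms(4) by blast
  qed
  ultimately show ?thesis by (simp add: mult.commute)
qed

section \<open>The gain of a vertex\<close>

text \<open>The logarithmic gain, compared with a tree, of a vertex whose earlier neighbours show \<open>J\<close> colours.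
  It is negative exactly for \<open>J = 0\<close>.\<close>

definition log_gain :: "nat \<Rightarrow> nat \<Rightarrow> real" where
  "log_gain y J = ln (real y / (real y + 1 - real J))"

definition seen :: "'a set \<Rightarrow> ('a \<times> 'a) set \<Rightarrow> ('a \<Rightarrow> nat) \<Rightarrow> ('a \<Rightarrow> nat) \<Rightarrow> 'a \<Rightarrow> nat" where
  "seen V E p c v = card (c ` {u \<in> nbrs V E v. p u < p v})"

definition gain :: "'a set \<Rightarrow> ('a \<times> 'a) set \<Rightarrow> nat \<Rightarrow> ('a \<Rightarrow> nat) \<Rightarrow> 'a \<Rightarrow> real" where
  "gain V E y c v = (\<Sum>p\<in>orders V. log_gain y (seen V E p c v)) / card (orders V)"

lemma seen_le_y:
  assumes "c \<in> cols V E (Suc y)" "v \<in> V" "finite V"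
  shows "seen V E p c v \<le> y"
proof -
  have "seen V E p c v \<le> card (c ` nbrs V E v)"
    unfolding seen_def using finite_nbrs[OF assms(3)] by (intro card_mono) auto
  also have "\<dots> < Suc y" by (rule seen_le[OF assms])
  finally show ?thesis by simp
qed

text \<open>For fixed \<open>p\<close>, the guessing probabilities \<open>a p c\<close> of all colourings add up to at most 1, so their mean is
  at most \<open>1 / card C\<close>; by concavity of the logarithm, in the form
  \<open>ln t \<le> t - 1\<close> with \<open>t = a p c * card C\<close>, the mean of \<open>ln (a p c)\<close> is at most \<open>- ln (card C)\<close>.\<close>

lemma sum_gain_le:
  assumes "finite V" "sym E" "C = cols V E (Suc y)" "C \<noteq> {}" "y \<ge> 1"
  shows "(\<Sum>c\<in>C. \<Sum>v\<in>V. gain V E y c v) \<le> card C * (card V * ln y - ln (card C))"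
proof -
  have finC: "finite C" using assms finite_cols by auto
  then have C0: "card C > 0" using assms(4) by (simp add: card_gt_0_iff)
  define N where "N = real (card (orders V))"
  have N0: "N > 0" using card_orders_pos[OF assms(1)] by (simp add: N_def)
  define a where "a p c = (\<Prod>v\<in>V. 1 / real (Suc y - seen V E p c v))" for p c
  have a0: "a p c > 0" and lna: "ln (a p c) = (\<Sum>v\<in>V. log_gain y (seen V E p c v)) - card V * ln y"
    if "c \<in> C" for p c
  proof -
    have le: "seen V E p c v \<le> y" if "v \<in> V" for v using seen_le_y[of c V E y v p] \<open>c \<in> C\<close> that assms by simp
    show "a p c > 0" unfolding a_def by (rule prod_pos) (use le in force)
    have "ln (a p c) = (\<Sum>v\<in>V. ln (1 / real (Suc y - seen V E p c v)))"
      unfolding a_def by (rule ln_prod) (use le assms(1) in force)+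
    also have "\<dots> = (\<Sum>v\<in>V. log_gain y (seen V E p c v) - ln y)"
    proof (rule sum.cong[OF refl])
      fix v assume "v \<in> V"
      have "real (Suc y - seen V E p c v) = real y + 1 - seen V E p c v"
        using le[OF \<open>v \<in> V\<close>] by (simp add: of_nat_diff)
      moreover have "real y + 1 - seen V E p c v > 0" using le[OF \<open>v \<in> V\<close>] by linarith
      ultimately show "ln (1 / real (Suc y - seen V E p c v)) = log_gain y (seen V E p c v) - ln y"
        using assms(5) by (simp add: log_gain_def ln_div)
    qed
    also have "\<dots> = (\<Sum>v\<in>V. log_gain y (seen V E p c v)) - card V * ln y"
      by (simp add: sum_subtractf)
    finally show "ln (a p c) = (\<Sum>v\<in>V. log_gain y (seen V E p c v)) - card V * ln y" .
  qed
  have seq: "(\<Sum>c\<in>C. a p c) \<le> 1" if "p \<in> orders V" for p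
    using sequential_bound[OF assms(1,2), where p = p and x = "Suc y"] that
    by (auto simp: a_def seen_def assms(3) orders_def)
  have "(\<Sum>p\<in>orders V. \<Sum>c\<in>C. ln (a p c) + ln (card C)) \<le> (\<Sum>p\<in>orders V. \<Sum>c\<in>C. a p c * card C - 1)"
  proof (intro sum_mono)
    fix p c assume "c \<in> C"
    have "ln (a p c) + ln (card C) = ln (a p c * card C)"
      using a0[OF \<open>c \<in> C\<close>, of p] C0 by (simp add: ln_mult)
    also have "\<dots> \<le> a p c * card C - 1"
      using a0[OF \<open>c \<in> C\<close>, of p] C0 by (intro ln_le_minus_one) simp
    finally show "ln (a p c) + ln (card C) \<le> a p c * card C - 1" .
  qed
  also have "\<dots> = (\<Sum>p\<in>orders V. (\<Sum>c\<in>C. a p c) * card C - card C)"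
    by (simp add: sum_subtractf sum_distrib_right)
  also have "\<dots> \<le> (\<Sum>p\<in>orders V. 1 * real (card C) - card C)"
    using seq by (intro sum_mono diff_right_mono mult_right_mono) auto
  finally have main: "(\<Sum>p\<in>orders V. \<Sum>c\<in>C. ln (a p c) + ln (card C)) \<le> 0" by simp
  have "(\<Sum>p\<in>orders V. \<Sum>c\<in>C. ln (a p c) + ln (card C))
      = (\<Sum>p\<in>orders V. \<Sum>c\<in>C. (\<Sum>v\<in>V. log_gain y (seen V E p c v)) - (card V * ln y - ln (card C)))"
    by (intro sum.cong refl) (simp add: lna)
  also have "\<dots> = (\<Sum>p\<in>orders V. \<Sum>c\<in>C. \<Sum>v\<in>V. log_gain y (seen V E p c v)) - N * (card C * (card V * ln y - ln (card C)))"
    by (simp add: sum_subtractf N_def)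
  also have "(\<Sum>p\<in>orders V. \<Sum>c\<in>C. \<Sum>v\<in>V. log_gain y (seen V E p c v))
      = (\<Sum>c\<in>C. \<Sum>v\<in>V. \<Sum>p\<in>orders V. log_gain y (seen V E p c v))"
    by (subst sum.swap, rule sum.cong[OF refl], rule sum.swap)
  also have "\<dots> = N * (\<Sum>c\<in>C. \<Sum>v\<in>V. gain V E y c v)"
  proof -
    have "(\<Sum>p\<in>orders V. log_gain y (seen V E p c v)) = N * gain V E y c v" for c v
      using N0 by (simp add: gain_def N_def)
    then show ?thesis by (simp add: sum_distrib_left)
  qed
  finally show ?thesis using main N0 by (simp add: right_diff_distrib[symmetric] mult_le_0_iff)
qed

lemma log_gain_0: "log_gain y 0 = - ln (1 + 1 / real y)" if "y \<ge> 1"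
proof -
  have "real y / (real y + 1) = inverse (1 + 1 / real y)" using that by (simp add: field_simps)
  then show ?thesis by (simp add: log_gain_def ln_inverse)
qed

lemma log_gain_Suc: "log_gain y (Suc J) = - ln (1 - real J / real y)" if "y \<ge> 1" "J < y"
proof -
  have "real y / (real y + 1 - real (Suc J)) = inverse (1 - real J / real y)"
    using that by (simp add: field_simps)
  moreover have "1 - real J / real y > 0" using that by (simp add: field_simps)
  ultimately show ?thesis by (simp add: log_gain_def ln_inverse)
qed

lemma log_gain_1: "y \<ge> 1 \<Longrightarrow> log_gain y (Suc 0) = 0"
  by (simp add: log_gain_Suc)

lemma log_gain_mono:
  assumes "i \<le> j" "j \<le> y" "y \<ge> 1"
  shows "log_gain y i \<le> log_gain y j"
proof -
  have "real y / (real y + 1 - real i) \<le> real y / (real y + 1 - real j)"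
    using assms by (intro divide_left_mono mult_pos_pos) auto
  then show ?thesis unfolding log_gain_def using assms by (subst ln_le_cancel_iff) (auto intro!: divide_pos_pos)
qed

text \<open>The log-gain is convex from \<open>J = 1\<close> on and vanishes there, so it lies above the line through
  its values at 1 and 2 (Bernoulli's inequality); at \<open>J = 0\<close> this is \<open>(1 - 1/y) (1 + 1/y) \<le> 1\<close>. The point of a
  linear bound is that expected numbers of colours are easy to compute.\<close>

lemma log_gain_linear:
  assumes "J \<le> y" "y \<ge> 2"
  shows "log_gain y 2 * (real J - 1) \<le> log_gain y J"
proof -
  have L2: "log_gain y 2 = - ln (1 - 1 / real y)" using log_gain_Suc[of y 1] assms by (simp add: numeral_2_eq_2)
  have pos: "1 - 1 / real y > 0" using assms by (simp add: field_simps)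
  have pos': "1 + 1 / real y > 0" by (intro add_pos_nonneg) auto
  show ?thesis
  proof (cases J)
    case 0
    have "ln (1 - 1 / real y) + ln (1 + 1 / real y) = ln ((1 - 1 / real y) * (1 + 1 / real y))"
      using ln_mult_pos[OF pos pos'] by simp
    also have "\<dots> \<le> ln 1"
    proof (subst ln_le_cancel_iff)
      show "(1 - 1 / real y) * (1 + 1 / real y) > 0" using pos pos' by (rule mult_pos_pos)
      show "(1 - 1 / real y) * (1 + 1 / real y) \<le> 1" by (simp add: algebra_simps)
    qed simp
    finally show ?thesis using 0 L2 log_gain_0[of y] assms by simp
  next
    case (Suc k)
    have "1 + real k * (- 1 / real y) \<le> (1 + - 1 / real y) ^ k"
      by (rule Bernoulli_inequality) (use assms in \<open>simp add: field_simps\<close>)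
    then have "1 - real k / real y \<le> (1 - 1 / real y) ^ k" by simp
    moreover have "1 - real k / real y > 0" using assms Suc by (simp add: field_simps)
    ultimately have "ln (1 - real k / real y) \<le> ln ((1 - 1 / real y) ^ k)" by (subst ln_le_cancel_iff) auto
    also have "\<dots> = real k * ln (1 - 1 / real y)" using pos by (simp add: ln_realpow)
    finally show ?thesis using Suc L2 log_gain_Suc[of y k] assms by (simp add: mult.commute)
  qed
qed

lemma log_gain_2_pos: "y \<ge> 2 \<Longrightarrow> log_gain y 2 > 0"
proof -
  assume "y \<ge> 2"
  then have "real y / (real y + 1 - real 2) > 1" by (simp add: field_simps)
  then show ?thesis unfolding log_gain_def by simp
qed

lemma orders_rank_frequency:
  assumes "finite V" "Q \<subseteq> V" "v \<in> V" "v \<notin> Q" "k \<le> card Q"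
  shows "real (card {p \<in> orders V. card {u \<in> Q. p u < p v} = k}) = real (card (orders V)) / (real (card Q) + 1)"
proof -
  have finQ: "finite Q" using assms finite_subset by blast
  have "card {p \<in> orders V. card {u \<in> insert v Q. p u < p v} = k} * card (insert v Q) = card (orders V)"
    using assms finQ by (intro card_orders_rank) auto
  moreover have "{u \<in> insert v Q. p u < p v} = {u \<in> Q. p u < p v}" for p :: "'a \<Rightarrow> nat" by auto
  ultimately have "card {p \<in> orders V. card {u \<in> Q. p u < p v} = k} * (card Q + 1) = card (orders V)"
    using finQ assms(4) by simp
  then have "real (card {p \<in> orders V. card {u \<in> Q. p u < p v} = k} * (card Q + 1)) = real (card (orders V))"
    by (rule arg_cong)
  then have "real (card {p \<in> orders V. card {u \<in> Q. p u < p v} = k}) * (real (card Q) + 1) = real (card (orders V))"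
    by (simp only: of_nat_mult of_nat_add of_nat_1)
  then show ?thesis by (simp add: field_simps)
qed

lemma sum_orders_rank:
  assumes "finite V" "Q \<subseteq> V" "v \<in> V" "v \<notin> Q" "k \<le> card Q"
  shows "(\<Sum>p\<in>orders V. of_bool (card {u \<in> Q. p u < p v} = k)) = real (card (orders V)) / (real (card Q) + 1)"
  using orders_rank_frequency[OF assms] finite_orders[OF assms(1)]
  by (simp add: of_bool_def sum.If_cases Int_def)

lemma sum_orders_some:
  assumes "finite V" "Q \<subseteq> V" "v \<in> V" "v \<notin> Q"
  shows "(\<Sum>p\<in>orders V. of_bool (\<exists>u\<in>Q. p u < p v)) = real (card (orders V)) * (1 - 1 / (real (card Q) + 1))"
proof -
  have finQ: "finite Q" using assms finite_subset by blast
  have "of_bool (\<exists>u\<in>Q. p u < p v) = (1 :: real) - of_bool (card {u \<in> Q. p u < p v} = 0)" for p :: "'a \<Rightarrow> nat"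
    using finQ by auto
  then have "(\<Sum>p\<in>orders V. of_bool (\<exists>u\<in>Q. p u < p v))
      = (\<Sum>p\<in>orders V. 1 - of_bool (card {u \<in> Q. p u < p v} = 0) :: real)" by simp
  also have "\<dots> = real (card (orders V)) - real (card (orders V)) / (real (card Q) + 1)"
    using sum_orders_rank[OF assms, of 0] by (simp only: sum_subtractf sum_constant le0 mult_1_right of_nat_1)
  finally show ?thesis by (simp add: algebra_simps)
qed

text \<open>The expected number of colours that the elements of \<open>Q\<close> preceding a fixed vertex outside \<open>Q\<close> show in a
  random order (\<open>sum_orders_colours\<close>): a colour carried by \<open>m\<close> elements is missed with probability
  \<open>1 / (m + 1)\<close>.\<close>

definition spread :: "('a \<Rightarrow> nat) \<Rightarrow> 'a set \<Rightarrow> real" where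
  "spread c Q = (\<Sum>a\<in>c ` Q. 1 - 1 / (real (card {u \<in> Q. c u = a}) + 1))"

lemma card_colours_eq_sum:
  fixes p :: "'a \<Rightarrow> nat"
  assumes "finite Q"
  shows "real (card (c ` {u \<in> Q. p u < p v})) = (\<Sum>a\<in>c ` Q. of_bool (\<exists>u\<in>{u \<in> Q. c u = a}. p u < p v))"
proof -
  have "c ` {u \<in> Q. p u < p v} = c ` Q \<inter> {a. \<exists>u\<in>{u \<in> Q. c u = a}. p u < p v}" (is "?l = ?r")
  proof (intro equalityI subsetI)
    fix a assume "a \<in> ?l"
    then obtain u where "a = c u" and u: "u \<in> {u \<in> Q. p u < p v}" by (rule imageE)
    moreover from u have "u \<in> Q" "p u < p v" by simp_all
    ultimately show "a \<in> ?r" by (intro IntI CollectI bexI[of _ u]) simp_all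
  next
    fix a assume "a \<in> ?r"
    then have "\<exists>u\<in>{u \<in> Q. c u = a}. p u < p v" by (elim IntE CollectE)
    then obtain u where u: "u \<in> {u \<in> Q. c u = a}" and "p u < p v" by (rule bexE)
    moreover from u have "u \<in> Q" "c u = a" by simp_all
    ultimately show "a \<in> ?l" by (intro image_eqI[of _ _ u]) simp_all
  qed
  then show ?thesis using assms by (subst sum_of_bool_eq) simp_all
qed

lemma sum_orders_colours:
  assumes "finite V" "Q \<subseteq> V" "v \<in> V" "v \<notin> Q"
  shows "(\<Sum>p\<in>orders V. real (card (c ` {u \<in> Q. p u < p v}))) = real (card (orders V)) * spread c Q"
proof -
  have finQ: "finite Q" using assms finite_subset by blast
  have "(\<Sum>p\<in>orders V. real (card (c ` {u \<in> Q. p u < p v})))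
      = (\<Sum>p\<in>orders V. \<Sum>a\<in>c ` Q. of_bool (\<exists>u\<in>{u \<in> Q. c u = a}. p u < p v))"
    by (intro sum.cong refl card_colours_eq_sum[OF finQ])
  also have "\<dots> = (\<Sum>a\<in>c ` Q. \<Sum>p\<in>orders V. of_bool (\<exists>u\<in>{u \<in> Q. c u = a}. p u < p v))"
    by (rule sum.swap)
  also have "\<dots> = (\<Sum>a\<in>c ` Q. real (card (orders V)) * (1 - 1 / (real (card {u \<in> Q. c u = a}) + 1)))"
    using assms by (intro sum.cong refl sum_orders_some) auto
  finally show ?thesis by (simp add: spread_def sum_distrib_left)
qed

lemma card_seen_ge:
  assumes "finite V" "Q \<subseteq> nbrs V E v"
  shows "card (c ` {u \<in> Q. p u < p v}) \<le> seen V E p c v"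
  unfolding seen_def
proof (rule card_mono)
  show "finite (c ` {u \<in> nbrs V E v. p u < p v})"
    by (rule finite_imageI, rule finite_subset[OF _ finite_nbrs[OF assms(1), of E v]]) blast
  show "c ` {u \<in> Q. p u < p v} \<subseteq> c ` {u \<in> nbrs V E v. p u < p v}"
    by (rule image_mono) (use assms(2) in blast)
qed

lemma not_self_nbr: "c \<in> cols V E x \<Longrightarrow> v \<in> V \<Longrightarrow> v \<notin> nbrs V E v"
proof
  assume "c \<in> cols V E x" "v \<in> V" "v \<in> nbrs V E v"
  then have "(v, v) \<in> E" "proper_on V E c" by (simp_all add: nbrs_def cols_def)
  with \<open>v \<in> V\<close> show False unfolding proper_on_def by blast
qed

lemma gain_ge:
  assumes "finite V" and "\<And>p. p \<in> orders V \<Longrightarrow> f p \<le> log_gain y (seen V E p c v)"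
  shows "(\<Sum>p\<in>orders V. f p) / card (orders V) \<le> gain V E y c v"
  unfolding gain_def using assms(2) by (intro divide_right_mono sum_mono) auto

lemma gain_linear:
  assumes "finite V" "y \<ge> 2" "c \<in> cols V E (Suc y)" "v \<in> V" "Q \<subseteq> nbrs V E v"
  shows "log_gain y 2 * (spread c Q - 1) \<le> gain V E y c v"
proof -
  have Q: "Q \<subseteq> V" "v \<notin> Q" using assms(5) not_self_nbr[OF assms(3,4)] by (auto simp: nbrs_def)
  have "(\<Sum>p\<in>orders V. log_gain y 2 * (real (card (c ` {u \<in> Q. p u < p v})) - 1)) / card (orders V) \<le> gain V E y c v"
  proof (rule gain_ge[OF assms(1)])
    fix p assume "p \<in> orders V"
    have "log_gain y 2 * (real (card (c ` {u \<in> Q. p u < p v})) - 1) \<le> log_gain y 2 * (real (seen V E p c v) - 1)"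
      using card_seen_ge[OF assms(1,5), of c p] log_gain_2_pos[OF assms(2)] by (intro mult_left_mono) auto
    also have "\<dots> \<le> log_gain y (seen V E p c v)"
      using seen_le_y[OF assms(3,4,1)] assms(2) by (rule log_gain_linear)
    finally show "log_gain y 2 * (real (card (c ` {u \<in> Q. p u < p v})) - 1) \<le> log_gain y (seen V E p c v)" .
  qed
  moreover have "(\<Sum>p\<in>orders V. log_gain y 2 * (real (card (c ` {u \<in> Q. p u < p v})) - 1))
      = real (card (orders V)) * (log_gain y 2 * (spread c Q - 1))"
    using sum_orders_colours[OF assms(1) Q(1) assms(4) Q(2), of c]
    by (simp add: sum_distrib_left[symmetric] sum_subtractf algebra_simps)
  ultimately show ?thesis using card_orders_pos[OF assms(1)] by simp
qed

lemma ex_reps: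
  assumes "finite Q" "k \<le> card (c ` Q)"
  obtains Y where "Y \<subseteq> Q" "card Y = k" "inj_on c Y"
proof -
  obtain A where A: "A \<subseteq> c ` Q" "card A = k" using obtain_subset_with_card_n[OF assms(2)] by metis
  obtain Y where "Y \<subseteq> Q" "inj_on c Y" "A = c ` Y" using A(1) unfolding subset_image_inj by blast
  then show ?thesis using that A card_image by metis
qed

lemma card_colours_eq_inj:
  assumes "inj_on c Y"
  shows "card (c ` {u \<in> Y. P u}) = card {u \<in> Y. P u}"
proof -
  have "{u \<in> Y. P u} \<subseteq> Y" by (rule Collect_restrict)
  then have "inj_on c {u \<in> Y. P u}" using assms by (rule inj_on_subset[rotated])
  then show ?thesis by (rule card_image)
qed

text \<open>This is the total gain that goes with the extremal number of colourings (\<open>clique_gain_eq\<close>).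
  The missing term for one colour is zero, so it is also the sum of the log-gains of five vertices that
  see 0, 1, 2, 3 and 4 colours, as in \<open>K\<^sub>5\<close>.\<close>

definition clique_gain :: "nat \<Rightarrow> real" where
  "clique_gain y = log_gain y 0 + log_gain y 2 + log_gain y 3 + log_gain y 4"

text \<open>Among four differently coloured neighbours and itself, the vertex has rank 0, 1, 2, 3, 4 with
  probability \<open>1/5\<close> each, and it sees at least as many colours as its rank.\<close>

lemma gain_dominating:
  assumes "finite V" "y \<ge> 4" "c \<in> cols V E (Suc y)" "v \<in> V" "4 \<le> card (c ` nbrs V E v)"
  shows "clique_gain y / 5 \<le> gain V E y c v"
proof -
  obtain Y where Y: "Y \<subseteq> nbrs V E v" "card Y = 4" "inj_on c Y"
    using ex_reps[OF finite_nbrs[OF assms(1)] assms(5)] .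
  have finY: "finite Y" using Y(2) by (metis card.infinite zero_neq_numeral)
  have YV: "Y \<subseteq> V" "v \<notin> Y" using Y(1) not_self_nbr[OF assms(3,4)] by (auto simp: nbrs_def)
  define r where "r p = card {u \<in> Y. p u < p v}" for p :: "'a \<Rightarrow> nat"
  have r4: "r p \<le> 4" for p unfolding r_def Y(2)[symmetric] using finY by (intro card_mono) auto
  have "(\<Sum>p\<in>orders V. log_gain y (r p)) / card (orders V) \<le> gain V E y c v"
  proof (rule gain_ge[OF assms(1)])
    fix p assume "p \<in> orders V"
    have "r p \<le> seen V E p c v"
      using card_seen_ge[OF assms(1) Y(1), of c p] card_colours_eq_inj[OF Y(3)] by (simp add: r_def)
    then show "log_gain y (r p) \<le> log_gain y (seen V E p c v)"
      using seen_le_y[OF assms(3,4,1)] assms(2) by (intro log_gain_mono) auto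
  qed
  moreover have "(\<Sum>p\<in>orders V. log_gain y (r p)) = real (card (orders V)) * (clique_gain y / 5)"
  proof -
    have "(\<Sum>p\<in>orders V. log_gain y (r p)) = (\<Sum>p\<in>orders V. \<Sum>k\<le>4. of_bool (r p = k) * log_gain y k)"
    proof (rule sum.cong[OF refl])
      fix p
      have "(\<Sum>k\<le>4. of_bool (r p = k) * log_gain y k) = (\<Sum>k\<in>{r p}. log_gain y k)"
        using r4[of p] by (intro sum.mono_neutral_cong_right) auto
      then show "log_gain y (r p) = (\<Sum>k\<le>4. of_bool (r p = k) * log_gain y k)" by simp
    qed
    also have "\<dots> = (\<Sum>k\<le>4. (\<Sum>p\<in>orders V. of_bool (r p = k)) * log_gain y k)"
      by (subst sum.swap) (simp add: sum_distrib_right)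
    also have "\<dots> = (\<Sum>k\<le>4. real (card (orders V)) / 5 * log_gain y k)"
      using sum_orders_rank[OF assms(1) YV(1) assms(4) YV(2)] Y(2) by (intro sum.cong refl) (simp add: r_def)
    also have "\<dots> = real (card (orders V)) * (clique_gain y / 5)"
      using assms(2) by (simp add: clique_gain_def log_gain_1 eval_nat_numeral algebra_simps)
    finally show ?thesis .
  qed
  ultimately show ?thesis using card_orders_pos[OF assms(1)] by simp
qed

text \<open>The linear bound of \<open>gain_linear\<close> is corrected where it is not sharp: at \<open>J = 0\<close>, which has probability
  \<open>1/5\<close>, and at \<open>J \<ge> 3\<close>, which happens at least when three given elements of \<open>Q\<close> with different colours
  all precede the vertex, with probability \<open>1/4\<close>.\<close>

lemma gain_four:
  assumes "finite V" "y \<ge> 4" "c \<in> cols V E (Suc y)" "v \<in> V" "Q \<subseteq> nbrs V E v" "card Q = 4"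
  shows "log_gain y 2 * (spread c Q - 1) + (log_gain y 0 + log_gain y 2) / 5
      + of_bool (3 \<le> card (c ` Q)) * (log_gain y 3 - 2 * log_gain y 2) / 4 \<le> gain V E y c v"
proof -
  have finQ: "finite Q" using assms(6) by (metis card.infinite zero_neq_numeral)
  have Q: "Q \<subseteq> V" "v \<notin> Q" using assms(5) not_self_nbr[OF assms(3,4)] by (auto simp: nbrs_def)
  define three where "three \<longleftrightarrow> 3 \<le> card (c ` Q)"
  obtain Y where Y: "Y \<subseteq> Q" "inj_on c Y" "three \<Longrightarrow> card Y = 3"
  proof (cases three)
    case True
    then show ?thesis using ex_reps[OF finQ, of 3 c] that unfolding three_def by blast
  next
    case False
    then show ?thesis using that[of "{}"] by simp
  qed
  have finY: "finite Y" using Y(1) finQ finite_subset by blast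
  define J where "J p = card (c ` {u \<in> Q. p u < p v})" for p :: "'a \<Rightarrow> nat"
  have L3: "log_gain y 3 \<ge> 2 * log_gain y 2" using log_gain_linear[of 3 y] assms(2) by simp
  have L4: "log_gain y 4 \<ge> log_gain y 3 + log_gain y 2"
  proof -
    have "log_gain y 3 + log_gain y 2 = ln (real y / (real y - 2) * (real y / (real y - 1)))"
      using assms(2) by (subst ln_mult) (auto simp: log_gain_def)
    also have "\<dots> \<le> log_gain y 4"
      unfolding log_gain_def
    proof (subst ln_le_cancel_iff)
      have "real y * (real y - 3) \<le> (real y - 2) * (real y - 1)" by (simp add: algebra_simps)
      then show "real y / (real y - 2) * (real y / (real y - 1)) \<le> real y / (real y + 1 - real 4)"
        using assms(2) by (simp add: divide_simps)
    qed (use assms(2) in auto)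
    finally show ?thesis .
  qed
  have Lpoint: "log_gain y 2 * (real j - 1) + of_bool (j = 0) * (log_gain y 0 + log_gain y 2) + of_bool (3 \<le> j) * (log_gain y 3 - 2 * log_gain y 2) \<le> log_gain y j"
    if "j \<le> 4" for j
  proof -
    have "j = 0 \<or> j = 1 \<or> j = 2 \<or> j = 3 \<or> j = 4" using that by arith
    then show ?thesis using L4 log_gain_1[of y] assms(2) by (elim disjE) (auto simp: algebra_simps)
  qed
  have "(\<Sum>p\<in>orders V. log_gain y 2 * (real (J p) - 1) + of_bool (card {u \<in> Q. p u < p v} = 0) * (log_gain y 0 + log_gain y 2)
      + of_bool (card {u \<in> Y. p u < p v} = 3) * (of_bool three * (log_gain y 3 - 2 * log_gain y 2))) / card (orders V)
      \<le> gain V E y c v"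
  proof (rule gain_ge[OF assms(1)])
    fix p assume "p \<in> orders V"
    have J4: "J p \<le> 4"
      unfolding J_def assms(6)[symmetric] using finQ
      by (intro order.trans[OF card_image_le] card_mono) auto
    have zero: "card {u \<in> Q. p u < p v} = 0 \<longleftrightarrow> J p = 0" using finQ by (auto simp: J_def)
    have three: "3 \<le> J p" if "card {u \<in> Y. p u < p v} = 3"
    proof -
      have "card (c ` {u \<in> Y. p u < p v}) \<le> J p"
        unfolding J_def using Y(1) finQ by (intro card_mono) auto
      then show ?thesis using that card_colours_eq_inj[OF Y(2), of "\<lambda>u. p u < p v"] by simp
    qed
    have "of_bool (card {u \<in> Y. p u < p v} = 3) * (of_bool three * (log_gain y 3 - 2 * log_gain y 2))
        \<le> of_bool (3 \<le> J p) * (log_gain y 3 - 2 * log_gain y 2)"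
      using three L3 by auto
    then have "log_gain y 2 * (real (J p) - 1) + of_bool (card {u \<in> Q. p u < p v} = 0) * (log_gain y 0 + log_gain y 2)
      + of_bool (card {u \<in> Y. p u < p v} = 3) * (of_bool three * (log_gain y 3 - 2 * log_gain y 2)) \<le> log_gain y (J p)"
      using Lpoint[OF J4] zero by simp
    also have "\<dots> \<le> log_gain y (seen V E p c v)"
      using card_seen_ge[OF assms(1,5), of c p] seen_le_y[OF assms(3,4,1)] assms(2)
      by (intro log_gain_mono) (auto simp: J_def)
    finally show "log_gain y 2 * (real (J p) - 1) + of_bool (card {u \<in> Q. p u < p v} = 0) * (log_gain y 0 + log_gain y 2)
      + of_bool (card {u \<in> Y. p u < p v} = 3) * (of_bool three * (log_gain y 3 - 2 * log_gain y 2)) \<le> log_gain y (seen V E p c v)" .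
  qed
  moreover have "(\<Sum>p\<in>orders V. log_gain y 2 * (real (J p) - 1) + of_bool (card {u \<in> Q. p u < p v} = 0) * (log_gain y 0 + log_gain y 2)
      + of_bool (card {u \<in> Y. p u < p v} = 3) * (of_bool three * (log_gain y 3 - 2 * log_gain y 2)))
      = real (card (orders V)) * (log_gain y 2 * (spread c Q - 1) + (log_gain y 0 + log_gain y 2) / 5 + of_bool three * (log_gain y 3 - 2 * log_gain y 2) / 4)"
  proof -
    have "(\<Sum>p\<in>orders V. of_bool (card {u \<in> Y. p u < p v} = 3)) * (of_bool three * (log_gain y 3 - 2 * log_gain y 2))
        = real (card (orders V)) / 4 * (of_bool three * (log_gain y 3 - 2 * log_gain y 2))"
    proof (cases three)
      case True
      have "Y \<subseteq> V" "v \<notin> Y" using Y(1) Q by auto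
      then have "(\<Sum>p\<in>orders V. of_bool (card {u \<in> Y. p u < p v} = 3)) = real (card (orders V)) / 4"
        using sum_orders_rank[OF assms(1) _ assms(4), of Y 3] Y(3)[OF True] by simp
      then show ?thesis by (rule arg_cong)
    qed simp
    moreover have "(\<Sum>p\<in>orders V. of_bool (card {u \<in> Q. p u < p v} = 0)) = real (card (orders V)) / 5"
      using sum_orders_rank[OF assms(1) Q(1) assms(4) Q(2), of 0] assms(6) by simp
    moreover have "(\<Sum>p\<in>orders V. real (J p)) = real (card (orders V)) * spread c Q"
      using sum_orders_colours[OF assms(1) Q(1) assms(4) Q(2), of c] by (simp add: J_def)
    moreover have "(\<Sum>p\<in>orders V. log_gain y 2 * (real (J p) - 1) + of_bool (card {u \<in> Q. p u < p v} = 0) * (log_gain y 0 + log_gain y 2)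
        + of_bool (card {u \<in> Y. p u < p v} = 3) * (of_bool three * (log_gain y 3 - 2 * log_gain y 2)))
      = log_gain y 2 * ((\<Sum>p\<in>orders V. real (J p)) - real (card (orders V)))
        + (\<Sum>p\<in>orders V. of_bool (card {u \<in> Q. p u < p v} = 0)) * (log_gain y 0 + log_gain y 2)
        + (\<Sum>p\<in>orders V. of_bool (card {u \<in> Y. p u < p v} = 3)) * (of_bool three * (log_gain y 3 - 2 * log_gain y 2))"
      by (simp only: sum.distrib sum_distrib_right[symmetric] sum_distrib_left[symmetric] sum_subtractf sum_constant mult_1_right)
    ultimately show ?thesis by (simp only: ring_distribs) (simp add: field_simps)
  qed
  ultimately show ?thesis using card_orders_pos[OF assms(1)] by (simp add: three_def)
qed

lemma colour_class_pos: "finite Q \<Longrightarrow> a \<in> c ` Q \<Longrightarrow> 1 \<le> card {u \<in> Q. c u = a}"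
  by (auto simp: Suc_le_eq card_gt_0_iff)

lemma sum_colour_classes: "finite Q \<Longrightarrow> (\<Sum>a\<in>c ` Q. card {u \<in> Q. c u = a}) = card Q"
proof -
  assume "finite Q"
  then have "(\<Sum>a\<in>c ` Q. \<Sum>u\<in>{u \<in> Q. c u = a}. 1::nat) = (\<Sum>u\<in>Q. 1)" by (rule sum.image_gen[symmetric])
  then show ?thesis by simp
qed

lemma spread_ge:
  assumes "finite Q"
  shows "card (c ` Q) / 2 \<le> spread c Q"
proof -
  have "(\<Sum>a\<in>c ` Q. 1 / 2 :: real) \<le> spread c Q"
    unfolding spread_def
  proof (rule sum_mono)
    fix a assume "a \<in> c ` Q"
    then have "1 \<le> card {u \<in> Q. c u = a}" by (rule colour_class_pos[OF assms])
    then show "1 / 2 \<le> 1 - 1 / (real (card {u \<in> Q. c u = a}) + 1)" by (simp add: field_simps)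
  qed
  then show ?thesis by simp
qed

text \<open>Each colour contributes at least \<open>1/2\<close>, and a colour carried by \<open>k\<close> elements at least \<open>k / (k + 1)\<close>. With
  at least four elements to distribute, this gives the values \<open>4/5\<close>, \<open>5/4\<close> and \<open>5/3\<close> for one, two and
  three colours below.\<close>

lemma spread_ge_strong:
  assumes "finite Q" "a \<in> c ` Q" "k \<le> card {u \<in> Q. c u = a}"
  shows "(real (card (c ` Q)) - 1) / 2 + (1 - 1 / (real k + 1)) \<le> spread c Q"
proof -
  let ?m = "\<lambda>a. card {u \<in> Q. c u = a}"
  have "(\<Sum>b\<in>c ` Q - {a}. 1 / 2 :: real) \<le> (\<Sum>b\<in>c ` Q - {a}. 1 - 1 / (real (?m b) + 1))"
  proof (rule sum_mono)
    fix b assume "b \<in> c ` Q - {a}"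
    then have "b \<in> c ` Q" by simp
    then have "1 \<le> ?m b" by (rule colour_class_pos[OF assms(1)])
    then show "1 / 2 \<le> 1 - 1 / (real (?m b) + 1)" by (simp add: field_simps)
  qed
  moreover have "1 - 1 / (real k + 1) \<le> 1 - 1 / (real (?m a) + 1)"
    using assms(3) by (simp add: frac_le)
  moreover have "spread c Q = (1 - 1 / (real (?m a) + 1)) + (\<Sum>b\<in>c ` Q - {a}. 1 - 1 / (real (?m b) + 1))"
    unfolding spread_def using assms by (intro sum.remove) auto
  moreover have "(\<Sum>b\<in>c ` Q - {a}. 1 / 2 :: real) = (real (card (c ` Q)) - 1) / 2"
  proof -
    have "card (c ` Q) \<ge> 1" using assms by (auto simp: Suc_le_eq card_gt_0_iff)
    then show ?thesis using assms by (simp add: card_Diff_singleton of_nat_diff)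
  qed
  ultimately show ?thesis by linarith
qed

lemma spread_1:
  assumes "finite Q" "4 \<le> card Q" "card (c ` Q) = 1"
  shows "4 / 5 \<le> spread c Q"
proof -
  obtain a where a: "c ` Q = {a}" using assms(3) by (auto simp: card_1_singleton_iff)
  then have "card {u \<in> Q. c u = a} = card Q" by (intro arg_cong[where f = card]) auto
  then show ?thesis using spread_ge_strong[OF assms(1), of a c 4] a assms(2,3) by simp
qed

lemma spread_2:
  assumes "finite Q" "4 \<le> card Q" "card (c ` Q) = 2"
  shows "5 / 4 \<le> spread c Q"
proof -
  obtain a b where ab: "c ` Q = {a, b}" "a \<noteq> b" using assms(3) by (auto simp: card_2_iff)
  let ?m = "\<lambda>a. card {u \<in> Q. c u = a}"
  have s: "?m a + ?m b \<ge> 4" using sum_colour_classes[OF assms(1), of c] ab assms(2) by simp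
  consider "?m a \<ge> 3" | "?m b \<ge> 3" | "?m a = 2" "?m b = 2" using s by linarith
  then show ?thesis
  proof cases
    case 1 then show ?thesis using spread_ge_strong[OF assms(1), of a c 3] ab by simp
  next
    case 2 then show ?thesis using spread_ge_strong[OF assms(1), of b c 3] ab by simp
  next
    case 3 then show ?thesis using ab by (simp add: spread_def)
  qed
qed

lemma spread_3:
  assumes "finite Q" "4 \<le> card Q" "3 \<le> card (c ` Q)"
  shows "5 / 3 \<le> spread c Q"
proof (cases "card (c ` Q) = 3")
  case True
  have "\<exists>a\<in>c ` Q. 2 \<le> card {u \<in> Q. c u = a}"
  proof (rule ccontr)
    assume "\<not> ?thesis"
    then have "(\<Sum>a\<in>c ` Q. card {u \<in> Q. c u = a}) \<le> (\<Sum>a\<in>c ` Q. 1)" by (intro sum_mono) force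
    then show False using sum_colour_classes[OF assms(1), of c] True assms(2) by simp
  qed
  then obtain a where "a \<in> c ` Q" "2 \<le> card {u \<in> Q. c u = a}" by blast
  then show ?thesis using spread_ge_strong[OF assms(1), of a c 2] True by simp
next
  case False
  then have "4 \<le> card (c ` Q)" using assms(3) by simp
  then show ?thesis using spread_ge[OF assms(1), of c] by simp
qed

section \<open>Identifying vertices\<close>

text \<open>Connectedness in terms of cuts. In this form it passes to quotients by taking preimages, and it
  directly provides the next vertex when a connected graph is built up.\<close>

definition linked :: "'a set \<Rightarrow> ('a \<times> 'a) set \<Rightarrow> bool" where
  "linked V E \<longleftrightarrow> (\<forall>W. W \<subseteq> V \<longrightarrow> W \<noteq> {} \<longrightarrow> W \<noteq> V \<longrightarrow> (\<exists>u\<in>W. \<exists>v\<in>V - W. (u, v) \<in> E))"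

text \<open>Counting the colours used, instead of prescribing them, makes recolourings and compositions possible
  without renumbering.\<close>

definition colourable :: "'a set \<Rightarrow> ('a \<times> 'a) set \<Rightarrow> nat \<Rightarrow> bool" where
  "colourable V E k \<longleftrightarrow> (\<exists>f :: 'a \<Rightarrow> nat. proper_on V E f \<and> card (f ` V) \<le> k)"

definition bound :: "nat \<Rightarrow> nat \<Rightarrow> real" where
  "bound y n = (real y + 1) * real y ^ (n - 4) * (real y - 1) * (real y - 2) * (real y - 3)"

lemma bound_pos: "4 \<le> y \<Longrightarrow> 0 < bound y n"
  unfolding bound_def by (intro mult_pos_pos) auto

lemma bound_add: "5 \<le> n \<Longrightarrow> bound y (n + k) = real y ^ k * bound y n"
proof -
  assume "5 \<le> n"
  then have "n + k - 4 = (n - 4) + k" by simp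
  then show ?thesis by (simp add: bound_def power_add)
qed

lemma proper_on_cols: "c \<in> cols V E x \<Longrightarrow> proper_on V E c"
  by (simp add: cols_def)

lemma card_colours_ge_5:
  assumes "\<not> colourable V E 4" "proper_on V E (f :: 'a \<Rightarrow> nat)"
  shows "5 \<le> card (f ` V)"
proof (rule ccontr)
  assume "\<not> ?thesis"
  then have "card (f ` V) \<le> 4" by simp
  then show False using assms by (auto simp: colourable_def)
qed

text \<open>A colouring that is constant on the fibres of \<open>\<phi>\<close> is a colouring of the quotient graph. The quotient is
  still connected, and a 4-colouring of it could be pulled back, so the bound for smaller graphs applies;
  each identified vertex gains a factor \<open>y\<close>.\<close>

lemma card_identified_colourings:
  fixes V :: "'a set"
  assumes IH: "\<And>(V' :: 'a set) E'. finite V' \<Longrightarrow> sym E' \<Longrightarrow> linked V' E' \<Longrightarrow> \<not> colourable V' E' 4 \<Longrightarrow>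
      card V' < card V \<Longrightarrow> real (card (cols V' E' (Suc y))) \<le> bound y (card V')"
    and "finite V" "sym E" "linked V E" "\<not> colourable V E 4" "4 \<le> y"
    and "\<phi> ` V \<subseteq> V" "card V = card (\<phi> ` V) + k" "0 < k"
  shows "real (card {c \<in> cols V E (Suc y). \<forall>v\<in>V. c (\<phi> v) = c v}) * real y ^ k \<le> bound y (card V)"
proof -
  define C where "C = {c \<in> cols V E (Suc y). \<forall>v\<in>V. c (\<phi> v) = c v}"
  show ?thesis
  proof (cases "C = {}")
    case True
    then have "card C = 0" by simp
    then show ?thesis using bound_pos[OF assms(6), of "card V"] unfolding C_def[symmetric] by (simp del: card_0_eq)
  next
    case False
    define V' where "V' = \<phi> ` V"
    define E' where "E' = {(\<phi> u, \<phi> v) | u v. u \<in> V \<and> v \<in> V \<and> (u, v) \<in> E}"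
    have fin': "finite V'" using assms(2) by (simp add: V'_def)
    have im: "restrict c V' \<in> cols V' E' (Suc y)" if "c \<in> C" for c
    proof -
      have c: "c \<in> cols V E (Suc y)" "\<And>v. v \<in> V \<Longrightarrow> c (\<phi> v) = c v" using that by (auto simp: C_def)
      have "restrict c V' \<in> V' \<rightarrow>\<^sub>E {1..Suc y}"
        using c(1) assms(7) by (auto simp: cols_def V'_def PiE_iff subset_iff simp del: atLeastAtMost_iff)
      moreover have "proper_on V' E' (restrict c V')"
        unfolding proper_on_def
      proof (intro ballI impI)
        fix a b assume ab: "a \<in> V'" "b \<in> V'" "(a, b) \<in> E'"
        then obtain u v where uv: "a = \<phi> u" "b = \<phi> v" "u \<in> V" "v \<in> V" "(u, v) \<in> E" by (auto simp: E'_def)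
        then have "c u \<noteq> c v" using c(1) by (auto simp: cols_def proper_on_def)
        then show "restrict c V' a \<noteq> restrict c V' b" using uv ab c(2) by simp
      qed
      ultimately show ?thesis by (simp add: cols_def)
    qed
    have inj: "inj_on (\<lambda>c. restrict c V') C"
    proof (rule inj_onI)
      fix c d assume cd: "c \<in> C" "d \<in> C" "restrict c V' = restrict d V'"
      have "c v = d v" if "v \<in> V" for v
      proof -
        have "c (\<phi> v) = d (\<phi> v)" using fun_cong[OF cd(3), of "\<phi> v"] that by (simp add: V'_def)
        then show ?thesis using cd(1,2) that by (simp add: C_def)
      qed
      then show "c = d" using cd(1,2) cols_eqI[of c V E "Suc y" d] by (simp add: C_def)
    qed
    have nc: "\<not> colourable V' E' 4"
    proof
      assume "colourable V' E' 4"
      then obtain f :: "'a \<Rightarrow> nat" where f: "proper_on V' E' f" "card (f ` V') \<le> 4" by (auto simp: colourable_def)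
      have "proper_on V E (f \<circ> \<phi>)" unfolding proper_on_def
      proof (intro ballI impI)
        fix u v assume "u \<in> V" "v \<in> V" "(u, v) \<in> E"
        then have "\<phi> u \<in> V'" "\<phi> v \<in> V'" "(\<phi> u, \<phi> v) \<in> E'" by (auto simp: V'_def E'_def)
        then show "(f \<circ> \<phi>) u \<noteq> (f \<circ> \<phi>) v" using f(1) by (simp add: proper_on_def)
      qed
      moreover have "(f \<circ> \<phi>) ` V = f ` V'" by (auto simp: V'_def)
      ultimately show False using f(2) assms(5) unfolding colourable_def by metis
    qed
    have lk: "linked V' E'"
      unfolding linked_def
    proof (intro allI impI)
      fix W assume W: "W \<subseteq> V'" "W \<noteq> {}" "W \<noteq> V'"
      define U where "U = {v \<in> V. \<phi> v \<in> W}"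
      have "U \<subseteq> V" "U \<noteq> {}" "U \<noteq> V" using W by (auto simp: U_def V'_def)
      then obtain u v where "u \<in> U" "v \<in> V - U" "(u, v) \<in> E" using assms(4) unfolding linked_def by meson
      then show "\<exists>u\<in>W. \<exists>v\<in>V' - W. (u, v) \<in> E'" by (intro bexI[of _ "\<phi> u"] bexI[of _ "\<phi> v"]) (auto simp: U_def V'_def E'_def)
    qed
    have sy: "sym E'" using assms(3) unfolding E'_def sym_def by blast
    obtain c where "c \<in> C" using False by blast
    then have "5 \<le> card (restrict c V' ` V')" using im nc card_colours_ge_5 proper_on_cols by metis
    also have "\<dots> \<le> card V'" using fin' by (rule card_image_le)
    finally have "5 \<le> card V'" .
    then have b: "bound y (card V) = real y ^ k * bound y (card V')"
      using bound_add[of "card V'" y k] assms(8) by (simp add: V'_def)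
    have "card C \<le> card (cols V' E' (Suc y))"
      using inj im finite_cols[OF fin'] by (intro card_inj_on_le[of "\<lambda>c. restrict c V'"]) auto
    also have "real \<dots> \<le> bound y (card V')"
      using fin' sy lk nc assms(8,9) by (intro IH) (auto simp: V'_def)
    finally have "real (card C) * real y ^ k \<le> bound y (card V') * real y ^ k" by (intro mult_right_mono) auto
    then show ?thesis unfolding b C_def[symmetric] by (simp add: mult.commute)
  qed
qed

text \<open>Identify the four vertices of \<open>Q\<close>, which removes three vertices.\<close>

lemma card_monochromatic_colourings:
  fixes V :: "'a set"
  assumes IH: "\<And>(V' :: 'a set) E'. finite V' \<Longrightarrow> sym E' \<Longrightarrow> linked V' E' \<Longrightarrow> \<not> colourable V' E' 4 \<Longrightarrow>
      card V' < card V \<Longrightarrow> real (card (cols V' E' (Suc y))) \<le> bound y (card V')"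
    and "finite V" "sym E" "linked V E" "\<not> colourable V E 4" "4 \<le> y"
    and Q: "Q \<subseteq> V" "card Q = 4"
  shows "real (card {c \<in> cols V E (Suc y). card (c ` Q) = 1}) * real y ^ 3 \<le> bound y (card V)"
proof -
  have finQ: "finite Q" using Q assms(2) finite_subset by blast
  obtain q where q: "q \<in> Q" using Q(2) by fastforce
  define \<phi> where "\<phi> v = (if v \<in> Q then q else v)" for v
  have im: "\<phi> ` V = V - (Q - {q})" using q Q(1) by (auto simp: \<phi>_def)
  have cq: "card (Q - {q}) = 3" using q Q(2) by (simp add: card_Diff_singleton)
  have "card (\<phi> ` V) = card V - 3"
    unfolding im using cq Q(1) finQ by (subst card_Diff_subset) auto
  moreover have "4 \<le> card V" using card_mono[OF assms(2) Q(1)] Q(2) by simp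
  ultimately have card: "card V = card (\<phi> ` V) + 3" by simp
  have "{c \<in> cols V E (Suc y). card (c ` Q) = 1} \<subseteq> {c \<in> cols V E (Suc y). \<forall>v\<in>V. c (\<phi> v) = c v}"
  proof (clarsimp simp: card_1_singleton_iff)
    fix c a v assume "c ` Q = {a}"
    then have "c u = a" if "u \<in> Q" for u using that by blast
    then show "c (\<phi> v) = c v" using q by (simp add: \<phi>_def)
  qed
  then have "card {c \<in> cols V E (Suc y). card (c ` Q) = 1} \<le> card {c \<in> cols V E (Suc y). \<forall>v\<in>V. c (\<phi> v) = c v}"
    using finite_cols[OF assms(2)] by (intro card_mono) auto
  then have "real (card {c \<in> cols V E (Suc y). card (c ` Q) = 1}) * real y ^ 3
      \<le> real (card {c \<in> cols V E (Suc y). \<forall>v\<in>V. c (\<phi> v) = c v}) * real y ^ 3"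
    by (intro mult_right_mono) auto
  also have "\<dots> \<le> bound y (card V)"
    by (rule card_identified_colourings[OF IH assms(2-6) _ card]) (auto simp: im)
  finally show ?thesis .
qed

text \<open>There are seven ways to split \<open>Q\<close> into two nonempty classes, and for each of them identifying the
  classes removes two vertices. A split is represented by the class \<open>A\<close> of a fixed element \<open>q\<close>.\<close>

lemma card_two_coloured:
  fixes V :: "'a set"
  assumes IH: "\<And>(V' :: 'a set) E'. finite V' \<Longrightarrow> sym E' \<Longrightarrow> linked V' E' \<Longrightarrow> \<not> colourable V' E' 4 \<Longrightarrow>
      card V' < card V \<Longrightarrow> real (card (cols V' E' (Suc y))) \<le> bound y (card V')"
    and "finite V" "sym E" "linked V E" "\<not> colourable V E 4" "4 \<le> y"
    and Q: "Q \<subseteq> V" "card Q = 4"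
  shows "real (card {c \<in> cols V E (Suc y). card (c ` Q) = 2}) * real y ^ 2 \<le> 7 * bound y (card V)"
proof -
  have finQ: "finite Q" using Q assms(2) finite_subset by blast
  obtain q where q: "q \<in> Q" using Q(2) by fastforce
  define P where "P = insert q ` (Pow (Q - {q}) - {Q - {q}})"
  have cq: "card (Q - {q}) = 3" using q Q(2) by (simp add: card_Diff_singleton)
  have "card P \<le> card (Pow (Q - {q}) - {Q - {q}})" unfolding P_def using finQ by (intro card_image_le) auto
  also have "\<dots> = 7" using finQ cq by (simp add: card_Diff_singleton card_Pow)
  finally have P7: "card P \<le> 7" .
  have finP: "finite P" unfolding P_def using finQ by auto
  define T where "T A = {c \<in> cols V E (Suc y). \<exists>a b. (\<forall>v\<in>A. c v = a) \<and> (\<forall>v\<in>Q - A. c v = b)}" for A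
  have T: "real (card (T A)) * real y ^ 2 \<le> bound y (card V)" if "A \<in> P" for A
  proof -
    have A: "q \<in> A" "A \<subseteq> Q" "A \<noteq> Q" using that q by (auto simp: P_def)
    then obtain b where b: "b \<in> Q" "b \<notin> A" by blast
    define \<phi> where "\<phi> v = (if v \<in> A then q else if v \<in> Q then b else v)" for v
    have im: "\<phi> ` V = V - (Q - {q, b})"
      using A b q Q(1) by (force simp: \<phi>_def)
    have "card (Q - {q, b}) = 2"
    proof (subst card_Diff_subset)
      show "card Q - card {q, b} = 2" using A(1) b Q(2) by (cases "q = b") auto
    qed (use q b in auto)
    then have "card (\<phi> ` V) = card V - 2"
      unfolding im using Q(1) finQ by (subst card_Diff_subset) auto
    moreover have "4 \<le> card V" using card_mono[OF assms(2) Q(1)] Q(2) by simp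
    ultimately have card: "card V = card (\<phi> ` V) + 2" by simp
    have "T A \<subseteq> {c \<in> cols V E (Suc y). \<forall>v\<in>V. c (\<phi> v) = c v}"
      using A b by (auto simp: T_def \<phi>_def)
    then have "card (T A) \<le> card {c \<in> cols V E (Suc y). \<forall>v\<in>V. c (\<phi> v) = c v}"
      using finite_cols[OF assms(2)] by (intro card_mono) auto
    then have "real (card (T A)) * real y ^ 2
        \<le> real (card {c \<in> cols V E (Suc y). \<forall>v\<in>V. c (\<phi> v) = c v}) * real y ^ 2"
      by (intro mult_right_mono) auto
    also have "\<dots> \<le> bound y (card V)"
      by (rule card_identified_colourings[OF IH assms(2-6) _ card]) (auto simp: im)
    finally show ?thesis .
  qed
  have "{c \<in> cols V E (Suc y). card (c ` Q) = 2} \<subseteq> (\<Union>A\<in>P. T A)"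
  proof
    fix c assume c: "c \<in> {c \<in> cols V E (Suc y). card (c ` Q) = 2}"
    then obtain a b where ab: "c ` Q = {a, b}" "a \<noteq> b" by (auto simp: card_2_iff)
    define A where "A = {v \<in> Q. c v = c q}"
    have "\<exists>v\<in>Q. c v \<noteq> c q" using ab by (metis imageE insert_iff)
    then have "A - {q} \<noteq> Q - {q}" using q by (auto simp: A_def)
    then have "A \<in> P" unfolding P_def using q by (intro image_eqI[of _ _ "A - {q}"]) (auto simp: A_def)
    moreover have "c \<in> T A"
    proof -
      obtain d where "{a, b} = {c q, d}" using ab q by (metis image_eqI insertE insert_commute singletonD)
      then have "\<forall>v\<in>A. c v = c q" "\<forall>v\<in>Q - A. c v = d" using ab by (auto simp: A_def)
      then show ?thesis using c unfolding T_def by blast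
    qed
    ultimately show "c \<in> (\<Union>A\<in>P. T A)" by blast
  qed
  then have "card {c \<in> cols V E (Suc y). card (c ` Q) = 2} \<le> card (\<Union>A\<in>P. T A)"
    using finP finite_cols[OF assms(2), of E] by (intro card_mono) (auto simp: T_def)
  also have "\<dots> \<le> (\<Sum>A\<in>P. card (T A))" using finP by (rule card_UN_le)
  finally have "real (card {c \<in> cols V E (Suc y). card (c ` Q) = 2}) \<le> real (\<Sum>A\<in>P. card (T A))"
    by (rule of_nat_mono)
  then have "real (card {c \<in> cols V E (Suc y). card (c ` Q) = 2}) \<le> (\<Sum>A\<in>P. real (card (T A)))"
    by (simp only: of_nat_sum)
  then have "real (card {c \<in> cols V E (Suc y). card (c ` Q) = 2}) * real y ^ 2 \<le> (\<Sum>A\<in>P. real (card (T A)) * real y ^ 2)"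
    by (simp add: sum_distrib_right[symmetric] mult_right_mono)
  also have "\<dots> \<le> (\<Sum>A\<in>P. bound y (card V))" using T by (intro sum_mono) auto
  also have "\<dots> \<le> 7 * bound y (card V)" using P7 bound_pos[OF assms(6), of "card V"] by (simp add: mult_right_mono)
  finally show ?thesis .
qed

section \<open>Many vertices see many colours\<close>

text \<open>If every vertex of colour \<open>i\<close> missed one of the other four colours, the class \<open>i\<close>, which is
  independent, could be recoloured with the other four.\<close>

lemma dominating_vertex:
  fixes f :: "'a \<Rightarrow> nat"
  assumes "finite V" "sym E" "\<not> colourable V E 4" "proper_on V E f" "card (f ` V) = 5" "i \<in> f ` V"
  shows "\<exists>v\<in>V. f v = i \<and> 4 \<le> card (f ` nbrs V E v)"
proof (rule ccontr)
  assume neg: "\<not> ?thesis"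
  let ?R = "f ` V - {i}"
  have R4: "card ?R = 4" using assms by (simp add: card_Diff_singleton)
  have "\<exists>k\<in>?R. k \<notin> f ` nbrs V E v" if "v \<in> V" "f v = i" for v
  proof (rule ccontr)
    assume "\<not> ?thesis"
    then have "?R \<subseteq> f ` nbrs V E v" by blast
    then have "card ?R \<le> card (f ` nbrs V E v)" using finite_nbrs[OF assms(1)] by (intro card_mono) auto
    then show False using neg that R4 by auto
  qed
  then obtain m where m: "\<And>v. v \<in> V \<Longrightarrow> f v = i \<Longrightarrow> m v \<in> ?R \<and> m v \<notin> f ` nbrs V E v" by metis
  define g where "g v = (if f v = i then m v else f v)" for v
  have "proper_on V E g" unfolding proper_on_def
  proof (intro ballI impI)
    fix u v assume uv: "u \<in> V" "v \<in> V" "(u, v) \<in> E"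
    then have "u \<in> nbrs V E v" "v \<in> nbrs V E u" using assms(2) by (auto simp: nbrs_def dest: symD)
    then have "m u \<noteq> f v" if "f u = i" using m[OF uv(1) that] by auto
    moreover have "m v \<noteq> f u" if "f v = i" using m[OF uv(2) that] \<open>u \<in> nbrs V E v\<close> by auto
    moreover have "f u \<noteq> f v" using assms(4) uv by (auto simp: proper_on_def)
    ultimately show "g u \<noteq> g v" by (auto simp: g_def)
  qed
  moreover have "g ` V \<subseteq> ?R" using m by (auto simp: g_def)
  then have "card (g ` V) \<le> 4" using R4 assms(1) card_mono[of ?R "g ` V"] by simp
  ultimately show False using assms(3) by (auto simp: colourable_def)
qed

lemma five_dominating_vertices:
  fixes f :: "'a \<Rightarrow> nat"
  assumes "finite V" "sym E" "\<not> colourable V E 4" "proper_on V E f" "card (f ` V) = 5"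
  obtains D where "D \<subseteq> V" "card D = 5" "\<And>v. v \<in> D \<Longrightarrow> 4 \<le> card (f ` nbrs V E v)"
proof -
  obtain d where d: "\<And>i. i \<in> f ` V \<Longrightarrow> d i \<in> V \<and> f (d i) = i \<and> 4 \<le> card (f ` nbrs V E (d i))"
    using dominating_vertex[OF assms] by metis
  have "inj_on d (f ` V)" by (rule inj_onI) (metis d)
  then have "card (d ` f ` V) = 5" using assms(5) by (simp add: card_image)
  then show ?thesis using that[of "d ` f ` V"] d by blast
qed

text \<open>Merge colour classes as long as two of them are not joined by an edge. A merged colouring shows at most
  as many colours in any set as the original one, so lower bounds for the numbers of colours seen carry over.\<close>

lemma coarsest_colouring:
  fixes c :: "'a \<Rightarrow> nat"
  assumes "finite V" "sym E" "\<not> colourable V E 4" "proper_on V E c"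
  obtains f :: "'a \<Rightarrow> nat" where "proper_on V E f" "\<And>A. A \<subseteq> V \<Longrightarrow> card (f ` A) \<le> card (c ` A)"
    "5 \<le> card (f ` V)"
    "\<And>i k. i \<in> f ` V \<Longrightarrow> k \<in> f ` V \<Longrightarrow> i \<noteq> k \<Longrightarrow> \<exists>u\<in>V. \<exists>v\<in>V. (u, v) \<in> E \<and> f u = i \<and> f v = k"
proof -
  \<comment> \<open>Mergings of classes are maps of colours; one with the fewest remaining colours is wanted.\<close>
  define P where "P h \<longleftrightarrow> proper_on V E (h \<circ> c)" for h :: "nat \<Rightarrow> nat"
  have "P id" using assms(4) by (simp add: P_def)
  then obtain h where h: "P h" "\<And>h'. P h' \<Longrightarrow> card ((h \<circ> c) ` V) \<le> card ((h' \<circ> c) ` V)"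
    using ex_has_least_nat[of P id "\<lambda>h. card ((h \<circ> c) ` V)"] by blast
  define f where "f = h \<circ> c"
  have pf: "proper_on V E f" using h(1) by (simp add: P_def f_def)
  have 1: "card (f ` A) \<le> card (c ` A)" if "A \<subseteq> V" for A
    unfolding f_def image_comp[symmetric] using finite_subset[OF that assms(1)] by (intro card_image_le) auto
  have 2: "5 \<le> card (f ` V)" using card_colours_ge_5[OF assms(3) pf] .
  have 3: "\<exists>u\<in>V. \<exists>v\<in>V. (u, v) \<in> E \<and> f u = i \<and> f v = k" if ik: "i \<in> f ` V" "k \<in> f ` V" "i \<noteq> k" for i k
  proof (rule ccontr)
    assume neg: "\<not> ?thesis"
    define h' where "h' a = (if h a = k then i else h a)" for a
    have hc: "(h' \<circ> c) v = (if f v = k then i else f v)" for v by (simp add: h'_def f_def)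
    have "P h'" unfolding P_def proper_on_def
    proof (intro ballI impI)
      fix u v assume uv: "u \<in> V" "v \<in> V" "(u, v) \<in> E"
      moreover have "(v, u) \<in> E" using uv assms(2) by (auto dest: symD)
      ultimately show "(h' \<circ> c) u \<noteq> (h' \<circ> c) v" using neg pf unfolding hc proper_on_def by (auto split: if_splits)
    qed
    then have "card (f ` V) \<le> card ((h' \<circ> c) ` V)" using h(2) by (simp add: f_def)
    also have "\<dots> \<le> card (f ` V - {k})"
      using ik assms(1) by (intro card_mono) (auto simp: hc simp del: o_apply)
    also have "\<dots> < card (f ` V)" using ik assms(1) by (intro psubset_card_mono) auto
    finally show False by simp
  qed
  show thesis by (rule that[OF pf 1 2 3])
qed

text \<open>Six classes that are pairwise joined by edges give 30 ordered pairs of classes; each is witnessed by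
  a vertex of the first class that sees the second, and different pairs give different pairs of a vertex and
  a colour.\<close>

lemma sum_seen_ge_30:
  fixes f :: "'a \<Rightarrow> nat"
  assumes "finite V" "proper_on V E f" "6 \<le> card (f ` V)"
    and "\<And>i k. i \<in> f ` V \<Longrightarrow> k \<in> f ` V \<Longrightarrow> i \<noteq> k \<Longrightarrow> \<exists>u\<in>V. \<exists>v\<in>V. (u, v) \<in> E \<and> f u = i \<and> f v = k"
  shows "30 \<le> (\<Sum>v\<in>V. min 5 (card (f ` nbrs V E v)))"
proof -
  obtain R where R: "R \<subseteq> f ` V" "card R = 6" "finite R"
    using obtain_subset_with_card_n[OF assms(3)] by metis
  define S where "S = (SIGMA v:{v \<in> V. f v \<in> R}. R \<inter> f ` nbrs V E v)"
  have "(SIGMA i:R. R - {i}) \<subseteq> (\<lambda>(v, k). (f v, k)) ` S"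
  proof (intro subsetI, elim SigmaE)
    fix z i k assume z: "z = (i, k)" and "i \<in> R" "k \<in> R - {i}"
    then have ik: "i \<in> R" "k \<in> R" "k \<noteq> i" by auto
    then obtain u v where "u \<in> V" "v \<in> V" "(u, v) \<in> E" "f u = k" "f v = i" using assms(4)[of k i] R(1) by blast
    then have "(v, k) \<in> S" using ik by (auto simp: S_def nbrs_def)
    then show "z \<in> (\<lambda>(v, k). (f v, k)) ` S"
      using \<open>f v = i\<close> z by (intro image_eqI[of _ _ "(v, k)"]) simp_all
  qed
  moreover have finS: "finite S" unfolding S_def using assms(1) R(3) by (intro finite_SigmaI) auto
  ultimately have "card (SIGMA i:R. R - {i}) \<le> card S"
    using surj_card_le[of S "SIGMA i:R. R - {i}" "\<lambda>(v, k). (f v, k)"] by simp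
  moreover have "card (SIGMA i:R. R - {i}) = 30" using R by (simp add: card_SigmaI card_Diff_singleton)
  moreover have "card S = (\<Sum>v\<in>{v \<in> V. f v \<in> R}. card (R \<inter> f ` nbrs V E v))"
    unfolding S_def using assms(1) R(3) by (intro card_SigmaI) auto
  moreover have "\<dots> \<le> (\<Sum>v\<in>{v \<in> V. f v \<in> R}. min 5 (card (f ` nbrs V E v)))"
  proof (rule sum_mono)
    fix v assume v: "v \<in> {v \<in> V. f v \<in> R}"
    have "R \<inter> f ` nbrs V E v \<subseteq> R - {f v}" using assms(2) v by (auto simp: proper_on_def nbrs_def)
    then have "card (R \<inter> f ` nbrs V E v) \<le> card (R - {f v})" using R by (intro card_mono) auto
    also have "\<dots> = 5" using v R by (simp add: card_Diff_singleton)
    finally have "card (R \<inter> f ` nbrs V E v) \<le> 5" .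
    moreover have "card (R \<inter> f ` nbrs V E v) \<le> card (f ` nbrs V E v)"
      using finite_nbrs[OF assms(1)] by (intro card_mono) auto
    ultimately show "card (R \<inter> f ` nbrs V E v) \<le> min 5 (card (f ` nbrs V E v))" by simp
  qed
  moreover have "\<dots> \<le> (\<Sum>v\<in>V. min 5 (card (f ` nbrs V E v)))"
    using assms(1) by (intro sum_mono2) auto
  ultimately show ?thesis by linarith
qed

section \<open>Two numerical inequalities\<close>

text \<open>A concave function with \<open>f 0 = 0\<close> lies above its chord. With \<open>t = 1/y\<close> this reduces inequalities for all
  \<open>y \<ge> 5\<close> to \<open>y = 5\<close>.\<close>

lemma concave_from_zero:
  fixes f f' f'' :: "real \<Rightarrow> real"
  assumes "\<And>t. 0 \<le> t \<Longrightarrow> t \<le> 1/5 \<Longrightarrow> (f has_real_derivative f' t) (at t)"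
    and "\<And>t. 0 \<le> t \<Longrightarrow> t \<le> 1/5 \<Longrightarrow> (f' has_real_derivative f'' t) (at t)"
    and "\<And>t. 0 \<le> t \<Longrightarrow> t \<le> 1/5 \<Longrightarrow> f'' t \<le> 0"
    and "f 0 = 0" "0 \<le> t" "t \<le> 1/5"
  shows "5 * t * f (1/5) \<le> f t"
proof -
  have "convex_on {0..1/5} (\<lambda>t. - f t)"
  proof (rule f''_ge0_imp_convex)
    show "convex {0..1/5::real}" by simp
  next
    fix t :: real assume "t \<in> {0..1/5}"
    then show "((\<lambda>t. - f t) has_real_derivative - f' t) (at t)" using assms(1)[of t] by (intro DERIV_minus) auto
  next
    fix t :: real assume "t \<in> {0..1/5}"
    then show "((\<lambda>t. - f' t) has_real_derivative - f'' t) (at t)" using assms(2)[of t] by (intro DERIV_minus) auto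
  next
    fix t :: real assume "t \<in> {0..1/5}"
    then show "0 \<le> - f'' t" using assms(3)[of t] by simp
  qed
  then have "- f ((1 - 5 * t) *\<^sub>R 0 + (5 * t) *\<^sub>R (1/5)) \<le> (1 - 5 * t) * - f 0 + (5 * t) * - f (1/5)"
    by (rule convex_onD) (use assms(5,6) in auto)
  then show ?thesis using assms(4) by simp
qed

text \<open>In \<open>t = 1/y\<close> the second derivative is \<open>a / (1 + t)\<^sup>2 + b / (1 - t)\<^sup>2 + 4 c / (1 - 2 t)\<^sup>2 - 9 / (1 - 3 t)\<^sup>2\<close>,
  and the last denominator is the smallest; this explains the condition on the coefficients.\<close>

lemma log_combination:
  fixes a b c :: real
  assumes "max a 0 + max b 0 + 4 * max c 0 \<le> 9" and "5 \<le> y"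
    and "0 < - a * ln (6/5) + b * ln (5/4) + c * ln (5/3) - ln (5/2)"
  shows "0 < a * log_gain y 0 + b * log_gain y 2 + c * log_gain y 3 - log_gain y 4"
proof -
  define f where "f t = - a * ln (1 + t) - b * ln (1 - t) - c * ln (1 - 2 * t) + ln (1 - 3 * t)" for t :: real
  define f' where "f' t = - a / (1 + t) + b / (1 - t) + 2 * c / (1 - 2 * t) - 3 / (1 - 3 * t)" for t :: real
  define f'' where "f'' t = a / (1 + t)\<^sup>2 + b / (1 - t)\<^sup>2 + 4 * c / (1 - 2 * t)\<^sup>2 - 9 / (1 - 3 * t)\<^sup>2" for t :: real
  have d1: "(f has_real_derivative f' t) (at t)" if "0 \<le> t" "t \<le> 1/5" for t
  proof -
    have "((\<lambda>t. ln (1 + t)) has_real_derivative 1 / (1 + t)) (at t)"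
      "((\<lambda>t. ln (1 - t)) has_real_derivative - 1 / (1 - t)) (at t)"
      "((\<lambda>t. ln (1 - 2 * t)) has_real_derivative - 2 / (1 - 2 * t)) (at t)"
      "((\<lambda>t. ln (1 - 3 * t)) has_real_derivative - 3 / (1 - 3 * t)) (at t)"
      using that by (auto intro!: derivative_eq_intros)
    then have "((\<lambda>t. - a * ln (1 + t) - b * ln (1 - t) - c * ln (1 - 2 * t) + ln (1 - 3 * t)) has_real_derivative
      - a * (1 / (1 + t)) - b * (- 1 / (1 - t)) - c * (- 2 / (1 - 2 * t)) + (- 3 / (1 - 3 * t))) (at t)"
      by (intro DERIV_add DERIV_diff DERIV_cmult)
    moreover have "- a * (1 / (1 + t)) - b * (- 1 / (1 - t)) - c * (- 2 / (1 - 2 * t)) + (- 3 / (1 - 3 * t)) = f' t"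
      by (simp add: f'_def mult.commute)
    ultimately show ?thesis unfolding f_def by simp
  qed
  have d2: "(f' has_real_derivative f'' t) (at t)" if "0 \<le> t" "t \<le> 1/5" for t
  proof -
    have "((\<lambda>t. 1 / (1 + t)) has_real_derivative - 1 / (1 + t)\<^sup>2) (at t)"
      "((\<lambda>t. 1 / (1 - t)) has_real_derivative 1 / (1 - t)\<^sup>2) (at t)"
      "((\<lambda>t. 1 / (1 - 2 * t)) has_real_derivative 2 / (1 - 2 * t)\<^sup>2) (at t)"
      "((\<lambda>t. 1 / (1 - 3 * t)) has_real_derivative 3 / (1 - 3 * t)\<^sup>2) (at t)"
      using that by (auto intro!: derivative_eq_intros simp: power2_eq_square)
    then have "((\<lambda>t. - a * (1 / (1 + t)) + b * (1 / (1 - t)) + 2 * c * (1 / (1 - 2 * t)) - 3 * (1 / (1 - 3 * t))) has_real_derivative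
      - a * (- 1 / (1 + t)\<^sup>2) + b * (1 / (1 - t)\<^sup>2) + 2 * c * (2 / (1 - 2 * t)\<^sup>2) - 3 * (3 / (1 - 3 * t)\<^sup>2)) (at t)"
      by (intro DERIV_add DERIV_diff DERIV_cmult)
    moreover have "- a * (- 1 / (1 + t)\<^sup>2) + b * (1 / (1 - t)\<^sup>2) + 2 * c * (2 / (1 - 2 * t)\<^sup>2) - 3 * (3 / (1 - 3 * t)\<^sup>2) = f'' t"
      by (simp add: f''_def)
    moreover have "f' = (\<lambda>t. - a * (1 / (1 + t)) + b * (1 / (1 - t)) + 2 * c * (1 / (1 - 2 * t)) - 3 * (1 / (1 - 3 * t)))"
      by (simp add: f'_def fun_eq_iff)
    ultimately show ?thesis by simp
  qed
  have d3: "f'' t \<le> 0" if t: "0 \<le> t" "t \<le> 1/5" for t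
  proof -
    define w where "w = 1 / (1 - 3 * t)\<^sup>2"
    have w: "w > 0" using t by (simp add: w_def)
    have le: "k / (1 - m)\<^sup>2 \<le> max k 0 * w" if "m \<le> 3 * t" for k m :: real
    proof -
      have "1 / (1 - m)\<^sup>2 \<le> w"
        unfolding w_def using that t by (intro divide_left_mono power_mono mult_pos_pos zero_less_power) auto
      moreover have "0 \<le> 1 / (1 - m)\<^sup>2" by simp
      ultimately have "max k 0 * (1 / (1 - m)\<^sup>2) \<le> max k 0 * w" by (intro mult_left_mono) auto
      moreover have "k * (1 / (1 - m)\<^sup>2) \<le> max k 0 * (1 / (1 - m)\<^sup>2)" by (intro mult_right_mono) auto
      ultimately show ?thesis by simp
    qed
    have "a / (1 + t)\<^sup>2 \<le> max a 0 * w" using le[of "- t" a] t by simp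
    moreover have "b / (1 - t)\<^sup>2 \<le> max b 0 * w" using le[of t b] t by simp
    moreover have "c / (1 - 2 * t)\<^sup>2 \<le> max c 0 * w" using le[of "2 * t" c] t by simp
    moreover have "9 / (1 - 3 * t)\<^sup>2 = 9 * w" by (simp add: w_def)
    moreover have "(max a 0 + max b 0 + 4 * max c 0) * w \<le> 9 * w" using assms(1) w by (intro mult_right_mono) auto
    moreover have "4 * c / (1 - 2 * t)\<^sup>2 = 4 * (c / (1 - 2 * t)\<^sup>2)" by simp
    ultimately show ?thesis unfolding f''_def by (simp only: ring_distribs)
  qed
  have t: "0 \<le> 1 / real y" "1 / real y \<le> 1/5" using assms(2) by (simp_all add: field_simps)
  have f5: "f (1/5) = - a * ln (6/5) + b * ln (5/4) + c * ln (5/3) - ln (5/2)"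
  proof -
    have "ln (5/4 :: real) = - ln (4/5)" "ln (5/3 :: real) = - ln (3/5)" "ln (5/2 :: real) = - ln (2/5)"
      by (simp_all add: ln_div)
    then show ?thesis by (simp add: f_def)
  qed
  have "0 < 5 * (1 / real y) * f (1/5)"
    using assms(2,3) unfolding f5 by (intro mult_pos_pos) auto
  also have "\<dots> \<le> f (1 / real y)"
    by (rule concave_from_zero[OF d1 d2 d3 _ t]) (auto simp: f_def)
  also have "\<dots> = a * log_gain y 0 + b * log_gain y 2 + c * log_gain y 3 - log_gain y 4"
    using assms(2) log_gain_0[of y] log_gain_Suc[of y 1] log_gain_Suc[of y 2] log_gain_Suc[of y 3]
    by (simp add: f_def eval_nat_numeral)
  finally show ?thesis .
qed

text \<open>The constant \<open>33/5\<close> is close to best possible: at \<open>y = 5\<close> the ratio is about 6.58, and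
  \<open>total_gain_six_classes\<close> tolerates slightly more than 6.61.\<close>

lemma clique_gain_le:
  assumes "5 \<le> y"
  shows "clique_gain y \<le> 33/5 * log_gain y 2"
proof -
  have "0 < - (-1) * ln (6/5 :: real) + 28/5 * ln (5/4) + (-1) * ln (5/3) - ln (5/2)"
  proof -
    \<comment> \<open>Five times the claim, exponentiated.\<close>
    have "ln ((4::real) ^ 28) < ln (5 ^ 13 * 6 ^ 10)" by (subst ln_less_cancel_iff) auto
    then have "28 * ln (4::real) < 13 * ln 5 + 10 * ln 6"
      by (simp only: ln_mult_pos zero_less_power zero_less_numeral ln_realpow of_nat_numeral)
    moreover have "ln (6::real) = ln 2 + ln 3" using ln_mult_pos[of "2::real" 3] by simp
    ultimately show ?thesis by (simp add: ln_div field_simps)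
  qed
  from log_combination[OF _ assms this] show ?thesis by (simp add: clique_gain_def)
qed

text \<open>The comparison needed in \<open>many_vertices_gain\<close>, with slightly smaller coefficients of
  the second and third term.\<close>

lemma fine_gain_exceeds_clique_gain:
  assumes "5 \<le> y"
  shows "0 < 6/5 * log_gain y 0 + 3 * log_gain y 2 + 19/20 * log_gain y 3 - log_gain y 4"
proof -
  have "0 < - (6/5) * ln (6/5 :: real) + 3 * ln (5/4) + 19/20 * ln (5/3) - ln (5/2)"
  proof -
    \<comment> \<open>Twenty times the claim, exponentiated.\<close>
    have "ln ((4::real) ^ 60 * 6 ^ 24 * 3 ^ 19) < ln (5 ^ 83 * 2 ^ 20)" by (subst ln_less_cancel_iff) auto
    then have "60 * ln (4::real) + 24 * ln 6 + 19 * ln 3 < 83 * ln 5 + 20 * ln 2"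
      by (simp only: ln_mult_pos zero_less_power zero_less_numeral mult_pos_pos ln_realpow of_nat_numeral)
    then show ?thesis by (simp add: ln_div field_simps)
  qed
  from log_combination[OF _ assms this] show ?thesis by simp
qed

lemma clique_gain_ge:
  assumes "4 \<le> y"
  shows "5 * log_gain y 2 \<le> clique_gain y"
  using log_gain_linear[of 0 y] log_gain_linear[of 3 y] log_gain_linear[of 4 y] assms by (simp add: clique_gain_def)

lemma clique_gain_eq:
  assumes "4 \<le> y" "5 \<le> n"
  shows "clique_gain y = n * ln y - ln (bound y n)"
proof -
  have n: "n = (n - 4) + 4" using assms by simp
  have "ln (bound y n) = ln (real y + 1) + (n - 4) * ln y + ln (real y - 1) + ln (real y - 2) + ln (real y - 3)"
    unfolding bound_def using assms by (simp add: ln_mult_pos ln_realpow)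
  moreover have "clique_gain y = 4 * ln y - ln (real y + 1) - ln (real y - 1) - ln (real y - 2) - ln (real y - 3)"
    unfolding clique_gain_def log_gain_def using assms by (simp add: ln_div)
  moreover have "n * ln y = (n - 4) * ln y + 4 * ln y" by (subst n) (simp add: ring_distribs)
  ultimately show ?thesis by simp
qed

section \<open>Graphs of minimum degree four\<close>

abbreviation mono_count :: "'a set \<Rightarrow> ('a \<times> 'a) set \<Rightarrow> ('a \<Rightarrow> nat) \<Rightarrow> real" where
  "mono_count V E c \<equiv> (\<Sum>v\<in>V. of_bool (card (c ` nbrs V E v) = 1))"

text \<open>In units of the log-gain of a vertex that sees two colours, a vertex of degree at least 4 that sees
  \<open>j = 1, 2, 3\<close> colours gains at least \<open>-1/5\<close>, \<open>1/4\<close>, \<open>2/3\<close>. The first part combines the first two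
  values: \<open>1/4 - 9/20 = -1/5\<close>.\<close>

lemma gain_nbrs:
  assumes "finite V" "2 \<le> y" "c \<in> cols V E (Suc y)" "v \<in> V" "4 \<le> card (nbrs V E v)"
  defines "j \<equiv> card (c ` nbrs V E v)"
  shows "log_gain y 2 * (1/4 - 9/20 * of_bool (j = 1)) \<le> gain V E y c v"
    and "3 \<le> j \<Longrightarrow> log_gain y 2 * (2/3) \<le> gain V E y c v"
    and "log_gain y 2 * (j / 2 - 1) \<le> gain V E y c v"
    and "1 \<le> j"
proof -
  have fin: "finite (nbrs V E v)" using assms(1) by (rule finite_nbrs)
  have L2: "0 < log_gain y 2" using assms(2) by (rule log_gain_2_pos)
  have lin: "log_gain y 2 * (s - 1) \<le> gain V E y c v" if "s \<le> spread c (nbrs V E v)" for s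
  proof -
    have "log_gain y 2 * (s - 1) \<le> log_gain y 2 * (spread c (nbrs V E v) - 1)"
      using that L2 by (intro mult_left_mono) auto
    also have "\<dots> \<le> gain V E y c v" by (rule gain_linear[OF assms(1-4) order.refl])
    finally show ?thesis .
  qed
  have "nbrs V E v \<noteq> {}" using assms(5) by auto
  then show j1: "1 \<le> j" unfolding j_def using fin by (simp add: Suc_le_eq card_gt_0_iff)
  show "log_gain y 2 * (j / 2 - 1) \<le> gain V E y c v"
    using lin[OF spread_ge[OF fin]] by (simp add: j_def)
  show g3: "log_gain y 2 * (2/3) \<le> gain V E y c v" if "3 \<le> j"
    using lin[OF spread_3[OF fin assms(5)]] that by (simp add: j_def)
  have "j = 1 \<or> j = 2 \<or> 3 \<le> j" using j1 by linarith
  then show "log_gain y 2 * (1/4 - 9/20 * of_bool (j = 1)) \<le> gain V E y c v"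
  proof (elim disjE)
    assume "j = 1"
    then show ?thesis using lin[OF spread_1[OF fin assms(5)]] by (simp add: j_def)
  next
    assume "j = 2"
    then show ?thesis using lin[OF spread_2[OF fin assms(5)]] by (simp add: j_def)
  next
    assume j: "3 \<le> j"
    have "log_gain y 2 * (1/4) \<le> log_gain y 2 * (2/3)" using L2 by simp
    then show ?thesis using g3[OF j] j by simp
  qed
qed

text \<open>The five vertices of \<open>D\<close> gain as much as \<open>K\<^sub>5\<close>; the other vertices gain \<open>1/4\<close> unless they have a
  monochromatic neighbourhood.\<close>

lemma total_gain_dominated:
  assumes "finite V" "4 \<le> y" "c \<in> cols V E (Suc y)" "\<And>v. v \<in> V \<Longrightarrow> 4 \<le> card (nbrs V E v)"
    and D: "D \<subseteq> V" "card D = 5" "\<And>v. v \<in> D \<Longrightarrow> 4 \<le> card (c ` nbrs V E v)"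
  shows "clique_gain y + log_gain y 2 * ((real (card V) - 5) / 4 - 9/20 * mono_count V E c) \<le> (\<Sum>v\<in>V. gain V E y c v)"
proof -
  have finD: "finite D" using D(1) assms(1) finite_subset by blast
  have "clique_gain y = (\<Sum>v\<in>D. clique_gain y / 5)" using D(2) by simp
  also have "\<dots> \<le> (\<Sum>v\<in>D. gain V E y c v)"
    using D assms(1-3) by (intro sum_mono gain_dominating) auto
  finally have 1: "clique_gain y \<le> (\<Sum>v\<in>D. gain V E y c v)" .
  have "(\<Sum>v\<in>V - D. log_gain y 2 * (1/4 - 9/20 * of_bool (card (c ` nbrs V E v) = 1))) \<le> (\<Sum>v\<in>V - D. gain V E y c v)"
    using assms by (intro sum_mono gain_nbrs(1)) auto
  moreover have "mono_count V E c = (\<Sum>v\<in>V - D. of_bool (card (c ` nbrs V E v) = 1)) + (\<Sum>v\<in>D. of_bool (card (c ` nbrs V E v) = 1))"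
    using D(1) assms(1) by (rule sum.subset_diff)
  moreover have "(\<Sum>v\<in>D. of_bool (card (c ` nbrs V E v) = 1)) = (0 :: real)"
    using D(3) by (intro sum.neutral) fastforce
  moreover have "real (card (V - D)) = real (card V) - 5"
    using D finD card_mono[OF assms(1) D(1)] by (subst card_Diff_subset) (auto simp: of_nat_diff)
  moreover have "(\<Sum>v\<in>V - D. log_gain y 2 * (1/4 - 9/20 * of_bool (card (c ` nbrs V E v) = 1)))
      = log_gain y 2 * (real (card (V - D)) / 4 - 9/20 * (\<Sum>v\<in>V - D. of_bool (card (c ` nbrs V E v) = 1)))"
    by (simp only: sum_distrib_left[symmetric] sum_subtractf sum_constant) simp
  ultimately have 2: "log_gain y 2 * ((real (card V) - 5) / 4 - 9/20 * mono_count V E c) \<le> (\<Sum>v\<in>V - D. gain V E y c v)"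
    by simp
  have "(\<Sum>v\<in>V. gain V E y c v) = (\<Sum>v\<in>V - D. gain V E y c v) + (\<Sum>v\<in>D. gain V E y c v)"
    using D(1) assms(1) by (rule sum.subset_diff)
  then show ?thesis using 1 2 by simp
qed

text \<open>The gain of a vertex is bounded below by a linear function of the number of colours it sees, cut off at
  5, and the numbers of colours add up to at least 30, that is, to an average of at least 3. Vertices that
  see one colour only are charged separately.\<close>

lemma total_gain_six_classes:
  assumes "finite V" "5 \<le> y" "c \<in> cols V E (Suc y)" "\<And>v. v \<in> V \<Longrightarrow> 4 \<le> card (nbrs V E v)"
    and "card V \<le> 10" "30 \<le> (\<Sum>v\<in>V. min 5 (card (c ` nbrs V E v)))"
  shows "clique_gain y + log_gain y 2 * (1/20 - 9/20 * mono_count V E c) \<le> (\<Sum>v\<in>V. gain V E y c v)"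
proof -
  have L2: "0 < log_gain y 2" using assms(2) by (intro log_gain_2_pos) simp
  define K where "K = clique_gain y / log_gain y 2"
  have K: "clique_gain y = K * log_gain y 2" using L2 by (simp add: K_def)
  have K66: "K \<le> 33/5" using clique_gain_le[OF assms(2)] L2 by (simp add: K_def field_simps)
  have K5: "5 \<le> K" using clique_gain_ge[of y] assms(2) L2 by (simp add: K_def field_simps)
  \<comment> \<open>The slope. With average 3 over ten vertices the bound \<open>1/4 + s (j - 2)\<close> adds up to \<open>5/2 + 10 s\<close>, and
    \<open>s\<close> is chosen to make this \<open>K + 1/20\<close>; the line then stays below the gains \<open>2/3\<close>, \<open>K/5\<close>, \<open>3/2\<close>
    for three, four, five colours because \<open>5 \<le> K \<le> 33/5\<close>.\<close>
  define s where "s = K / 10 - 49/200"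
  define j where "j v = card (c ` nbrs V E v)" for v
  have point: "log_gain y 2 * (1/4 + s * (real (min 5 (j v)) - 2) - 9/20 * of_bool (j v = 1)) \<le> gain V E y c v"
    if v: "v \<in> V" for v
  proof -
    have y2: "2 \<le> y" using assms(2) by simp
    note g = gain_nbrs[OF assms(1) y2 assms(3) v assms(4)[OF v], folded j_def[of v]]
    have step: ?thesis
      if "1/4 + s * (real (min 5 (j v)) - 2) - 9/20 * of_bool (j v = 1) \<le> r" "log_gain y 2 * r \<le> gain V E y c v" for r
      using mult_left_mono[OF that(1), of "log_gain y 2"] L2 that(2) by linarith
    consider "j v = 1" | "j v = 2" | "j v = 3" | "j v = 4" | "5 \<le> j v" using g(4) by linarith
    then show ?thesis
    proof cases
      case 1
      then show ?thesis using g(1) K5 by (intro step[of "1/4 - 9/20"]) (simp_all add: s_def)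
    next
      case 2
      then show ?thesis using g(1) by (intro step[of "1/4"]) simp_all
    next
      case 3
      then show ?thesis using g(2) K66 by (intro step[of "2/3"]) (simp_all add: s_def)
    next
      case 4
      have "clique_gain y / 5 \<le> gain V E y c v"
        using assms(1-3) v 4 by (intro gain_dominating) (auto simp: j_def)
      then show ?thesis using 4 K by (intro step[of "K / 5"]) (simp_all add: s_def mult.commute)
    next
      case 5
      then have "log_gain y 2 * (3/2) \<le> log_gain y 2 * (j v / 2 - 1)" using L2 by (intro mult_left_mono) auto
      then have "log_gain y 2 * (3/2) \<le> gain V E y c v" using g(3) by linarith
      then show ?thesis using 5 K66 by (intro step[of "3/2"]) (simp_all add: s_def)
    qed
  qed
  have "(\<Sum>v\<in>V. log_gain y 2 * (1/4 + s * (real (min 5 (j v)) - 2) - 9/20 * of_bool (j v = 1))) \<le> (\<Sum>v\<in>V. gain V E y c v)"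
    using point by (rule sum_mono)
  moreover have "(\<Sum>v\<in>V. log_gain y 2 * (1/4 + s * (real (min 5 (j v)) - 2) - 9/20 * of_bool (j v = 1)))
      = log_gain y 2 * (card V / 4 + s * (real (\<Sum>v\<in>V. min 5 (j v)) - 2 * card V) - 9/20 * mono_count V E c)"
    unfolding j_def[symmetric]
    by (simp only: sum_distrib_left[symmetric] sum_subtractf sum.distrib sum_constant of_nat_sum) simp
  moreover have "log_gain y 2 * (K + 1/20 - 9/20 * mono_count V E c)
      \<le> log_gain y 2 * (card V / 4 + s * (real (\<Sum>v\<in>V. min 5 (j v)) - 2 * card V) - 9/20 * mono_count V E c)"
  proof -
    have s: "1/8 \<le> s" using K5 by (simp add: s_def)
    have "s * (30 - 2 * real (card V)) \<le> s * (real (\<Sum>v\<in>V. min 5 (j v)) - 2 * card V)"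
      using s assms(6) unfolding j_def by (intro mult_left_mono) linarith+
    moreover have "0 \<le> (10 - real (card V)) * (2 * s - 1/4)" using assms(5) s by (intro mult_nonneg_nonneg) auto
    then have "K + 1/20 \<le> card V / 4 + s * (30 - 2 * real (card V))"
      by (simp add: s_def field_simps)
    ultimately show ?thesis using L2 by (intro mult_left_mono) auto
  qed
  ultimately show ?thesis by (simp add: K algebra_simps)
qed

lemma sum_mono_count_le:
  fixes V :: "'a set"
  assumes IH: "\<And>(V' :: 'a set) E'. finite V' \<Longrightarrow> sym E' \<Longrightarrow> linked V' E' \<Longrightarrow> \<not> colourable V' E' 4 \<Longrightarrow>
      card V' < card V \<Longrightarrow> real (card (cols V' E' (Suc y))) \<le> bound y (card V')"
    and G: "finite V" "sym E" "linked V E" "\<not> colourable V E 4" "4 \<le> y"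
    and deg: "\<And>v. v \<in> V \<Longrightarrow> 4 \<le> card (nbrs V E v)"
  shows "(\<Sum>c\<in>cols V E (Suc y). mono_count V E c) * real y ^ 3 \<le> card V * bound y (card V)"
proof -
  let ?C = "cols V E (Suc y)"
  have finC: "finite ?C" using G(1) by (rule finite_cols)
  have one: "(\<Sum>c\<in>?C. of_bool (card (c ` nbrs V E v) = 1)) * real y ^ 3 \<le> bound y (card V)" if v: "v \<in> V" for v
  proof -
    obtain Q where Q: "Q \<subseteq> nbrs V E v" "card Q = 4" using obtain_subset_with_card_n[OF deg[OF v]] by metis
    have QV: "Q \<subseteq> V" using Q(1) by (auto simp: nbrs_def)
    have "(\<Sum>c\<in>?C. of_bool (card (c ` nbrs V E v) = 1)) = real (card (?C \<inter> {c. card (c ` nbrs V E v) = 1}))"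
      by (subst sum_of_bool_eq) (simp_all add: finC)
    also have "\<dots> \<le> real (card {c \<in> ?C. card (c ` Q) = 1})"
    proof (intro of_nat_mono card_mono subsetI)
      fix c assume c: "c \<in> ?C \<inter> {c. card (c ` nbrs V E v) = 1}"
      then obtain a where "c ` nbrs V E v = {a}" by (auto simp: card_1_singleton_iff)
      then have "c ` Q \<subseteq> {a}" using Q(1) by blast
      moreover have "Q \<noteq> {}" using Q(2) by auto
      ultimately have "c ` Q = {a}" by blast
      then show "c \<in> {c \<in> ?C. card (c ` Q) = 1}" using c by simp
    qed (use finC in auto)
    finally have "(\<Sum>c\<in>?C. of_bool (card (c ` nbrs V E v) = 1)) * real y ^ 3
        \<le> real (card {c \<in> ?C. card (c ` Q) = 1}) * real y ^ 3"
      by (intro mult_right_mono) auto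
    also have "\<dots> \<le> bound y (card V)" by (rule card_monochromatic_colourings[OF IH G QV Q(2)])
    finally show ?thesis .
  qed
  have "(\<Sum>c\<in>?C. mono_count V E c) * real y ^ 3
      = (\<Sum>v\<in>V. (\<Sum>c\<in>?C. of_bool (card (c ` nbrs V E v) = 1)) * real y ^ 3)"
    by (subst sum.swap) (simp add: sum_distrib_right)
  also have "\<dots> \<le> (\<Sum>v\<in>V. bound y (card V))" using one by (rule sum_mono)
  finally show ?thesis by simp
qed

text \<open>Either the coarsest merging has five classes, and \<open>total_gain_dominated\<close> applies, or it has at
  least six, which is impossible for \<open>y = 4\<close>.\<close>

lemma few_vertices_gain:
  fixes c :: "'a \<Rightarrow> nat"
  assumes G: "finite V" "sym E" "\<not> colourable V E 4" "4 \<le> y"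
    and deg: "\<And>v. v \<in> V \<Longrightarrow> 4 \<le> card (nbrs V E v)"
    and n: "6 \<le> card V" "y = 4 \<or> card V \<le> 10" and c: "c \<in> cols V E (Suc y)"
  shows "clique_gain y + log_gain y 2 * ((if y = 4 then (real (card V) - 5) / 4 else 1/20) - 9/20 * mono_count V E c)
    \<le> (\<Sum>v\<in>V. gain V E y c v)"
proof -
  have L2: "0 < log_gain y 2" using G(4) by (intro log_gain_2_pos) simp
  obtain f :: "'a \<Rightarrow> nat" where f: "proper_on V E f" "\<And>A. A \<subseteq> V \<Longrightarrow> card (f ` A) \<le> card (c ` A)"
    "5 \<le> card (f ` V)"
    "\<And>i k. i \<in> f ` V \<Longrightarrow> k \<in> f ` V \<Longrightarrow> i \<noteq> k \<Longrightarrow> \<exists>u\<in>V. \<exists>v\<in>V. (u, v) \<in> E \<and> f u = i \<and> f v = k"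
    using coarsest_colouring[OF G(1-3) proper_on_cols[OF c]] by metis
  have nb: "card (f ` nbrs V E v) \<le> card (c ` nbrs V E v)" for v by (rule f(2)) (auto simp: nbrs_def)
  show ?thesis
  proof (cases "card (f ` V) = 5")
    case True
    obtain D where D: "D \<subseteq> V" "card D = 5" "\<And>v. v \<in> D \<Longrightarrow> 4 \<le> card (f ` nbrs V E v)"
      using five_dominating_vertices[OF G(1-3) f(1) True] by metis
    have "clique_gain y + log_gain y 2 * ((real (card V) - 5) / 4 - 9/20 * mono_count V E c) \<le> (\<Sum>v\<in>V. gain V E y c v)"
      using D(3) nb order.trans by (intro total_gain_dominated[OF G(1,4) c deg D(1,2)]) blast+
    moreover have "log_gain y 2 * ((if y = 4 then (real (card V) - 5) / 4 else 1/20) - 9/20 * mono_count V E c)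
        \<le> log_gain y 2 * ((real (card V) - 5) / 4 - 9/20 * mono_count V E c)"
      using L2 n(1) by (intro mult_left_mono) auto
    ultimately show ?thesis by linarith
  next
    case False
    then have six: "6 \<le> card (f ` V)" using f(3) by simp
    have y5: "y \<noteq> 4"
    proof
      assume "y = 4"
      have "card (f ` V) \<le> card (c ` V)" by (rule f(2)) simp
      also have "\<dots> \<le> card {1..Suc y}" using cols_image_subset[OF c order.refl] by (intro card_mono) auto
      finally show False using six \<open>y = 4\<close> by simp
    qed
    have "30 \<le> (\<Sum>v\<in>V. min 5 (card (f ` nbrs V E v)))" using sum_seen_ge_30[OF G(1) f(1) six f(4)] .
    also have "\<dots> \<le> (\<Sum>v\<in>V. min 5 (card (c ` nbrs V E v)))"
      using nb by (intro sum_mono min.mono) auto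
    finally have "30 \<le> (\<Sum>v\<in>V. min 5 (card (c ` nbrs V E v)))" .
    then have "clique_gain y + log_gain y 2 * (1/20 - 9/20 * mono_count V E c) \<le> (\<Sum>v\<in>V. gain V E y c v)"
      using y5 G(4) n(2) by (intro total_gain_six_classes[OF G(1) _ c deg]) auto
    then show ?thesis using y5 by simp
  qed
qed

text \<open>The bound of \<open>gain_four\<close> is \<open>g3\<close> if \<open>Q\<close> has at least three colours; two colours cost \<open>d2\<close> and one colour
  costs \<open>d1\<close>. For \<open>y \<ge> 5\<close> these cases have frequency at most \<open>7 / y\<^sup>2 \<le> 7/25\<close> and \<open>1 / y\<^sup>3 \<le> 1/125\<close>,
  provided that there are as many colourings as the bound says.\<close>

lemma many_vertices_gain:
  fixes V :: "'a set"
  assumes IH: "\<And>(V' :: 'a set) E'. finite V' \<Longrightarrow> sym E' \<Longrightarrow> linked V' E' \<Longrightarrow> \<not> colourable V' E' 4 \<Longrightarrow>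
      card V' < card V \<Longrightarrow> real (card (cols V' E' (Suc y))) \<le> bound y (card V')"
    and G: "finite V" "sym E" "linked V E" "\<not> colourable V E 4" "5 \<le> y"
    and v: "v \<in> V" "4 \<le> card (nbrs V E v)" and C: "bound y (card V) \<le> card (cols V E (Suc y))"
  shows "card (cols V E (Suc y)) * (clique_gain y / 11) < (\<Sum>c\<in>cols V E (Suc y). gain V E y c v)"
proof -
  let ?C = "cols V E (Suc y)"
  have y4: "4 \<le> y" using G(5) by simp
  have finC: "finite ?C" using G(1) by (rule finite_cols)
  have C0: "0 < real (card ?C)" using C bound_pos[OF y4, of "card V"] by linarith
  have L2: "0 < log_gain y 2" using G(5) by (intro log_gain_2_pos) simp
  have L3: "2 * log_gain y 2 \<le> log_gain y 3" using log_gain_linear[of 3 y] G(5) by simp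
  obtain Q where Q: "Q \<subseteq> nbrs V E v" "card Q = 4" using obtain_subset_with_card_n[OF v(2)] by metis
  have QV: "Q \<subseteq> V" using Q(1) by (auto simp: nbrs_def)
  have finQ: "finite Q" using QV G(1) finite_subset by blast
  define g3 where "g3 = (log_gain y 0 + log_gain y 2) / 5 + log_gain y 2 / 6 + log_gain y 3 / 4"
  define d2 where "d2 = log_gain y 3 / 4 - log_gain y 2 / 12"
  define d1 where "d1 = log_gain y 3 / 4 + log_gain y 2 * (11/30)"
  have d: "0 \<le> d1" "0 \<le> d2" using L2 L3 by (auto simp: d1_def d2_def)
  have point: "g3 - d1 * of_bool (card (c ` Q) = 1) - d2 * of_bool (card (c ` Q) = 2) \<le> gain V E y c v"
    if c: "c \<in> ?C" for c
  proof -
    note g = gain_four[OF G(1) y4 c v(1) Q]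
    have sp: "log_gain y 2 * (s - 1) \<le> log_gain y 2 * (spread c Q - 1)" if "s \<le> spread c Q" for s
      using that L2 by (intro mult_left_mono) auto
    have "Q \<noteq> {}" using Q(2) by auto
    then have "1 \<le> card (c ` Q)" using finQ by (simp add: Suc_le_eq card_gt_0_iff)
    then consider "card (c ` Q) = 1" | "card (c ` Q) = 2" | "3 \<le> card (c ` Q)" by linarith
    then show ?thesis
    proof cases
      case 1 then show ?thesis using g sp[OF spread_1[OF finQ _ 1]] Q(2) by (simp add: g3_def d1_def field_simps)
    next
      case 2 then show ?thesis using g sp[OF spread_2[OF finQ _ 2]] Q(2) by (simp add: g3_def d2_def field_simps)
    next
      case 3 then show ?thesis using g sp[OF spread_3[OF finQ _ 3]] Q(2) by (simp add: g3_def field_simps)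
    qed
  qed
  have cnt: "(\<Sum>c\<in>?C. of_bool (card (c ` Q) = k)) = real (card {c \<in> ?C. card (c ` Q) = k})" for k
    using finC by (subst sum_of_bool_eq) (auto intro: arg_cong[where f = card])
  have y3: "125 \<le> real y ^ 3" "25 \<le> real y ^ 2"
    using power_mono[of 5 "real y" 3] power_mono[of 5 "real y" 2] G(5) by simp_all
  have 1: "real (card {c \<in> ?C. card (c ` Q) = 1}) \<le> card ?C / 125"
  proof -
    have "real (card {c \<in> ?C. card (c ` Q) = 1}) * 125 \<le> real (card {c \<in> ?C. card (c ` Q) = 1}) * real y ^ 3"
      using y3 by (intro mult_left_mono) auto
    also have "\<dots> \<le> bound y (card V)" by (rule card_monochromatic_colourings[OF IH G(1-4) y4 QV Q(2)])
    finally show ?thesis using C by simp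
  qed
  have 2: "real (card {c \<in> ?C. card (c ` Q) = 2}) \<le> 7 * card ?C / 25"
  proof -
    have "real (card {c \<in> ?C. card (c ` Q) = 2}) * 25 \<le> real (card {c \<in> ?C. card (c ` Q) = 2}) * real y ^ 2"
      using y3 by (intro mult_left_mono) auto
    also have "\<dots> \<le> 7 * bound y (card V)" by (rule card_two_coloured[OF IH G(1-4) y4 QV Q(2)])
    finally show ?thesis using C by simp
  qed
  have "0 < 6/5 * log_gain y 0 + 3 * log_gain y 2 + 19/20 * log_gain y 3 - log_gain y 4"
    by (rule fine_gain_exceeds_clique_gain[OF G(5)])
  then have "clique_gain y / 11 < g3 - d1 / 125 - d2 * (7 / 25)"
    using L2 L3 by (simp add: clique_gain_def g3_def d1_def d2_def field_simps)
  then have "card ?C * (clique_gain y / 11) < card ?C * (g3 - d1 / 125 - d2 * (7 / 25))"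
    using C0 by (intro mult_strict_left_mono) auto
  also have "\<dots> \<le> card ?C * g3 - d1 * real (card {c \<in> ?C. card (c ` Q) = 1}) - d2 * real (card {c \<in> ?C. card (c ` Q) = 2})"
    using mult_left_mono[OF 1 d(1)] mult_left_mono[OF 2 d(2)] by (simp add: algebra_simps)
  also have "\<dots> = (\<Sum>c\<in>?C. g3 - d1 * of_bool (card (c ` Q) = 1) - d2 * of_bool (card (c ` Q) = 2))"
    by (simp only: sum_subtractf sum_distrib_left[symmetric] sum_constant cnt)
  also have "\<dots> \<le> (\<Sum>c\<in>?C. gain V E y c v)" using point by (rule sum_mono)
  finally show ?thesis .
qed

text \<open>The heart of the proof. Assuming the contrary, the mean total gain is at most \<open>clique_gain y\<close>, and the
  lower bounds for the gain exceed this once the rare vertices with monochromatic neighbourhood are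
  averaged out.\<close>

lemma card_cols_less_bound:
  fixes V :: "'a set"
  assumes IH: "\<And>(V' :: 'a set) E'. finite V' \<Longrightarrow> sym E' \<Longrightarrow> linked V' E' \<Longrightarrow> \<not> colourable V' E' 4 \<Longrightarrow>
      card V' < card V \<Longrightarrow> real (card (cols V' E' (Suc y))) \<le> bound y (card V')"
    and G: "finite V" "sym E" "linked V E" "\<not> colourable V E 4" "4 \<le> y"
    and deg: "\<And>v. v \<in> V \<Longrightarrow> 4 \<le> card (nbrs V E v)" and n: "6 \<le> card V"
  shows "card (cols V E (Suc y)) < bound y (card V)"
proof (rule ccontr)
  let ?C = "cols V E (Suc y)" and ?n = "real (card V)"
  assume "\<not> ?thesis"
  then have C: "bound y (card V) \<le> card ?C" by simp
  then have C0: "0 < real (card ?C)" using bound_pos[OF G(5), of "card V"] by linarith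
  then have ne: "?C \<noteq> {}" by auto
  have L2: "0 < log_gain y 2" using G(5) by (intro log_gain_2_pos) simp
  have "(\<Sum>c\<in>?C. \<Sum>v\<in>V. gain V E y c v) \<le> card ?C * (?n * ln y - ln (card ?C))"
    using sum_gain_le[OF G(1,2) refl ne] G(5) by simp
  also have "\<dots> \<le> card ?C * (?n * ln y - ln (bound y (card V)))"
    using C bound_pos[OF G(5), of "card V"] C0 by (intro mult_left_mono diff_left_mono) auto
  also have "\<dots> = card ?C * clique_gain y" using clique_gain_eq[OF G(5), of "card V"] n by simp
  finally have upper: "(\<Sum>c\<in>?C. \<Sum>v\<in>V. gain V E y c v) \<le> card ?C * clique_gain y" .
  show False
  proof (cases "y = 4 \<or> card V \<le> 10")
    case True
    define e where "e = (if y = 4 then (?n - 5) / 4 else 1/20)"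
    let ?M = "\<Sum>c\<in>?C. mono_count V E c"
    have "(\<Sum>c\<in>?C. clique_gain y + log_gain y 2 * (e - 9/20 * mono_count V E c)) \<le> (\<Sum>c\<in>?C. \<Sum>v\<in>V. gain V E y c v)"
      unfolding e_def by (intro sum_mono few_vertices_gain[OF G(1,2,4,5) deg n True])
    moreover have "(\<Sum>c\<in>?C. clique_gain y + log_gain y 2 * (e - 9/20 * mono_count V E c))
        = card ?C * clique_gain y + log_gain y 2 * (card ?C * e - 9/20 * ?M)"
      by (simp only: sum.distrib sum_subtractf sum_distrib_left[symmetric] sum_constant)
    ultimately have "log_gain y 2 * (card ?C * e - 9/20 * ?M) \<le> 0" using upper by linarith
    then have "card ?C * e \<le> 9/20 * ?M" using L2 by (simp add: mult_le_0_iff)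
    moreover have M: "?M * real y ^ 3 \<le> ?n * card ?C"
    proof -
      have "?M * real y ^ 3 \<le> ?n * bound y (card V)" by (rule sum_mono_count_le[OF IH G deg])
      also have "\<dots> \<le> ?n * card ?C" using C by (intro mult_left_mono) auto
      finally show ?thesis .
    qed
    ultimately have "card ?C * e * real y ^ 3 \<le> 9/20 * ?M * real y ^ 3" by (intro mult_right_mono) auto
    also have "\<dots> = 9/20 * (?M * real y ^ 3)" by (simp only: mult.assoc)
    also have "\<dots> \<le> 9/20 * (?n * card ?C)" using M by (intro mult_left_mono) auto
    finally have "card ?C * (e * real y ^ 3) \<le> card ?C * (9/20 * ?n)" by (simp add: mult.commute mult.left_commute)
    then have le: "e * real y ^ 3 \<le> 9/20 * ?n" using C0 by (simp only: mult_le_cancel_left_pos)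
    show False
    proof (cases "y = 4")
      \<comment> \<open>Here \<open>le\<close> says \<open>16 (n - 5) \<le> 9 n / 20\<close>, which fails from \<open>n = 6\<close> on.\<close>
      case True then show False using le n by (simp add: e_def)
    next
      case False
      then have "5 \<le> y" using G(5) by simp
      then have "125 \<le> real y ^ 3" using power_mono[of 5 "real y" 3] by simp
      moreover have "?n \<le> 10" using False True by simp
      moreover have "real y ^ 3 \<le> 9 * ?n" using le False by (simp add: e_def)
      ultimately show False by linarith
    qed
  next
    case False
    then have y5: "5 \<le> y" and n11: "11 \<le> ?n" using G(5) by auto
    have "card ?C * clique_gain y \<le> ?n * (card ?C * (clique_gain y / 11))"
    proof -
      have "0 \<le> clique_gain y" using clique_gain_ge[OF G(5)] L2 by linarith
      then have "11 * (card ?C * (clique_gain y / 11)) \<le> ?n * (card ?C * (clique_gain y / 11))"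
        using n11 by (intro mult_right_mono) auto
      then show ?thesis by simp
    qed
    also have "\<dots> = (\<Sum>v\<in>V. card ?C * (clique_gain y / 11))" by simp
    also have "\<dots> < (\<Sum>v\<in>V. \<Sum>c\<in>?C. gain V E y c v)"
      using G(1) n11 by (intro sum_strict_mono many_vertices_gain[OF IH G(1-4) y5 _ deg C]) auto
    also have "\<dots> = (\<Sum>c\<in>?C. \<Sum>v\<in>V. gain V E y c v)" by (rule sum.swap)
    finally show False using upper by simp
  qed
qed

section \<open>Growing a connected graph vertex by vertex\<close>

lemma card_cols_insert_le:
  assumes "m \<notin> S" "(m, m) \<notin> E" "sym E" "finite S" "nbrs S E m \<noteq> {}"
  shows "card (cols (insert m S) E (Suc y)) \<le> card (cols S E (Suc y)) * y"
proof -
  have "card (cols (insert m S) E (Suc y)) = (\<Sum>c\<in>cols S E (Suc y). Suc y - card (c ` nbrs S E m))"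
    by (rule card_cols_insert[OF assms(1-4)])
  also have "\<dots> \<le> (\<Sum>c\<in>cols S E (Suc y). y)"
  proof (rule sum_mono)
    fix c
    have "c ` nbrs S E m \<noteq> {}" using assms(5) by simp
    then have "0 < card (c ` nbrs S E m)" using finite_nbrs[OF assms(4)] by (simp add: card_gt_0_iff)
    then show "Suc y - card (c ` nbrs S E m) \<le> y" by simp
  qed
  finally show ?thesis by simp
qed

text \<open>If some colouring gives two neighbours of the new vertex different colours, that colouring has fewer than
  \<open>y\<close> extensions.\<close>

lemma card_cols_insert_less:
  assumes "m \<notin> S" "(m, m) \<notin> E" "sym E" "finite S" "p \<in> nbrs S E m" "q \<in> nbrs S E m"
    and "c \<in> cols S E (Suc y)" "c p \<noteq> c q" "2 \<le> y"
  shows "card (cols (insert m S) E (Suc y)) < card (cols S E (Suc y)) * y"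
proof -
  have fin: "finite (nbrs S E m)" using assms(4) by (rule finite_nbrs)
  have "card (cols (insert m S) E (Suc y)) = (\<Sum>c\<in>cols S E (Suc y). Suc y - card (c ` nbrs S E m))"
    by (rule card_cols_insert[OF assms(1-4)])
  also have "\<dots> < (\<Sum>c\<in>cols S E (Suc y). y)"
  proof (rule sum_strict_mono_ex1)
    show "finite (cols S E (Suc y))" using assms(4) by (rule finite_cols)
    show "\<forall>c\<in>cols S E (Suc y). Suc y - card (c ` nbrs S E m) \<le> y"
    proof
      fix d
      have "d ` nbrs S E m \<noteq> {}" using assms(5) by auto
      then have "0 < card (d ` nbrs S E m)" using fin by (simp add: card_gt_0_iff)
      then show "Suc y - card (d ` nbrs S E m) \<le> y" by simp
    qed
    have "card {c p, c q} \<le> card (c ` nbrs S E m)" using fin assms(5,6) by (intro card_mono) auto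
    then have "Suc y - card (c ` nbrs S E m) < y" using assms(8,9) by simp
    then show "\<exists>c\<in>cols S E (Suc y). Suc y - card (c ` nbrs S E m) < y" using assms(7) by blast
  qed
  finally show ?thesis by simp
qed

lemma linked_step:
  assumes "linked V E" "sym E" "W \<subseteq> V" "W \<noteq> {}" "W \<noteq> V"
  obtains v where "v \<in> V - W" "nbrs W E v \<noteq> {}"
proof -
  obtain u v where "u \<in> W" "v \<in> V - W" "(u, v) \<in> E" using assms unfolding linked_def by meson
  then show thesis using that by (auto simp: nbrs_def)
qed

lemma card_cols_grow:
  assumes "finite V" "sym E" "linked V E" "\<And>v. v \<in> V \<Longrightarrow> (v, v) \<notin> E" "W \<subseteq> V" "W \<noteq> {}"
  shows "card (cols V E (Suc y)) \<le> card (cols W E (Suc y)) * y ^ (card V - card W)"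
  using assms(5,6)
proof (induction "card (V - W)" arbitrary: W)
  case 0
  then have "V - W = {}" using assms(1) by simp
  then have "W = V" using 0 by blast
  then show ?case by simp
next
  case (Suc k)
  then have "W \<noteq> V" by auto
  then obtain v where v: "v \<in> V - W" "nbrs W E v \<noteq> {}" using linked_step[OF assms(3,2) Suc.prems] by metis
  have finW: "finite W" using Suc.prems assms(1) finite_subset by blast
  have "V - insert v W = (V - W) - {v}" by blast
  then have k: "k = card (V - insert v W)" using Suc.hyps(2) v(1) by (simp add: card_Diff_singleton)
  have "card (cols V E (Suc y)) \<le> card (cols (insert v W) E (Suc y)) * y ^ (card V - card (insert v W))"
    by (rule Suc.hyps(1)[OF k]) (use v Suc.prems in auto)
  also have "\<dots> \<le> (card (cols W E (Suc y)) * y) * y ^ (card V - card (insert v W))"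
    using v assms finW by (intro mult_right_mono card_cols_insert_le) auto
  also have "\<dots> = card (cols W E (Suc y)) * y ^ Suc (card V - card (insert v W))" by simp
  also have "Suc (card V - card (insert v W)) = card V - card W"
  proof -
    have "card W < card V" using v Suc.prems(1) assms(1) by (intro psubset_card_mono) auto
    then show ?thesis using v(1) finW by simp
  qed
  finally show ?case .
qed

inductive leaf_grown :: "('a \<times> 'a) set \<Rightarrow> 'a set \<Rightarrow> 'a set \<Rightarrow> bool" for E K where
  base: "leaf_grown E K K"
| step: "leaf_grown E K W \<Longrightarrow> v \<notin> W \<Longrightarrow> nbrs W E v = {p} \<Longrightarrow> leaf_grown E K (insert v W)"

lemma leaf_grown_subset: "leaf_grown E K W \<Longrightarrow> K \<subseteq> W"
  by (induction rule: leaf_grown.induct) auto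

lemma leaf_grown_finite: "leaf_grown E K W \<Longrightarrow> finite K \<Longrightarrow> finite W"
  by (induction rule: leaf_grown.induct) auto

definition five_clique :: "('a \<times> 'a) set \<Rightarrow> 'a set \<Rightarrow> bool" where
  "five_clique E K \<longleftrightarrow> card K = 5 \<and> (\<forall>u\<in>K. \<forall>v\<in>K. u \<noteq> v \<longrightarrow> (u, v) \<in> E)"

lemma five_clique_finite: "five_clique E K \<Longrightarrow> finite K"
  unfolding five_clique_def by (metis card.infinite zero_neq_numeral)

lemma clique_colouring_inj:
  assumes "c \<in> cols K E x" "\<And>u v. u \<in> K \<Longrightarrow> v \<in> K \<Longrightarrow> u \<noteq> v \<Longrightarrow> (u, v) \<in> E"
  shows "inj_on c K"
proof (rule inj_onI, rule ccontr)
  fix u v assume "u \<in> K" "v \<in> K" "c u = c v" "u \<noteq> v"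
  then show False using assms(2)[of u v] assms(1) by (simp add: cols_def proper_on_def)
qed

lemma card_cols_clique:
  assumes "finite K" "sym E" "\<And>v. v \<in> K \<Longrightarrow> (v, v) \<notin> E" "\<And>u v. u \<in> K \<Longrightarrow> v \<in> K \<Longrightarrow> u \<noteq> v \<Longrightarrow> (u, v) \<in> E"
  shows "real (card (cols K E x)) = (\<Prod>i<card K. real x - real i)"
  using assms(1,3,4)
proof (induction K rule: finite_induct)
  case empty
  have "cols {} E x = {\<lambda>_. undefined}" by (auto simp: cols_def proper_on_def)
  then show ?case by simp
next
  case (insert m S)
  have IH: "real (card (cols S E x)) = (\<Prod>i<card S. real x - real i)"
    using insert.prems by (intro insert.IH) auto
  have nb: "nbrs S E m = S" using insert.prems(2)[of _ m] insert.hyps(2) by (auto simp: nbrs_def)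
  have im: "card (c ` S) = card S" if "c \<in> cols S E x" for c
    using clique_colouring_inj[OF that] insert.prems(2) by (intro card_image) blast
  have "card (cols (insert m S) E x) = (\<Sum>c\<in>cols S E x. x - card (c ` nbrs S E m))"
    using insert assms(2) by (intro card_cols_insert) auto
  also have "\<dots> = (\<Sum>c\<in>cols S E x. x - card S)" using im nb by (intro sum.cong refl) simp
  also have "\<dots> = card (cols S E x) * (x - card S)" by simp
  finally have *: "card (cols (insert m S) E x) = card (cols S E x) * (x - card S)" .
  have "real (card (cols (insert m S) E x)) = real (card (cols S E x)) * (real x - real (card S))"
  proof (cases "cols S E x = {}")
    case True
    then show ?thesis using * by simp
  next
    case False
    then obtain c where c: "c \<in> cols S E x" by blast
    have "card S = card (c ` S)" using im[OF c] by simp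
    also have "\<dots> \<le> card {1..x}" using cols_image_subset[OF c order.refl] by (intro card_mono) auto
    finally have "card S \<le> x" by simp
    then show ?thesis using * by (simp add: of_nat_diff)
  qed
  then show ?case using IH insert.hyps by (simp add: mult.commute)
qed

lemma card_cols_leaf_grown:
  assumes "leaf_grown E K W" "finite K" "sym E" "\<And>v. v \<in> W \<Longrightarrow> (v, v) \<notin> E" "1 \<le> x"
  shows "card (cols W E x) = card (cols K E x) * (x - 1) ^ (card W - card K)"
  using assms(1,4)
proof (induction rule: leaf_grown.induct)
  case base
  then show ?case by simp
next
  case (step W v p)
  have fin: "finite W" using leaf_grown_finite[OF step.hyps(1) assms(2)] .
  have "card (cols (insert v W) E x) = (\<Sum>c\<in>cols W E x. x - card (c ` nbrs W E v))"
    using step fin assms(3) by (intro card_cols_insert) auto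
  also have "\<dots> = card (cols W E x) * (x - 1)" using step.hyps(3) by simp
  also have "card (cols W E x) = card (cols K E x) * (x - 1) ^ (card W - card K)"
    using step by auto
  finally have "card (cols (insert v W) E x) = card (cols K E x) * (x - 1) ^ Suc (card W - card K)"
    by simp
  moreover have "Suc (card W - card K) = card (insert v W) - card K"
    using step.hyps(2) fin card_mono[OF fin leaf_grown_subset[OF step.hyps(1)]] by simp
  ultimately show ?case by simp
qed

lemma card_cols_leaf_grown_clique:
  assumes "leaf_grown E K W" "five_clique E K" "sym E" "\<And>v. v \<in> W \<Longrightarrow> (v, v) \<notin> E"
  shows "real (card (cols W E (Suc y))) = bound y (card W)"
proof -
  have K: "finite K" "card K = 5" "K \<subseteq> W"
    using assms(2) five_clique_finite[OF assms(2)] leaf_grown_subset[OF assms(1)] by (simp_all add: five_clique_def)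
  have "card K \<le> card W" using K leaf_grown_finite[OF assms(1)] by (intro card_mono) auto
  then have n: "card W - 4 = Suc (card W - card K)" using K(2) by simp
  have "real (card (cols K E (Suc y))) = (\<Prod>i<card K. real (Suc y) - real i)"
    using assms K by (intro card_cols_clique) (auto simp: five_clique_def)
  also have "\<dots> = (real y + 1) * real y * (real y - 1) * (real y - 2) * (real y - 3)"
    unfolding K(2) by (simp add: eval_nat_numeral)
  finally have cK: "real (card (cols K E (Suc y))) = (real y + 1) * real y * (real y - 1) * (real y - 2) * (real y - 3)" .
  have "card (cols W E (Suc y)) = card (cols K E (Suc y)) * (Suc y - 1) ^ (card W - card K)"
    using assms K by (intro card_cols_leaf_grown) auto
  then have "real (card (cols W E (Suc y))) = real (card (cols K E (Suc y))) * real y ^ (card W - card K)"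
    by simp
  then show ?thesis unfolding bound_def n cK by simp
qed

lemma extend_colouring:
  assumes "c \<in> cols S E x" "m \<notin> S" "(m, m) \<notin> E" "sym E" "k \<in> {1..x}" "k \<notin> c ` nbrs S E m"
  shows "c(m := k) \<in> cols (insert m S) E x"
  using bij_betw_imp_surj_on[OF bij_betw_cols_insert[OF assms(2-4), of x]] assms(1,5,6) by force

text \<open>In a graph grown from a 5-clique by leaves any two vertices can receive different colours: the later one
  has to avoid only its parent and the other vertex.\<close>

lemma leaf_grown_separates:
  assumes "leaf_grown E K W" "five_clique E K" "sym E" "\<And>v. v \<in> W \<Longrightarrow> (v, v) \<notin> E" "4 \<le> y"
    and "p \<in> W" "q \<in> W" "p \<noteq> q"
  shows "\<exists>c\<in>cols W E (Suc y). c p \<noteq> c q"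
  using assms(1,4,6-8)
proof (induction arbitrary: p q rule: leaf_grown.induct)
  case base
  have "real (card (cols K E (Suc y))) = bound y (card K)"
    using base assms by (intro card_cols_leaf_grown_clique[OF leaf_grown.base]) auto
  then have "cols K E (Suc y) \<noteq> {}" using bound_pos[OF assms(5), of "card K"] by auto
  then obtain c where c: "c \<in> cols K E (Suc y)" by blast
  have "inj_on c K" using assms(2) by (intro clique_colouring_inj[OF c]) (auto simp: five_clique_def)
  then have "c p \<noteq> c q" using base.prems(2-4) by (auto dest: inj_onD)
  then show ?case using c by blast
next
  case (step W v r)
  have loopless: "(u, u) \<notin> E" if "u \<in> insert v W" for u using step.prems(1) that by blast
  have extend: "\<exists>k. c(v := k) \<in> cols (insert v W) E (Suc y) \<and> k \<noteq> a" if c: "c \<in> cols W E (Suc y)" for c a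
  proof -
    have "card {c r, a} < card {1..Suc y}" using assms(5) card_insert_le_m1[of 2 "{a}" "c r"] by simp
    then obtain k where "k \<in> {1..Suc y}" "k \<notin> {c r, a}" by (metis card_mono finite.intros leD subsetI)
    then show ?thesis using step.hyps loopless assms(3) c by (intro exI[of _ k] conjI extend_colouring) auto
  qed
  have ex: "\<exists>c\<in>cols (insert v W) E (Suc y). c w \<noteq> c v" if w: "w \<in> W" for w
  proof -
    have "real (card (cols W E (Suc y))) = bound y (card W)"
      using step.hyps assms loopless by (intro card_cols_leaf_grown_clique) auto
    then have "cols W E (Suc y) \<noteq> {}" using bound_pos[OF assms(5), of "card W"] by auto
    then obtain c where c: "c \<in> cols W E (Suc y)" by blast
    obtain k where "c(v := k) \<in> cols (insert v W) E (Suc y)" "k \<noteq> c w" using extend[OF c] by blast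
    moreover have "w \<noteq> v" using w step.hyps(2) by auto
    ultimately show ?thesis by (intro bexI[of _ "c(v := k)"]) auto
  qed
  consider "p \<in> W" "q \<in> W" | "p = v" "q \<in> W" | "p \<in> W" "q = v" using step.prems by blast
  then show ?case
  proof cases
    case 1
    then obtain c where c: "c \<in> cols W E (Suc y)" "c p \<noteq> c q" using step.IH[OF loopless _ _ step.prems(4)] by blast
    obtain k where "c(v := k) \<in> cols (insert v W) E (Suc y)" using extend[OF c(1)] by blast
    moreover have "p \<noteq> v" "q \<noteq> v" using 1 step.hyps(2) by auto
    ultimately show ?thesis using c(2) by (intro bexI[of _ "c(v := k)"]) auto
  next
    case 2
    obtain c where "c \<in> cols (insert v W) E (Suc y)" "c q \<noteq> c v" using ex[OF 2(2)] by blast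
    then show ?thesis using 2 by (intro bexI[of _ c]) auto
  next
    case 3
    then show ?thesis using ex by blast
  qed
qed

text \<open>Continue growing by leaves as long as possible. The first new vertex with two neighbours makes the
  count drop strictly below the bound, and later vertices cannot make up for it.\<close>

lemma leaf_grown_or_less:
  assumes "finite V" "sym E" "linked V E" "\<And>v. v \<in> V \<Longrightarrow> (v, v) \<notin> E" "five_clique E K" "4 \<le> y"
    and "leaf_grown E K W" "W \<subseteq> V"
  shows "leaf_grown E K V \<or> card (cols V E (Suc y)) < bound y (card V)"
  using assms(7,8)
proof (induction "card (V - W)" arbitrary: W)
  case 0
  then have "V - W = {}" using assms(1) by simp
  then have "W = V" using 0 by blast
  then show ?case using 0 by simp
next
  case (Suc k)
  have KW: "K \<subseteq> W" "card K = 5" using leaf_grown_subset Suc.prems assms(5) by (auto simp: five_clique_def)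
  have finW: "finite W" using Suc.prems assms(1) finite_subset by blast
  have W5: "5 \<le> card W" using card_mono[OF finW KW(1)] KW(2) by simp
  have "W \<noteq> V" "W \<noteq> {}" using Suc.hyps(2) W5 by auto
  then obtain v where v: "v \<in> V - W" "nbrs W E v \<noteq> {}" using linked_step[OF assms(3,2) Suc.prems(2)] by metis
  have "V - insert v W = (V - W) - {v}" by blast
  then have k: "k = card (V - insert v W)" using Suc.hyps(2) v(1) by (simp add: card_Diff_singleton)
  show ?case
  proof (cases "\<exists>p. nbrs W E v = {p}")
    case True
    then obtain p where "nbrs W E v = {p}" by blast
    then have "leaf_grown E K (insert v W)" using v(1) by (intro leaf_grown.step[OF Suc.prems(1)]) auto
    then show ?thesis using v(1) Suc.prems(2) by (intro Suc.hyps(1)[OF k]) auto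
  next
    case False
    obtain p where p: "p \<in> nbrs W E v" using v(2) by blast
    then obtain q where q: "q \<in> nbrs W E v" "q \<noteq> p" using False by blast
    have "p \<in> W" "q \<in> W" using p q by (auto simp: nbrs_def)
    then obtain c where c: "c \<in> cols W E (Suc y)" "c p \<noteq> c q"
      using leaf_grown_separates[OF Suc.prems(1) assms(5,2) _ assms(6), of p q] assms(4) Suc.prems(2) q(2) by blast
    have lt: "card (cols (insert v W) E (Suc y)) < card (cols W E (Suc y)) * y"
      using v(1) assms finW by (intro card_cols_insert_less[OF _ _ _ _ p q(1) c]) auto
    have "card (cols V E (Suc y)) \<le> card (cols (insert v W) E (Suc y)) * y ^ (card V - card (insert v W))"
      using v(1) assms(4) Suc.prems(2) by (intro card_cols_grow assms) auto
    also have "\<dots> < (card (cols W E (Suc y)) * y) * y ^ (card V - card (insert v W))"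
      using lt assms(6) by (intro mult_strict_right_mono) auto
    finally have "real (card (cols V E (Suc y))) < real (card (cols W E (Suc y)) * y * y ^ (card V - card (insert v W)))"
      by (rule of_nat_less_iff[THEN iffD2])
    also have "\<dots> = bound y (card W) * real y ^ Suc (card V - card (insert v W))"
      using card_cols_leaf_grown_clique[OF Suc.prems(1) assms(5,2)] assms(4) Suc.prems(2) by (simp add: subset_iff)
    also have "\<dots> = bound y (card W + Suc (card V - card (insert v W)))"
      by (simp only: bound_add[OF W5] mult.commute)
    also have "card W + Suc (card V - card (insert v W)) = card V"
    proof -
      have "card (insert v W) \<le> card V" using v(1) Suc.prems(2) assms(1) by (intro card_mono) auto
      then show ?thesis using v(1) finW by simp
    qed
    finally show ?thesis by blast
  qed
qed

section \<open>Vertex-critical subgraphs\<close>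

lemma colourable_4_iff:
  assumes "finite V"
  shows "colourable V E 4 \<longleftrightarrow> (\<exists>f :: 'a \<Rightarrow> nat. proper_on V E f \<and> f ` V \<subseteq> {1..4})"
proof
  assume "colourable V E 4"
  then obtain f :: "'a \<Rightarrow> nat" where f: "proper_on V E f" "card (f ` V) \<le> 4" by (auto simp: colourable_def)
  have "\<exists>h. h ` (f ` V) \<subseteq> {1..4::nat} \<and> inj_on h (f ` V)"
    using f(2) assms by (intro card_le_inj) auto
  then obtain h :: "nat \<Rightarrow> nat" where h: "h ` (f ` V) \<subseteq> {1..4}" "inj_on h (f ` V)" by blast
  have "proper_on V E (h \<circ> f)" using f(1) h(2) unfolding proper_on_def by (auto dest: inj_onD)
  then show "\<exists>f :: 'a \<Rightarrow> nat. proper_on V E f \<and> f ` V \<subseteq> {1..4}" using h(1) by (intro exI[of _ "h \<circ> f"]) (simp add: image_comp)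
next
  assume "\<exists>f :: 'a \<Rightarrow> nat. proper_on V E f \<and> f ` V \<subseteq> {1..4}"
  then obtain f :: "'a \<Rightarrow> nat" where "proper_on V E f" "f ` V \<subseteq> {1..4}" by blast
  then show "colourable V E 4" using card_mono[of "{1..4::nat}" "f ` V"] unfolding colourable_def by auto
qed

text \<open>A smallest vertex set that does not induce a 4-colourable graph. It is connected, since 4-colourings of the two
  sides of an empty cut fit together, and a vertex of degree at most 3 could be coloured last.\<close>

lemma critical_subgraph:
  assumes "finite V" "sym E" "\<And>v. v \<in> V \<Longrightarrow> (v, v) \<notin> E" "\<not> colourable V E 4"
  obtains W where "W \<subseteq> V" "\<not> colourable W E 4" "linked W E" "\<And>v. v \<in> W \<Longrightarrow> 4 \<le> card (nbrs W E v)"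
proof -
  define P where "P W \<longleftrightarrow> W \<subseteq> V \<and> \<not> colourable W E 4" for W
  have "P V" using assms by (simp add: P_def)
  then obtain W where W: "P W" "\<And>U. P U \<Longrightarrow> card W \<le> card U"
    using ex_has_least_nat[of P V card] by blast
  have WV: "W \<subseteq> V" "\<not> colourable W E 4" using W(1) by (auto simp: P_def)
  have finW: "finite W" using WV assms(1) finite_subset by blast
  have smaller: "\<exists>f :: 'a \<Rightarrow> nat. proper_on U E f \<and> f ` U \<subseteq> {1..4}" if "U \<subset> W" for U
  proof -
    have "card U < card W" using finW that by (rule psubset_card_mono)
    then have "colourable U E 4" using W(2)[of U] that WV by (auto simp: P_def)
    moreover have "finite U" using that finW finite_subset by blast
    ultimately show ?thesis by (simp add: colourable_4_iff)
  qed
  have lk: "linked W E" unfolding linked_def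
  proof (intro allI impI, rule ccontr)
    fix U assume U: "U \<subseteq> W" "U \<noteq> {}" "U \<noteq> W" and "\<not> (\<exists>u\<in>U. \<exists>v\<in>W - U. (u, v) \<in> E)"
    then have no: "(u, v) \<notin> E" "(v, u) \<notin> E" if "u \<in> U" "v \<in> W - U" for u v using that assms(2) by (blast dest: symD)+
    obtain f g :: "'a \<Rightarrow> nat" where fg: "proper_on U E f" "f ` U \<subseteq> {1..4}" "proper_on (W - U) E g" "g ` (W - U) \<subseteq> {1..4}"
      using smaller[of U] smaller[of "W - U"] U by blast
    define h where "h v = (if v \<in> U then f v else g v)" for v
    have "proper_on W E h" unfolding proper_on_def
    proof (intro ballI impI)
      fix u v assume uv: "u \<in> W" "v \<in> W" "(u, v) \<in> E"
      then have "u \<in> U \<longleftrightarrow> v \<in> U" using no by blast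
      then show "h u \<noteq> h v" using fg(1,3) uv by (auto simp: h_def proper_on_def)
    qed
    moreover have "h ` W \<subseteq> {1..4}" using fg(2,4) by (auto simp: h_def)
    ultimately show False using WV(2) finW by (auto simp: colourable_4_iff)
  qed
  have deg: "4 \<le> card (nbrs W E v)" if v: "v \<in> W" for v
  proof (rule ccontr)
    assume small: "\<not> 4 \<le> card (nbrs W E v)"
    obtain f :: "'a \<Rightarrow> nat" where f: "proper_on (W - {v}) E f" "f ` (W - {v}) \<subseteq> {1..4}" using smaller[of "W - {v}"] v by blast
    have "card (f ` nbrs W E v) \<le> card (nbrs W E v)" using finite_nbrs[OF finW] by (rule card_image_le)
    then have "card (f ` nbrs W E v) < card {1..4::nat}" using small by simp
    then have "\<not> {1..4} \<subseteq> f ` nbrs W E v" using card_mono[of "f ` nbrs W E v" "{1..4}"] finite_nbrs[OF finW, of E v] by auto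
    then obtain k where k: "k \<in> {1..4}" "k \<notin> f ` nbrs W E v" by blast
    have "proper_on W E (f(v := k))" unfolding proper_on_def
    proof (intro ballI impI)
      fix a b assume ab: "a \<in> W" "b \<in> W" "(a, b) \<in> E"
      then have ba: "(b, a) \<in> E" using assms(2) by (auto dest: symD)
      have "a \<noteq> b" using ab assms(3) WV(1) by blast
      then consider "a = v" "b \<noteq> v" | "b = v" "a \<noteq> v" | "a \<noteq> v" "b \<noteq> v" by blast
      then show "(f(v := k)) a \<noteq> (f(v := k)) b"
      proof cases
        case 1
        then have "b \<in> nbrs W E v" using ab ba by (simp add: nbrs_def)
        then show ?thesis using 1 k(2) by auto
      next
        case 2
        then have "a \<in> nbrs W E v" using ab by (simp add: nbrs_def)
        then show ?thesis using 2 k(2) by auto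
      next
        case 3
        then show ?thesis using f(1) ab by (simp add: proper_on_def)
      qed
    qed
    moreover have "(f(v := k)) ` W \<subseteq> {1..4}"
    proof
      fix i assume "i \<in> (f(v := k)) ` W"
      then obtain a where a: "a \<in> W" "i = (f(v := k)) a" by blast
      show "i \<in> {1..4}"
      proof (cases "a = v")
        case True then show ?thesis using a(2) k(1) by simp
      next
        case False
        then have "f a \<in> {1..4}" using f(2) a(1) by blast
        then show ?thesis using a(2) False by simp
      qed
    qed
    ultimately show False using WV(2) finW unfolding colourable_4_iff[OF finW] by blast
  qed
  show thesis by (rule that[OF WV lk deg])
qed

text \<open>If the critical subgraph has five vertices, the degree condition makes it a clique from which the graph is
  grown; otherwise it already has strictly fewer colourings than the bound allows.\<close>

lemma card_cols_dichotomy: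
  fixes V :: "'a set"
  assumes "finite V" "sym E" "linked V E" "\<not> colourable V E 4" "4 \<le> y"
  shows "(\<exists>K. five_clique E K \<and> leaf_grown E K V \<and> card (cols V E (Suc y)) = bound y (card V))
    \<or> card (cols V E (Suc y)) < bound y (card V)"
  using assms(1-4)
proof (induction "card V" arbitrary: V E rule: less_induct)
  case less
  show ?case
  proof (cases "\<exists>v\<in>V. (v, v) \<in> E")
    case True
    then have "cols V E (Suc y) = {}" by (auto simp: cols_def proper_on_def)
    then show ?thesis using bound_pos[OF assms(5), of "card V"] by simp
  next
    case False
    then have loopless: "(v, v) \<notin> E" if "v \<in> V" for v using that by blast
    obtain W where W: "W \<subseteq> V" "\<not> colourable W E 4" "linked W E" "\<And>v. v \<in> W \<Longrightarrow> 4 \<le> card (nbrs W E v)"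
      using critical_subgraph[OF less.prems(1,2) loopless less.prems(4)] by blast
    have finW: "finite W" using W(1) less.prems(1) finite_subset by blast
    have cW: "card W \<le> card V" using W(1) less.prems(1) by (rule card_mono[rotated])
    have ndef: "5 \<le> card W"
    proof -
      obtain h :: "'a \<Rightarrow> nat" where h: "bij_betw h W {0..<card W}" using ex_bij_betw_finite_nat[OF finW] by blast
      have "proper_on W E h"
        unfolding proper_on_def
      proof (intro ballI impI)
        fix u v assume uv: "u \<in> W" "v \<in> W" "(u, v) \<in> E"
        then have "u \<noteq> v" using loopless W(1) by blast
        then show "h u \<noteq> h v" using uv bij_betw_imp_inj_on[OF h] by (auto dest: inj_onD)
      qed
      then have "5 \<le> card (h ` W)" by (rule card_colours_ge_5[OF W(2)])
      then show ?thesis using card_image_le[OF finW, of h] by linarith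
    qed
    show ?thesis
    proof (cases "card W = 5")
      case True
      have "five_clique E W" unfolding five_clique_def
      proof (intro conjI ballI impI)
        fix u v assume uv: "u \<in> W" "v \<in> W" "u \<noteq> v"
        have sub: "nbrs W E v \<subseteq> W - {v}" using loopless W(1) uv(2) by (auto simp: nbrs_def)
        have "card (W - {v}) = 4" using True uv(2) by (simp add: card_Diff_singleton)
        then have "nbrs W E v = W - {v}" using sub finW W(4)[OF uv(2)] by (intro card_seteq) auto
        then show "(u, v) \<in> E" using uv by (auto simp: nbrs_def)
      qed (rule True)
      moreover from this have "leaf_grown E W V \<or> card (cols V E (Suc y)) < bound y (card V)"
        by (intro leaf_grown_or_less[OF less.prems(1-3) loopless _ assms(5) leaf_grown.base W(1)])
      ultimately show ?thesis using card_cols_leaf_grown_clique[OF _ _ less.prems(2) loopless] by blast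
    next
      case False
      have "card (cols W E (Suc y)) < bound y (card W)"
      proof (rule card_cols_less_bound[OF _ finW less.prems(2) W(3,2) assms(5) W(4)])
        fix V' :: "'a set" and E'
        assume "finite V'" "sym E'" "linked V' E'" "\<not> colourable V' E' 4" "card V' < card W"
        then show "real (card (cols V' E' (Suc y))) \<le> bound y (card V')"
          using less.hyps[of V' E'] cW by fastforce
      qed (use False ndef in auto)
      then have "real (card (cols W E (Suc y))) * real y ^ (card V - card W) < bound y (card W) * real y ^ (card V - card W)"
        using assms(5) by (intro mult_strict_right_mono) auto
      also have "\<dots> = bound y (card W + (card V - card W))" using bound_add[OF ndef] by simp
      also have "card W + (card V - card W) = card V" using cW by simp
      finally have "real (card (cols W E (Suc y))) * real y ^ (card V - card W) < bound y (card V)" .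
      moreover have "card (cols V E (Suc y)) \<le> card (cols W E (Suc y)) * y ^ (card V - card W)"
        using ndef by (intro card_cols_grow less.prems loopless W(1)) auto
      then have "real (card (cols V E (Suc y))) \<le> real (card (cols W E (Suc y))) * real y ^ (card V - card W)"
        by (metis of_nat_le_iff of_nat_mult of_nat_power)
      ultimately show ?thesis by linarith
    qed
  qed
qed

section \<open>Trees grown on a clique\<close>

lemma linked_insert:
  assumes "linked S E" "sym E" "p \<in> S" "(p, w) \<in> E"
  shows "linked (insert w S) E"
  unfolding linked_def
proof (intro allI impI)
  fix U assume U: "U \<subseteq> insert w S" "U \<noteq> {}" "U \<noteq> insert w S"
  have wp: "(w, p) \<in> E" using assms(2,4) by (auto dest: symD)
  consider "U \<inter> S = {}" | "U \<inter> S = S" | "U \<inter> S \<noteq> {}" "U \<inter> S \<noteq> S" by blast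
  then show "\<exists>u\<in>U. \<exists>v\<in>insert w S - U. (u, v) \<in> E"
  proof cases
    case 1
    then have "w \<in> U" "p \<notin> U" using U assms(3) by auto
    then show ?thesis using wp assms(3) by blast
  next
    case 2
    then have "p \<in> U" "w \<notin> U" using U assms(3) by auto
    then show ?thesis using assms(4) by blast
  next
    case 3
    then obtain u v where "u \<in> U \<inter> S" "v \<in> S - U \<inter> S" "(u, v) \<in> E"
      using assms(1) unfolding linked_def by (meson Int_lower2)
    then show ?thesis by blast
  qed
qed

lemma connected_iff_linked:
  assumes "pair_graph G"
  shows "Digraph_Component.connected (with_proj G) \<longleftrightarrow> pverts G \<noteq> {} \<and> linked (pverts G) (parcs G)"
proof -
  interpret pair_graph G by fact
  have symE: "sym (parcs G)" using pair_sym_arcs by (simp add: symmetric_def)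
  have "parcs (mk_symmetric (with_proj G)) = parcs G"
    using symE by (auto simp: parcs_mk_symmetric dest: symD)
  then have "Digraph_Component.connected (with_proj G) \<longleftrightarrow>
      pverts G \<noteq> {} \<and> (\<forall>u\<in>pverts G. \<forall>v\<in>pverts G. (u, v) \<in> rtrancl_on (pverts G) (parcs G))"
    by (simp add: Digraph_Component.connected_def strongly_connected_def reachable_def)
  also have "\<dots> \<longleftrightarrow> pverts G \<noteq> {} \<and> linked (pverts G) (parcs G)"
  proof (intro conj_cong refl iffI)
    assume reach: "\<forall>u\<in>pverts G. \<forall>v\<in>pverts G. (u, v) \<in> rtrancl_on (pverts G) (parcs G)"
    show "linked (pverts G) (parcs G)" unfolding linked_def
    proof (intro allI impI, rule ccontr)
      fix W assume W: "W \<subseteq> pverts G" "W \<noteq> {}" "W \<noteq> pverts G"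
        and no: "\<not> (\<exists>u\<in>W. \<exists>v\<in>pverts G - W. (u, v) \<in> parcs G)"
      obtain u v where uv: "u \<in> W" "v \<in> pverts G" "v \<notin> W" using W by blast
      then have "(u, v) \<in> rtrancl_on (pverts G) (parcs G)" using reach W(1) by blast
      then have "u \<in> W \<longrightarrow> v \<in> W"
      proof (induction rule: rtrancl_on_induct)
        case (step b c)
        then show ?case using no by blast
      qed simp
      then show False using uv by blast
    qed
  next
    assume lk: "linked (pverts G) (parcs G)"
    show "\<forall>u\<in>pverts G. \<forall>v\<in>pverts G. (u, v) \<in> rtrancl_on (pverts G) (parcs G)"
    proof (intro ballI, rule ccontr)
      fix u v assume uv: "u \<in> pverts G" "v \<in> pverts G" "(u, v) \<notin> rtrancl_on (pverts G) (parcs G)"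
      define W where "W = {w \<in> pverts G. (u, w) \<in> rtrancl_on (pverts G) (parcs G)}"
      have "W \<subseteq> pverts G" "W \<noteq> {}" "W \<noteq> pverts G" using uv by (auto simp: W_def)
      then obtain a b where "a \<in> W" "b \<in> pverts G - W" "(a, b) \<in> parcs G" using lk unfolding linked_def by meson
      then show False by (auto simp: W_def intro: rtrancl_on_into_rtrancl_on)
    qed
  qed
  finally show ?thesis .
qed

lemma pair_graph_intro:
  assumes "finite V" "sym E" "E \<subseteq> V \<times> V" "\<And>v. (v, v) \<notin> E"
  shows "pair_graph \<lparr>pverts = V, parcs = E\<rparr>"
proof
  show "finite (parcs \<lparr>pverts = V, parcs = E\<rparr>)" using assms(1,3) by (simp add: finite_subset)
qed (use assms in \<open>auto simp: symmetric_def\<close>)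

lemma pawalk_verts_pcas: "pcas u c v \<Longrightarrow> pawalk_verts u c = u # map snd c"
  by (induction c arbitrary: u) auto

lemma cycle_with_proj:
  "pre_digraph.cycle (with_proj G) c \<longleftrightarrow>
    (\<exists>u. u \<in> pverts G \<and> set c \<subseteq> parcs G \<and> pcas u c u \<and> distinct (map snd c) \<and> c \<noteq> [])"
  unfolding pre_digraph.cycle_def pre_digraph.awalk_def cas_with_proj_eq awalk_verts_with_proj_eq with_proj_simps
  by (intro ex_cong1) (auto simp: pawalk_verts_pcas)

text \<open>A path inside \<open>S\<close> between the two neighbours has at least one arc, so together with \<open>w\<close> it is a cycle of
  length at least 3.\<close>

lemma two_neighbours_cycle:
  assumes "pair_graph T" "S \<subseteq> pverts T" "linked S (parcs T)" "w \<in> pverts T" "w \<notin> S"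
    and pq: "p \<in> nbrs S (parcs T) w" "q \<in> nbrs S (parcs T) w" "p \<noteq> q"
  shows "\<exists>c. pre_digraph.cycle (with_proj T) c \<and> 3 \<le> length c"
proof -
  interpret T: pair_graph T by fact
  have symE: "sym (parcs T)" using T.pair_sym_arcs by (simp add: symmetric_def)
  have loopless: "(v, v) \<notin> parcs T" for v using T.pair_no_loops[of "(v, v)"] by auto
  have pS: "p \<in> S" "q \<in> S" "(p, w) \<in> parcs T" "(q, w) \<in> parcs T" using pq by (auto simp: nbrs_def)
  define E' where "E' = parcs T \<inter> S \<times> S"
  define H where "H = \<lparr>pverts = S, parcs = E'\<rparr>"
  have H: "pair_graph H" unfolding H_def
    using loopless symE finite_subset[OF assms(2) T.pair_finite_verts]
    by (intro pair_graph_intro) (auto simp: E'_def sym_def)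
  have "linked S E'" unfolding linked_def
  proof (intro allI impI)
    fix W assume W: "W \<subseteq> S" "W \<noteq> {}" "W \<noteq> S"
    then obtain u v where uv: "u \<in> W" "v \<in> S - W" "(u, v) \<in> parcs T" using assms(3) unfolding linked_def by meson
    then have "(u, v) \<in> E'" using W(1) by (auto simp: E'_def)
    then show "\<exists>u\<in>W. \<exists>v\<in>S - W. (u, v) \<in> E'" using uv by blast
  qed
  then have "Digraph_Component.connected (with_proj H)"
    using connected_iff_linked[OF H] pS(1) by (auto simp: H_def)
  interpret H: pair_graph H by fact
  have "sym (parcs H)" using H.pair_sym_arcs by (simp add: symmetric_def)
  then have "parcs (mk_symmetric (with_proj H)) = parcs H" by (auto simp: parcs_mk_symmetric dest: symD)
  then have "p \<rightarrow>\<^sup>*\<^bsub>with_proj H\<^esub> q"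
    using \<open>Digraph_Component.connected (with_proj H)\<close> pS
    by (simp add: Digraph_Component.connected_def strongly_connected_def reachable_def H_def)
  then obtain r where "H.awalk p r q" by (auto simp: H.reachable_awalk)
  then have "H.apath p (H.awalk_to_apath r) q" by (rule H.apath_awalk_to_apath)
  then obtain r where r: "H.awalk p r q" "distinct (pawalk_verts p r)" by (auto simp: H.apath_def)
  have r': "set r \<subseteq> E'" "pcas p r q" using r(1)
    unfolding pre_digraph.awalk_def cas_with_proj_eq with_proj_simps H_def by simp_all
  have "r \<noteq> []" using r'(2) pq(3) by auto
  define c where "c = (w, p) # r @ [(q, w)]"
  have cas: "pcas a (r @ [(q, w)]) w" if "pcas a r q" for a using that by (induction r arbitrary: a) auto
  have "distinct (map snd c)"
  proof -
    have "distinct (p # map snd r)" using r(2) pawalk_verts_pcas[OF r'(2)] by simp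
    moreover have "w \<notin> set (p # map snd r)" using r'(1) pS(1) assms(5) by (auto simp: E'_def)
    ultimately show ?thesis by (auto simp: c_def)
  qed
  moreover have "set c \<subseteq> parcs T"
    using r'(1) pS symE by (auto simp: c_def E'_def dest: symD)
  moreover have "pcas w c w" using cas[OF r'(2)] by (simp add: c_def)
  ultimately have "pre_digraph.cycle (with_proj T) c"
    unfolding cycle_with_proj using assms(4) by (intro exI[of _ w]) (simp add: c_def)
  moreover have "3 \<le> length c" using \<open>r \<noteq> []\<close> by (cases r) (auto simp: c_def)
  ultimately show ?thesis by blast
qed

lemma pcas_nth:
  assumes "pcas u c v" "Suc i < length c"
  shows "fst (c ! Suc i) = snd (c ! i)"
  using assms
proof (induction c arbitrary: u i)
  case (Cons e c)
  then show ?case by (cases i; cases c) auto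
qed simp

lemma pcas_last: "pcas u c v \<Longrightarrow> c \<noteq> [] \<Longrightarrow> fst (c ! 0) = u \<and> snd (c ! (length c - 1)) = v"
proof (induction c arbitrary: u)
  case (Cons e c)
  then show ?case by (cases c) auto
qed simp

lemma closed_successor:
  assumes "pcas u c u" "i < length c"
  shows "fst (c ! (Suc i mod length c)) = snd (c ! i)"
proof (cases "Suc i < length c")
  case True
  then show ?thesis using pcas_nth[OF assms(1)] by simp
next
  case False
  then have "i = length c - 1" "c \<noteq> []" using assms(2) by auto
  then show ?thesis using pcas_last[OF assms(1)] assms(2) by simp
qed

lemma undirected_tree_single: "undirected_tree \<lparr>pverts = {v}, parcs = {}\<rparr>"
proof -
  have G: "pair_graph \<lparr>pverts = {v}, parcs = {}\<rparr>" by (rule pair_graph_intro) (auto simp: sym_def)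
  moreover have "linked {v} {}" by (auto simp: linked_def)
  ultimately show ?thesis using connected_iff_linked[OF G]
    by (simp add: undirected_tree_def cycle_with_proj)
qed

text \<open>A cycle through the new leaf \<open>w\<close> must enter and leave it by \<open>(p, w)\<close> and \<open>(w, p)\<close>. Since a cycle passes
  \<open>p\<close> only once, these two arcs also follow each other at \<open>p\<close>, so the cycle has length 2.\<close>

lemma undirected_tree_add_leaf:
  assumes T: "undirected_tree T" and w: "w \<notin> pverts T" and p: "p \<in> pverts T"
  shows "undirected_tree \<lparr>pverts = insert w (pverts T), parcs = parcs T \<union> {(w, p), (p, w)}\<rparr>" (is "undirected_tree ?T")
proof -
  interpret T: pair_graph T using T by (simp add: undirected_tree_def)
  have symE: "sym (parcs T)" using T.pair_sym_arcs by (simp add: symmetric_def)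
  have arcs: "parcs T \<subseteq> pverts T \<times> pverts T" using T.wellformed' by auto
  have G: "pair_graph ?T"
  proof (rule pair_graph_intro)
    show "sym (parcs T \<union> {(w, p), (p, w)})" using symE by (auto simp: sym_def)
    show "(v, v) \<notin> parcs T \<union> {(w, p), (p, w)}" for v using T.pair_no_loops[of "(v, v)"] w p by auto
  qed (use T.pair_finite_verts arcs p in auto)
  have "linked (pverts T) (parcs T)" "pverts T \<noteq> {}"
    using T connected_iff_linked[of T] by (auto simp: undirected_tree_def)
  then have "linked (pverts T) (parcs T \<union> {(w, p), (p, w)})" unfolding linked_def by blast
  then have "linked (insert w (pverts T)) (parcs T \<union> {(w, p), (p, w)})"
    using symE p by (intro linked_insert[of _ _ p]) (auto simp: sym_def)
  then have con: "Digraph_Component.connected (with_proj ?T)" using connected_iff_linked[OF G] by simp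
  have "\<not> (\<exists>c. pre_digraph.cycle (with_proj ?T) c \<and> 3 \<le> length c)"
  proof
    assume "\<exists>c. pre_digraph.cycle (with_proj ?T) c \<and> 3 \<le> length c"
    then obtain c u where c: "u \<in> insert w (pverts T)" "set c \<subseteq> parcs T \<union> {(w, p), (p, w)}" "pcas u c u"
      "distinct (map snd c)" "3 \<le> length c"
      by (auto simp: cycle_with_proj)
    define n where "n = length c"
    have suc: "fst (c ! (Suc i mod n)) = snd (c ! i)" if "i < n" for i
      using closed_successor[OF c(3)] that by (simp add: n_def)
    have inj: "i = j" if "snd (c ! i) = snd (c ! j)" "i < n" "j < n" for i j
      using that c(4) by (auto simp: n_def distinct_conv_nth)
    have mem: "c ! i \<in> parcs T \<union> {(w, p), (p, w)}" if "i < n" for i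
    proof -
      have "c ! i \<in> set c" using that by (simp add: n_def)
      then show ?thesis using c(2) by blast
    qed
    have pred: "\<exists>j<n. Suc j mod n = i" if "i < n" for i
    proof (cases i)
      case 0
      then show ?thesis using that by (intro exI[of _ "n - 1"]) auto
    next
      case (Suc j)
      then show ?thesis using that by (intro exI[of _ j]) auto
    qed
    have n3: "3 \<le> n" using c(5) by (simp add: n_def)
    show False
    proof (cases "\<exists>j<n. snd (c ! j) = w")
      case True
      then obtain j where j: "j < n" "snd (c ! j) = w" by blast
      then have cj: "c ! j = (p, w)" using mem[OF j(1)] arcs w p by (cases "c ! j") auto
      define i where "i = Suc j mod n"
      have i: "i < n" "fst (c ! i) = w" using suc[OF j(1)] j n3 by (auto simp: i_def)
      then have ci: "c ! i = (w, p)" using mem[OF i(1)] arcs w p by (cases "c ! i") auto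
      obtain k where k: "k < n" "Suc k mod n = j" using pred[OF j(1)] by blast
      have "snd (c ! k) = p" using suc[OF k(1)] k(2) cj by simp
      then have "k = i" using inj[of k i] k(1) i(1) ci by simp
      \<comment> \<open>The arcs at positions \<open>j\<close> and \<open>j + 1\<close> follow each other in both directions, which is
        impossible modulo \<open>n \<ge> 3\<close>.\<close>
      then have "Suc (Suc j mod n) mod n = j" using k(2) by (simp add: i_def)
      then have eq: "Suc (Suc j) mod n = j" by (simp add: mod_Suc_eq)
      show False
      proof (cases "Suc (Suc j) < n")
        case True
        then show False using eq by simp
      next
        case False
        then have "Suc (Suc j) mod n = Suc (Suc j) - n" using j(1) n3 by (subst mod_if) (simp add: le_mod_geq)
        then show False using eq n3 by simp
      qed
    next
      case False
      then have snd: "snd (c ! j) \<noteq> w" if "j < n" for j using that by blast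
      have fst: "fst (c ! i) \<noteq> w" if "i < n" for i
        using pred[OF that] suc snd by metis
      have "set c \<subseteq> parcs T"
      proof
        fix e assume "e \<in> set c"
        then obtain i where "i < n" "e = c ! i" by (auto simp: in_set_conv_nth n_def)
        then show "e \<in> parcs T" using mem[of i] snd[of i] fst[of i] by auto
      qed
      moreover have "u \<noteq> w"
      proof -
        have "c \<noteq> []" "0 < n" using c(5) n3 by auto
        then show ?thesis using fst[of 0] pcas_last[OF c(3)] by metis
      qed
      ultimately have "pre_digraph.cycle (with_proj T) c"
        unfolding cycle_with_proj using c by (intro exI[of _ u]) auto
      then show False using T c(5) by (auto simp: undirected_tree_def)
    qed
  qed
  then show ?thesis using G con by (simp add: undirected_tree_def)
qed

text \<open>Each new leaf is added to the tree that contains its neighbour.\<close>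

lemma leaf_grown_trees:
  fixes K :: "'a set"
  assumes "leaf_grown E K W" "sym E" "\<forall>v\<in>W. (v, v) \<notin> E"
  shows "\<exists>T :: 'a \<Rightarrow> 'a pair_pre_digraph.
    (\<forall>v\<in>K. undirected_tree (T v) \<and> pverts (T v) \<inter> K = {v}) \<and>
    disjoint_family_on (\<lambda>v. pverts (T v)) K \<and> W = (\<Union>v\<in>K. pverts (T v)) \<and>
    E \<inter> W \<times> W = E \<inter> K \<times> K \<union> (\<Union>v\<in>K. parcs (T v))"
  using assms(1,3)
proof (induction rule: leaf_grown.induct)
  case base
  show ?case
    by (intro exI[of _ "\<lambda>v. \<lparr>pverts = {v}, parcs = {}\<rparr>"])
      (auto simp: undirected_tree_single disjoint_family_on_def)
next
  case (step W w p)
  have KW: "K \<subseteq> W" using leaf_grown_subset[OF step.hyps(1)] .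
  have "\<forall>v\<in>W. (v, v) \<notin> E" using step.prems by simp
  from step.IH[OF this]
  obtain T :: "'a \<Rightarrow> 'a pair_pre_digraph" where T0: "\<forall>v\<in>K. undirected_tree (T v) \<and> pverts (T v) \<inter> K = {v}"
    and T3: "disjoint_family_on (\<lambda>v. pverts (T v)) K" and T4: "W = (\<Union>v\<in>K. pverts (T v))"
    and T5: "E \<inter> W \<times> W = E \<inter> K \<times> K \<union> (\<Union>v\<in>K. parcs (T v))"
    by (elim exE conjE) (rule that)
  have T1: "undirected_tree (T v)" and T2: "pverts (T v) \<inter> K = {v}" if "v \<in> K" for v
    by (rule conjunct1[OF bspec[OF T0 that]], rule conjunct2[OF bspec[OF T0 that]])
  have p: "p \<in> W" "(p, w) \<in> E" "\<And>u. u \<in> W \<Longrightarrow> (u, w) \<in> E \<Longrightarrow> u = p" using step.hyps(3) by (auto simp: nbrs_def)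
  then obtain k where k: "k \<in> K" "p \<in> pverts (T k)" using T4 by blast
  have wT: "w \<notin> pverts (T v)" if "v \<in> K" for v using step.hyps(2) T4 that by blast
  define T' where "T' = T(k := \<lparr>pverts = insert w (pverts (T k)), parcs = parcs (T k) \<union> {(w, p), (p, w)}\<rparr>)"
  have v': "pverts (T' v) = (if v = k then insert w (pverts (T v)) else pverts (T v))" for v by (simp add: T'_def)
  have a': "parcs (T' v) = (if v = k then parcs (T v) \<union> {(w, p), (p, w)} else parcs (T v))" for v by (simp add: T'_def)
  have "undirected_tree (T' v)" if "v \<in> K" for v
    using undirected_tree_add_leaf[OF T1[OF k(1)] wT[OF k(1)] k(2)] T1[OF that] by (simp add: T'_def)
  moreover have "pverts (T' v) \<inter> K = {v}" if "v \<in> K" for v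
    using T2[OF that] KW step.hyps(2) by (auto simp: v')
  moreover have "disjoint_family_on (\<lambda>v. pverts (T' v)) K"
    using T3 wT unfolding disjoint_family_on_def v' by auto
  moreover have "insert w W = (\<Union>v\<in>K. pverts (T' v))"
    unfolding T4 v' using k(1) by (auto split: if_splits)
  moreover have "E \<inter> insert w W \<times> insert w W = E \<inter> K \<times> K \<union> (\<Union>v\<in>K. parcs (T' v))"
  proof -
    have "E \<inter> insert w W \<times> insert w W = E \<inter> W \<times> W \<union> {(w, p), (p, w)}"
    proof (intro equalityI subsetI)
      fix z assume z: "z \<in> E \<inter> insert w W \<times> insert w W"
      obtain a b where ab: "z = (a, b)" by (cases z)
      have abE: "(a, b) \<in> E" "(b, a) \<in> E" "a \<in> insert w W" "b \<in> insert w W"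
        using z ab assms(2) by (auto dest: symD)
      have "(w, w) \<notin> E" using step.prems by simp
      then consider "a \<in> W" "b \<in> W" | "a = w" "b \<in> W" | "a \<in> W" "b = w" using abE by auto
      then show "z \<in> E \<inter> W \<times> W \<union> {(w, p), (p, w)}"
      proof cases
        case 1 then show ?thesis using ab abE by simp
      next
        case 2 then show ?thesis using ab abE p(3)[of b] by simp
      next
        case 3 then show ?thesis using ab abE p(3)[of a] by simp
      qed
    next
      fix z assume "z \<in> E \<inter> W \<times> W \<union> {(w, p), (p, w)}"
      then show "z \<in> E \<inter> insert w W \<times> insert w W" using p(1,2) symD[OF assms(2) p(2)] by auto
    qed
    also have "\<dots> = E \<inter> K \<times> K \<union> ((\<Union>v\<in>K. parcs (T v)) \<union> {(w, p), (p, w)})" unfolding T5 by blast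
    also have "(\<Union>v\<in>K. parcs (T v)) \<union> {(w, p), (p, w)} = (\<Union>v\<in>K. parcs (T' v))"
      unfolding a' using k(1) by (auto split: if_splits)
    finally show ?thesis .
  qed
  ultimately show ?case by (intro exI[of _ T']) blast
qed

text \<open>Grow the clique inside all the trees, keeping the part reached in every tree connected. A tree that is not
  yet exhausted has an edge leaving that part, and its new end vertex has no second neighbour there, by
  \<open>two_neighbours_cycle\<close>; no edge of the clique or of another tree ends in it.\<close>

lemma K5_with_trees_leaf_grown:
  assumes "pair_graph G" "K5_with_trees G"
  obtains K where "five_clique (parcs G) K" "leaf_grown (parcs G) K (pverts G)"
proof -
  interpret G: pair_graph G by fact
  have symE: "sym (parcs G)" using G.pair_sym_arcs by (simp add: symmetric_def)
  from assms(2)[unfolded K5_with_trees_def]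
  obtain C :: "'a pair_pre_digraph" and T :: "'a \<Rightarrow> 'a pair_pre_digraph" where C: "complete_digraph 5 (with_proj C)"
    and T0: "\<forall>v\<in>pverts C. undirected_tree (T v) \<and> pverts (T v) \<inter> pverts C = {v}"
    and disj: "disjoint_family_on (\<lambda>v. pverts (T v)) (pverts C)"
    and Gv: "pverts G = (\<Union>v \<in> pverts C. pverts (T v))" and Ga: "parcs G = parcs C \<union> (\<Union>v \<in> pverts C. parcs (T v))"
    by (elim exE conjE) (rule that)
  have T1: "undirected_tree (T v)" and T2: "pverts (T v) \<inter> pverts C = {v}" if "v \<in> pverts C" for v
    by (rule conjunct1[OF bspec[OF T0 that]], rule conjunct2[OF bspec[OF T0 that]])
  define K where "K = pverts C"
  have arcsC: "parcs C = {(u, v). (u, v) \<in> K \<times> K \<and> u \<noteq> v}" "card K = 5"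
    using C by (auto simp: complete_digraph_def K_def)
  have clique: "five_clique (parcs G) K" using arcsC Ga by (auto simp: five_clique_def)
  have tree: "pair_graph (T v)" "linked (pverts (T v)) (parcs (T v))"
      "\<not> (\<exists>c. pre_digraph.cycle (with_proj (T v)) c \<and> 3 \<le> length c)" if "v \<in> K" for v
    using T1[of v] that connected_iff_linked[of "T v"] by (auto simp: undirected_tree_def K_def)
  have root: "v \<in> pverts (T v)" if "v \<in> K" for v using T2[of v] that by (auto simp: K_def)
  have KV: "K \<subseteq> pverts G" using root Gv by (auto simp: K_def)
  have arcsT: "parcs (T v) \<subseteq> pverts (T v) \<times> pverts (T v)" if "v \<in> K" for v
  proof -
    interpret pair_graph "T v" using tree(1)[OF that] .
    show ?thesis using wellformed' by auto
  qed
  have symT: "sym (parcs (T v))" if "v \<in> K" for v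
  proof -
    interpret pair_graph "T v" using tree(1)[OF that] .
    show ?thesis using pair_sym_arcs by (simp add: symmetric_def)
  qed
  have "leaf_grown (parcs G) K (pverts G)"
    if "leaf_grown (parcs G) K W" "W \<subseteq> pverts G" "\<And>v. v \<in> K \<Longrightarrow> linked (W \<inter> pverts (T v)) (parcs (T v))" for W
    using that
  proof (induction "card (pverts G - W)" arbitrary: W)
    case 0
    then have "pverts G - W = {}" using G.pair_finite_verts by simp
    then have "W = pverts G" using 0 by blast
    then show ?case using 0 by simp
  next
    case (Suc k)
    have KW: "K \<subseteq> W" using leaf_grown_subset[OF Suc.prems(1)] .
    have "pverts G - W \<noteq> {}"
    proof
      assume e: "pverts G - W = {}"
      show False using Suc.hyps(2) unfolding e by simp
    qed
    then obtain v x where v: "v \<in> K" "x \<in> pverts (T v)" "x \<notin> W" using Gv by (auto simp: K_def)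
    define S where "S = W \<inter> pverts (T v)"
    have "S \<subseteq> pverts (T v)" "S \<noteq> {}" "S \<noteq> pverts (T v)" using v root KW by (auto simp: S_def)
    then obtain u w where uw: "u \<in> S" "w \<in> pverts (T v) - S" "(u, w) \<in> parcs (T v)"
      using tree(2)[OF v(1)] unfolding linked_def by meson
    have w: "w \<in> pverts (T v)" "w \<notin> W" "w \<notin> S" using uw by (auto simp: S_def)
    have wv: "v' = v" if "v' \<in> K" "w \<in> pverts (T v')" for v'
      using disj that w(1) v(1) unfolding disjoint_family_on_def K_def by blast
    have nb: "nbrs W (parcs G) w = nbrs S (parcs (T v)) w"
    proof (intro equalityI subsetI)
      fix a assume a: "a \<in> nbrs W (parcs G) w"
      then have "(a, w) \<in> parcs G" "a \<in> W" by (auto simp: nbrs_def)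
      moreover have "(a, w) \<notin> parcs C" using arcsC w(2) KW by auto
      ultimately obtain v' where v': "v' \<in> K" "(a, w) \<in> parcs (T v')" using Ga by (auto simp: K_def)
      then have "v' = v" using arcsT wv by blast
      then show "a \<in> nbrs S (parcs (T v)) w" using v' \<open>a \<in> W\<close> arcsT by (auto simp: nbrs_def S_def)
    next
      fix a assume "a \<in> nbrs S (parcs (T v)) w"
      then show "a \<in> nbrs W (parcs G) w" using v(1) Ga by (auto simp: nbrs_def S_def K_def)
    qed
    have uS: "u \<in> nbrs S (parcs (T v)) w" using uw by (simp add: nbrs_def)
    have "a = u" if "a \<in> nbrs S (parcs (T v)) w" for a
    proof (rule ccontr)
      assume "a \<noteq> u"
      then show False
        using two_neighbours_cycle[OF tree(1)[OF v(1)] _ _ w(1) w(3) that uS] tree(3)[OF v(1)] Suc.prems(3)[OF v(1)]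
        by (auto simp: S_def)
    qed
    then have single: "nbrs W (parcs G) w = {u}" unfolding nb using uS by blast
    have wG: "w \<in> pverts G" using w(1) v(1) Gv by (auto simp: K_def)
    have "pverts G - insert w W = (pverts G - W) - {w}" by blast
    then have k: "k = card (pverts G - insert w W)" using Suc.hyps(2) wG w(2) by (simp add: card_Diff_singleton)
    show ?case
    proof (rule Suc.hyps(1)[OF k])
      show "leaf_grown (parcs G) K (insert w W)" by (rule leaf_grown.step[OF Suc.prems(1) w(2) single])
      show "insert w W \<subseteq> pverts G" using wG Suc.prems(2) by simp
      fix v' assume v': "v' \<in> K"
      show "linked (insert w W \<inter> pverts (T v')) (parcs (T v'))"
      proof (cases "v' = v")
        case True
        have "linked (insert w S) (parcs (T v))"
          using Suc.prems(3)[OF v(1)] symT[OF v(1)] uw by (intro linked_insert[of _ _ u]) (auto simp: S_def)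
        moreover have "insert w W \<inter> pverts (T v) = insert w S" using w(1) by (auto simp: S_def)
        ultimately show ?thesis using True by simp
      next
        case False
        then have "w \<notin> pverts (T v')" using wv v' by blast
        then show ?thesis using Suc.prems(3)[OF v'] by simp
      qed
    qed
  qed
  moreover have "linked (K \<inter> pverts (T v)) (parcs (T v))" if "v \<in> K" for v
  proof -
    have "K \<inter> pverts (T v) = {v}" using T2[of v] that by (auto simp: K_def)
    then show ?thesis by (auto simp: linked_def)
  qed
  ultimately have "leaf_grown (parcs G) K (pverts G)" using leaf_grown.base KV by blast
  then show thesis using that clique by blast
qed

lemma leaf_grown_K5_with_trees:
  assumes "pair_graph G" "five_clique (parcs G) K" "leaf_grown (parcs G) K (pverts G)"
  shows "K5_with_trees G"
proof -
  interpret G: pair_graph G by fact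
  have symE: "sym (parcs G)" using G.pair_sym_arcs by (simp add: symmetric_def)
  have arcs: "parcs G \<inter> pverts G \<times> pverts G = parcs G" using G.wellformed' by auto
  have loopless: "(v, v) \<notin> parcs G" for v using G.pair_no_loops[of "(v, v)"] by auto
  have "\<forall>v\<in>pverts G. (v, v) \<notin> parcs G" using loopless by simp
  from leaf_grown_trees[OF assms(3) symE this, unfolded arcs]
  obtain T :: "'a \<Rightarrow> 'a pair_pre_digraph" where T: "\<forall>v\<in>K. undirected_tree (T v) \<and> pverts (T v) \<inter> K = {v}"
    "disjoint_family_on (\<lambda>v. pverts (T v)) K" "pverts G = (\<Union>v\<in>K. pverts (T v))"
    "parcs G = parcs G \<inter> K \<times> K \<union> (\<Union>v\<in>K. parcs (T v))"
    by (elim exE conjE) (rule that)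
  define C where "C = \<lparr>pverts = K, parcs = parcs G \<inter> K \<times> K\<rparr>"
  have C: "pair_graph C" unfolding C_def
    using symE loopless five_clique_finite[OF assms(2)] by (intro pair_graph_intro) (auto simp: sym_def)
  interpret C: pair_graph C by fact
  have "complete_digraph 5 (with_proj C)"
    unfolding complete_digraph_def using C.pair_graphD_graph assms(2) loopless
    by (auto simp: C_def five_clique_def)
  moreover have "pverts C = K" "parcs C = parcs G \<inter> K \<times> K" by (simp_all add: C_def)
  ultimately have "complete_digraph 5 (with_proj C) \<and>
      (\<forall>v\<in>pverts C. undirected_tree (T v) \<and> pverts (T v) \<inter> pverts C = {v}) \<and>
      disjoint_family_on (\<lambda>v. pverts (T v)) (pverts C) \<and>
      pverts G = (\<Union>v\<in>pverts C. pverts (T v)) \<and> parcs G = parcs C \<union> (\<Union>v\<in>pverts C. parcs (T v))"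
    using T by (simp only: simp_thms)
  then show ?thesis unfolding K5_with_trees_def by (rule exI[where x = C, OF exI[where x = T]])
qed

section \<open>The chromatic polynomial\<close>

lemma colourings_eq_cols:
  assumes "pair_graph G"
  shows "colourings G x = cols (pverts G) (parcs G) x"
proof -
  interpret pair_graph G by fact
  show ?thesis unfolding colourings_def cols_def proper_on_def using wellformed' by blast
qed

lemma chromatic_poly_leaf_grown:
  assumes "pair_graph G" "five_clique (parcs G) K" "leaf_grown (parcs G) K (pverts G)"
  shows "chromatic_poly G = (\<Prod>i<5. [:- real i, 1:]) * [:-1, 1:] ^ (card (pverts G) - 5)" (is "_ = ?p")
proof -
  interpret pair_graph G by fact
  have symE: "sym (parcs G)" using pair_sym_arcs by (simp add: symmetric_def)
  have loopless: "(v, v) \<notin> parcs G" for v using pair_no_loops[of "(v, v)"] by auto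
  have K: "finite K" "card K = 5" "K \<subseteq> pverts G"
    using assms(2) five_clique_finite[OF assms(2)] leaf_grown_subset[OF assms(3)] by (simp_all add: five_clique_def)
  have n: "5 \<le> card (pverts G)" using card_mono[OF pair_finite_verts K(3)] K(2) by simp
  have "is_chromatic_poly G ?p" unfolding is_chromatic_poly_def
  proof (intro conjI allI impI)
    have "degree (\<Prod>i<5. [:- real i, 1:]) = 5" by (subst degree_prod_eq_sum_degree) auto
    moreover have "degree ([:-1, 1:] ^ (card (pverts G) - 5) :: real poly) = card (pverts G) - 5"
      by (subst degree_power_eq) auto
    moreover have "(\<Prod>i<5. [:- real i, 1:]) \<noteq> 0" by simp
    ultimately show "degree ?p = card (pverts G)" using n by (subst degree_mult_eq) auto
  next
    fix x :: nat assume x: "0 < x"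
    have "card (cols (pverts G) (parcs G) x) = card (cols K (parcs G) x) * (x - 1) ^ (card (pverts G) - card K)"
      using x loopless by (intro card_cols_leaf_grown assms(3) K symE) auto
    then have "real (card (cols (pverts G) (parcs G) x)) = real (card (cols K (parcs G) x)) * real (x - 1) ^ (card (pverts G) - 5)"
      using K(2) by simp
    also have "real (card (cols K (parcs G) x)) = (\<Prod>i<card K. real x - real i)"
      using loopless assms(2) by (intro card_cols_clique K symE) (auto simp: five_clique_def)
    finally show "poly ?p (real x) = real (card (colourings G x))"
      using x K(2) by (simp add: colourings_eq_cols[OF assms(1)] poly_prod of_nat_diff)
  qed
  then show ?thesis using ex1_chromatic_poly[OF assms(1)] is_chromatic_poly_chromatic_poly[OF assms(1)] by blast
qed

theorem theorem1p3:
  fixes G :: "'a pair_pre_digraph" and n :: nat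
  assumes "pair_graph G"
    and "Digraph_Component.connected (with_proj G)"
    and "chromatic_number G = 5"
    and "n = card (pverts G)"
  shows "(\<forall>y::int. y \<ge> 4 \<longrightarrow>
            poly (shifted_chromatic_poly G) (of_int y) \<le>
              (of_int y + 1) * of_int y ^ (n - 4) * (of_int y - 1) * (of_int y - 2) * (of_int y - 3)) \<and>
         ((\<exists>y::int. y \<ge> 4 \<and>
            poly (shifted_chromatic_poly G) (of_int y) =
              (of_int y + 1) * of_int y ^ (n - 4) * (of_int y - 1) * (of_int y - 2) * (of_int y - 3)) \<longleftrightarrow>
          K5_with_trees G) \<and>
         (K5_with_trees G \<longrightarrow>
          (\<forall>y::real. poly (shifted_chromatic_poly G) y =
              (y + 1) * y ^ (n - 4) * (y - 1) * (y - 2) * (y - 3)))"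
proof -
  interpret pair_graph G by fact
  let ?V = "pverts G" and ?E = "parcs G"
  have symE: "sym ?E" using pair_sym_arcs by (simp add: symmetric_def)
  have lk: "linked ?V ?E" using assms(2) connected_iff_linked[OF assms(1)] by blast
  have nc: "\<not> colourable ?V ?E 4"
  proof
    assume "colourable ?V ?E 4"
    then obtain f :: "'a \<Rightarrow> nat" where f: "proper_on ?V ?E f" "f ` ?V \<subseteq> {1..4}"
      unfolding colourable_4_iff[OF pair_finite_verts] by blast
    have "restrict f ?V \<in> cols ?V ?E 4" using f by (auto simp: cols_def proper_on_def)
    then have "colourings G 4 \<noteq> {}" using colourings_eq_cols[OF assms(1)] by blast
    then have "chromatic_number G \<le> 4" unfolding chromatic_number_def by (rule Least_le)
    then show False using assms(3) by simp
  qed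
  have val: "poly (shifted_chromatic_poly G) (of_int y) = card (cols ?V ?E (Suc (nat y)))" if "y \<ge> 4" for y :: int
  proof -
    have "real_of_int y + 1 = real (Suc (nat y))" using that by simp
    then have "poly (shifted_chromatic_poly G) (of_int y) = poly (chromatic_poly G) (real (Suc (nat y)))"
      by (simp only: poly_shifted_chromatic_poly)
    also have "\<dots> = card (colourings G (Suc (nat y)))"
      using is_chromatic_poly_chromatic_poly[OF assms(1)] unfolding is_chromatic_poly_def by blast
    finally show ?thesis by (simp add: colourings_eq_cols[OF assms(1)])
  qed
  have rhs: "(of_int y + 1) * of_int y ^ (n - 4) * (of_int y - 1) * (of_int y - 2) * (of_int y - 3) = bound (nat y) (card ?V)"
    if "y \<ge> 4" for y :: int
    using that by (simp add: bound_def assms(4))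
  have dich: "K5_with_trees G \<and> card (cols ?V ?E (Suc (nat y))) = bound (nat y) (card ?V)
      \<or> card (cols ?V ?E (Suc (nat y))) < bound (nat y) (card ?V)" if "y \<ge> 4" for y :: int
  proof -
    have "4 \<le> nat y" using that by simp
    from card_cols_dichotomy[OF pair_finite_verts symE lk nc this] show ?thesis
      using leaf_grown_K5_with_trees[OF assms(1)] by blast
  qed
  have le: "\<forall>y::int. y \<ge> 4 \<longrightarrow> poly (shifted_chromatic_poly G) (of_int y) \<le>
      (of_int y + 1) * of_int y ^ (n - 4) * (of_int y - 1) * (of_int y - 2) * (of_int y - 3)"
    using dich val rhs by (metis less_eq_real_def)
  have trees: "\<forall>y::real. poly (shifted_chromatic_poly G) y = (y + 1) * y ^ (n - 4) * (y - 1) * (y - 2) * (y - 3)"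
    if K5: "K5_with_trees G"
  proof
    fix y :: real
    obtain K where K: "five_clique ?E K" "leaf_grown ?E K ?V" using K5_with_trees_leaf_grown[OF assms(1) K5] .
    have "card K \<le> card ?V" using leaf_grown_subset[OF K(2)] pair_finite_verts by (intro card_mono) auto
    then have n: "n - 4 = Suc (card ?V - 5)" using K(1) assms(4) by (simp add: five_clique_def)
    show "poly (shifted_chromatic_poly G) y = (y + 1) * y ^ (n - 4) * (y - 1) * (y - 2) * (y - 3)"
      unfolding poly_shifted_chromatic_poly chromatic_poly_leaf_grown[OF assms(1) K] n
      by (simp add: poly_prod eval_nat_numeral algebra_simps)
  qed
  have "K5_with_trees G" if "y \<ge> 4" "poly (shifted_chromatic_poly G) (of_int y) =
      (of_int y + 1) * of_int y ^ (n - 4) * (of_int y - 1) * (of_int y - 2) * (of_int y - 3)" for y :: int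
    using dich[OF that(1)] val[OF that(1)] rhs[OF that(1)] that(2) by simp
  moreover have "\<exists>y::int. y \<ge> 4 \<and> poly (shifted_chromatic_poly G) (of_int y) =
      (of_int y + 1) * of_int y ^ (n - 4) * (of_int y - 1) * (of_int y - 2) * (of_int y - 3)" if "K5_with_trees G"
    using trees[OF that] by (intro exI[of _ 4]) simp
  ultimately show ?thesis using le trees by blast
qed

end
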